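(* Let $\mathbf{k}$ be a commutative ring, and let $H$ and $G$ be two graded $\mathbf{k}$-bialgebras. Let $\alpha\in\mathbb{N}^k$ be a weak composition of length $k$, and let $\sigma\in\mathfrak{S}_k$ be a permutation. Then $$\left(p_{\alpha,\sigma}\text{ for }H\otimes G\right)=\sum_{\substack{\beta,\gamma\in\mathbb{N}^k;\\ \beta+\gamma=\alpha}}\left(p_{\beta,\sigma}\text{ for }H\right)\otimes\left(p_{\gamma,\sigma}\text{ for }G\right)$$ as endomorphisms of $H\otimes G$. Here $\beta+\gamma$ denotes the entrywise sum of $\beta$ and $\gamma$.
   Context: $\mathbb{N}=\{0,1,2,\ldots\}$; $[k]=\{1,2,\ldots,k\}$; $\mathfrak{S}_k$ is the group of permutations of $[k]$. All structures are over the commutative ring $\mathbf{k}$. "Graded" means $\mathbb{N}$-graded; a graded bialgebra $H=\bigoplus_{n\in\mathbb{N}}H_n$ is a bialgebra whose multiplication, unit, comultiplication and counit are graded maps. Tensor products of graded modules carry the usual grading $(A\otimes B)_n=\bigoplus_{i+j=n}A_i\otimes B_j$, and tensor products of bialgebras are not twisted by signs: $(a\otimes b)(a'\otimes b')=aa'\otimes bb'$. For a graded bialgebra $H$: $p_n:H\to H$ is the canonical projection onto $H_n$. The maps $m^{[k]}:H^{\otimes k}\to H$ and $\Delta^{[k]}:H\to H^{\otimes k}$ are the $k$-fold iterated multiplication and comultiplication ($m^{[0]}=u$ is the unit map, $\Delta^{[0]}=\epsilon$ is the counit). The group $\mathfrak{S}_k$ acts on $H^{\otimes k}$ from the left by $\sigma\cdot(h_1\otimes\cdots\otimes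 h_k)=h_{\sigma^{-1}(1)}\otimes\cdots\otimes h_{\sigma^{-1}(k)}$. A weak composition is a finite tuple of nonnegative integers. For $\alpha=(\alpha_1,\ldots,\alpha_k)\in\mathbb{N}^k$, let $P_\alpha:=p_{\alpha_1}\otimes\cdots\otimes p_{\alpha_k}$. For $\alpha\in\mathbb{N}^k$ and $\sigma\in\mathfrak{S}_k$, define $p_{\alpha,\sigma}:=m^{[k]}\circ P_\alpha\circ\sigma^{-1}\circ\Delta^{[k]}:H\to H$, where $\sigma^{-1}$ means the action of $\sigma^{-1}$ on $H^{\otimes k}$. The notation "$p_{\alpha,\sigma}$ for $H$" indicates that this endomorphism is formed for the graded bialgebra $H$. *)

theory Defs
  imports "HOL-Algebra.Module" "HOL-Algebra.AbelCoset" "HOL-Combinatorics.Permutations"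
begin

section \<open>Linear maps, spans, quotients, free modules\<close>

definition linear_map ::
  "('a, 'r) ring_scheme \<Rightarrow> ('a, 'b, 'm) module_scheme \<Rightarrow> ('a, 'c, 'n) module_scheme \<Rightarrow> ('b \<Rightarrow> 'c) \<Rightarrow> bool"
  where "linear_map R M N f \<longleftrightarrow>
    f \<in> carrier M \<rightarrow> carrier N \<and>
    (\<forall>x\<in>carrier M. \<forall>y\<in>carrier M. f (x \<oplus>\<^bsub>M\<^esub> y) = f x \<oplus>\<^bsub>N\<^esub> f y) \<and>
    (\<forall>r\<in>carrier R. \<forall>x\<in>carrier M. f (r \<odot>\<^bsub>M\<^esub> x) = r \<odot>\<^bsub>N\<^esub> f x)"

definition submodule_span ::
  "('a, 'r) ring_scheme \<Rightarrow> ('a, 'b, 'm) module_scheme \<Rightarrow> 'b set \<Rightarrow> 'b set"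
  where "submodule_span R M S = \<Inter>{N. submodule N R M \<and> S \<subseteq> N}"

text \<open>
  The module record extends the ring record, so a plain module carries meaningless
  \<^const>\<open>monoid.mult\<close> and \<^const>\<open>one\<close> fields; they are left undefined here.
\<close>

definition self_module :: "('a, 'r) ring_scheme \<Rightarrow> ('a, 'a) module"
  where "self_module R =
    \<lparr>carrier = carrier R, monoid.mult = monoid.mult R, one = \<one>\<^bsub>R\<^esub>, zero = \<zero>\<^bsub>R\<^esub>,
     add = add R, smult = monoid.mult R\<rparr>"

definition free_module :: "('a, 'r) ring_scheme \<Rightarrow> 'x set \<Rightarrow> ('a, 'x \<Rightarrow> 'a) module"
  where "free_module R X =
    \<lparr>carrier = {f. range f \<subseteq> carrier R \<and> finite {x. f x \<noteq> \<zero>\<^bsub>R\<^esub>} \<and> {x. f x \<noteq> \<zero>\<^bsub>R\<^esub>} \<subseteq> X},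
     monoid.mult = undefined, one = undefined,
     zero = (\<lambda>_. \<zero>\<^bsub>R\<^esub>),
     add = (\<lambda>f g x. f x \<oplus>\<^bsub>R\<^esub> g x),
     smult = (\<lambda>r f x. r \<otimes>\<^bsub>R\<^esub> f x)\<rparr>"

definition free_gen :: "('a, 'r) ring_scheme \<Rightarrow> 'x \<Rightarrow> 'x \<Rightarrow> 'a"
  where "free_gen R x = (\<lambda>y. if y = x then \<one>\<^bsub>R\<^esub> else \<zero>\<^bsub>R\<^esub>)"

definition quotient_module :: "('a, 'b, 'm) module_scheme \<Rightarrow> 'b set \<Rightarrow> ('a, 'b set) module"
  where "quotient_module M N =
    \<lparr>carrier = a_rcosets\<^bsub>M\<^esub> N,
     monoid.mult = undefined, one = undefined,
     zero = N,
     add = set_add M,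
     smult = (\<lambda>r C. \<Union>c\<in>C. N +>\<^bsub>M\<^esub> (r \<odot>\<^bsub>M\<^esub> c))\<rparr>"

text \<open>
  Every tensor product below is a free module on a set of generators modulo relations.
  \<open>lift R V \<phi>\<close> is the linear map from such a quotient to \<open>V\<close> sending the class of each
  generator \<open>x\<close> to \<open>\<phi> x\<close>. It is meaningful only if \<open>\<phi>\<close> respects the relations, i.e. is
  multilinear; the image of a coset under the linear extension is then a singleton.
\<close>

definition lift ::
  "('a, 'r) ring_scheme \<Rightarrow> ('a, 'v, 'm) module_scheme \<Rightarrow> ('x \<Rightarrow> 'v) \<Rightarrow> ('x \<Rightarrow> 'a) set \<Rightarrow> 'v"
  where "lift R V \<phi> C =
    the_elem ((\<lambda>c. \<Oplus>\<^bsub>V\<^esub>x\<in>{x. c x \<noteq> \<zero>\<^bsub>R\<^esub>}. c x \<odot>\<^bsub>V\<^esub> \<phi> x) ` C)"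

section \<open>Tensor product of two modules\<close>

definition tensor_relations ::
  "('a, 'r) ring_scheme \<Rightarrow> ('a, 'b, 'm) module_scheme \<Rightarrow> ('a, 'c, 'n) module_scheme \<Rightarrow> ('b \<times> 'c \<Rightarrow> 'a) set"
  where "tensor_relations R M N =
    (let F = free_module R (carrier M \<times> carrier N); \<delta> = free_gen R in
      {\<delta> (x \<oplus>\<^bsub>M\<^esub> x', y) \<ominus>\<^bsub>F\<^esub> (\<delta> (x, y) \<oplus>\<^bsub>F\<^esub> \<delta> (x', y)) |x x' y.
          x \<in> carrier M \<and> x' \<in> carrier M \<and> y \<in> carrier N} \<union>
      {\<delta> (x, y \<oplus>\<^bsub>N\<^esub> y') \<ominus>\<^bsub>F\<^esub> (\<delta> (x, y) \<oplus>\<^bsub>F\<^esub> \<delta> (x, y')) |x y y'.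
          x \<in> carrier M \<and> y \<in> carrier N \<and> y' \<in> carrier N} \<union>
      {\<delta> (r \<odot>\<^bsub>M\<^esub> x, y) \<ominus>\<^bsub>F\<^esub> r \<odot>\<^bsub>F\<^esub> \<delta> (x, y) |r x y.
          r \<in> carrier R \<and> x \<in> carrier M \<and> y \<in> carrier N} \<union>
      {\<delta> (x, r \<odot>\<^bsub>N\<^esub> y) \<ominus>\<^bsub>F\<^esub> r \<odot>\<^bsub>F\<^esub> \<delta> (x, y) |r x y.
          r \<in> carrier R \<and> x \<in> carrier M \<and> y \<in> carrier N})"

definition tensor_kernel ::
  "('a, 'r) ring_scheme \<Rightarrow> ('a, 'b, 'm) module_scheme \<Rightarrow> ('a, 'c, 'n) module_scheme \<Rightarrow> ('b \<times> 'c \<Rightarrow> 'a) set"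
  where "tensor_kernel R M N =
    submodule_span R (free_module R (carrier M \<times> carrier N)) (tensor_relations R M N)"

definition tensor_module ::
  "('a, 'r) ring_scheme \<Rightarrow> ('a, 'b, 'm) module_scheme \<Rightarrow> ('a, 'c, 'n) module_scheme
    \<Rightarrow> ('a, ('b \<times> 'c \<Rightarrow> 'a) set) module"
  where "tensor_module R M N =
    quotient_module (free_module R (carrier M \<times> carrier N)) (tensor_kernel R M N)"

text \<open>The pure tensor of \<open>x\<close> and \<open>y\<close>.\<close>

definition tensor ::
  "('a, 'r) ring_scheme \<Rightarrow> ('a, 'b, 'm) module_scheme \<Rightarrow> ('a, 'c, 'n) module_scheme
    \<Rightarrow> 'b \<Rightarrow> 'c \<Rightarrow> ('b \<times> 'c \<Rightarrow> 'a) set"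
  where "tensor R M N x y =
    tensor_kernel R M N +>\<^bsub>free_module R (carrier M \<times> carrier N)\<^esub> free_gen R (x, y)"

text \<open>The map \<open>f \<otimes> g\<close>; the modules \<open>M\<close> and \<open>N\<close> are the codomains of \<open>f\<close> and \<open>g\<close>.\<close>

definition tensor_map ::
  "('a, 'r) ring_scheme \<Rightarrow> ('a, 'd, 'm) module_scheme \<Rightarrow> ('a, 'e, 'n) module_scheme
    \<Rightarrow> ('b \<Rightarrow> 'd) \<Rightarrow> ('c \<Rightarrow> 'e) \<Rightarrow> ('b \<times> 'c \<Rightarrow> 'a) set \<Rightarrow> ('d \<times> 'e \<Rightarrow> 'a) set"
  where "tensor_map R M N f g =
    lift R (tensor_module R M N) (\<lambda>(x, y). tensor R M N (f x) (g y))"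

text \<open>The canonical isomorphism from \<open>(L \<otimes> M) \<otimes> N\<close> to \<open>L \<otimes> (M \<otimes> N)\<close>.\<close>

definition tensor_assoc ::
  "('a, 'r) ring_scheme \<Rightarrow> ('a, 'b, 'm) module_scheme \<Rightarrow> ('a, 'c, 'n) module_scheme
    \<Rightarrow> ('a, 'd, 'o) module_scheme
    \<Rightarrow> (('b \<times> 'c \<Rightarrow> 'a) set \<times> 'd \<Rightarrow> 'a) set \<Rightarrow> ('b \<times> ('c \<times> 'd \<Rightarrow> 'a) set \<Rightarrow> 'a) set"
  where "tensor_assoc R L M N =
    (let V = tensor_module R L (tensor_module R M N) in
      lift R V (\<lambda>(t, z). lift R V (\<lambda>(x, y).
        tensor R L (tensor_module R M N) x (tensor R M N y z)) t))"

text \<open>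
  The algebra structure on \<open>A \<otimes> B\<close>, without signs:
  \<open>(a \<otimes> b) (a' \<otimes> b') = a a' \<otimes> b b'\<close>.
\<close>

definition tensor_mult ::
  "('a, 'r) ring_scheme \<Rightarrow> ('a, 'b, 'm) module_scheme \<Rightarrow> ('a, 'c, 'n) module_scheme
    \<Rightarrow> ('b \<times> 'c \<Rightarrow> 'a) set \<Rightarrow> ('b \<times> 'c \<Rightarrow> 'a) set \<Rightarrow> ('b \<times> 'c \<Rightarrow> 'a) set"
  where "tensor_mult R A B s t =
    (let V = tensor_module R A B in
      lift R V (\<lambda>(a, b). lift R V (\<lambda>(a', b').
        tensor R A B (a \<otimes>\<^bsub>A\<^esub> a') (b \<otimes>\<^bsub>B\<^esub> b')) t) s)"

definition tensor_algebra ::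
  "('a, 'r) ring_scheme \<Rightarrow> ('a, 'b, 'm) module_scheme \<Rightarrow> ('a, 'c, 'n) module_scheme
    \<Rightarrow> ('a, ('b \<times> 'c \<Rightarrow> 'a) set) module"
  where "tensor_algebra R A B =
    (tensor_module R A B)
      \<lparr>monoid.mult := tensor_mult R A B, one := tensor R A B \<one>\<^bsub>A\<^esub> \<one>\<^bsub>B\<^esub>\<rparr>"

text \<open>
  If \<open>A\<close> and \<open>B\<close> are graded by \<open>g\<close> and \<open>h\<close>, each \<open>g i \<otimes> h j\<close> embeds into \<open>A \<otimes> B\<close>, because
  the homogeneous components are direct summands; the degree-\<open>n\<close> component of \<open>A \<otimes> B\<close> is
  the internal sum of those with \<open>i + j = n\<close>.
\<close>

definition tensor_grade ::
  "('a, 'r) ring_scheme \<Rightarrow> ('a, 'b, 'm) module_scheme \<Rightarrow> ('a, 'c, 'n) module_scheme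
    \<Rightarrow> (nat \<Rightarrow> 'b set) \<Rightarrow> (nat \<Rightarrow> 'c set) \<Rightarrow> nat \<Rightarrow> ('b \<times> 'c \<Rightarrow> 'a) set set"
  where "tensor_grade R A B g h n =
    submodule_span R (tensor_module R A B)
      {tensor R A B x y |x y i j. i + j = n \<and> x \<in> g i \<and> y \<in> h j}"

section \<open>Tensor powers\<close>

text \<open>
  The \<open>k\<close>-th tensor power is generated by lists of length \<open>k\<close>, read as
  \<open>x\<^sub>1 \<otimes> \<dots> \<otimes> x\<^sub>k\<close>, modulo multilinearity. List positions count from \<open>0\<close>. For \<open>k = 0\<close> it is
  free on the empty list, a copy of the base ring.
\<close>

definition tpow_gens :: "('a, 'b, 'm) module_scheme \<Rightarrow> nat \<Rightarrow> 'b list set"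
  where "tpow_gens M k = {xs. length xs = k \<and> set xs \<subseteq> carrier M}"

definition tpow_relations ::
  "('a, 'r) ring_scheme \<Rightarrow> ('a, 'b, 'm) module_scheme \<Rightarrow> nat \<Rightarrow> ('b list \<Rightarrow> 'a) set"
  where "tpow_relations R M k =
    (let F = free_module R (tpow_gens M k); \<delta> = free_gen R in
      {\<delta> (xs @ (x \<oplus>\<^bsub>M\<^esub> y) # ys) \<ominus>\<^bsub>F\<^esub> (\<delta> (xs @ x # ys) \<oplus>\<^bsub>F\<^esub> \<delta> (xs @ y # ys)) |xs x y ys.
          xs @ x # ys \<in> tpow_gens M k \<and> y \<in> carrier M} \<union>
      {\<delta> (xs @ (r \<odot>\<^bsub>M\<^esub> x) # ys) \<ominus>\<^bsub>F\<^esub> r \<odot>\<^bsub>F\<^esub> \<delta> (xs @ x # ys) |r xs x ys.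
          xs @ x # ys \<in> tpow_gens M k \<and> r \<in> carrier R})"

definition tpow_kernel ::
  "('a, 'r) ring_scheme \<Rightarrow> ('a, 'b, 'm) module_scheme \<Rightarrow> nat \<Rightarrow> ('b list \<Rightarrow> 'a) set"
  where "tpow_kernel R M k =
    submodule_span R (free_module R (tpow_gens M k)) (tpow_relations R M k)"

definition tpow_module ::
  "('a, 'r) ring_scheme \<Rightarrow> ('a, 'b, 'm) module_scheme \<Rightarrow> nat \<Rightarrow> ('a, ('b list \<Rightarrow> 'a) set) module"
  where "tpow_module R M k = quotient_module (free_module R (tpow_gens M k)) (tpow_kernel R M k)"

definition tpow_pure ::
  "('a, 'r) ring_scheme \<Rightarrow> ('a, 'b, 'm) module_scheme \<Rightarrow> nat \<Rightarrow> 'b list \<Rightarrow> ('b list \<Rightarrow> 'a) set"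
  where "tpow_pure R M k xs = tpow_kernel R M k +>\<^bsub>free_module R (tpow_gens M k)\<^esub> free_gen R xs"

text \<open>The canonical isomorphism from \<open>M \<otimes> M\<^bsup>\<otimes>k\<^esup>\<close> to \<open>M\<^bsup>\<otimes>(k+1)\<^esup>\<close>.\<close>

definition tpow_Cons ::
  "('a, 'r) ring_scheme \<Rightarrow> ('a, 'b, 'm) module_scheme \<Rightarrow> nat
    \<Rightarrow> ('b \<times> ('b list \<Rightarrow> 'a) set \<Rightarrow> 'a) set \<Rightarrow> ('b list \<Rightarrow> 'a) set"
  where "tpow_Cons R M k =
    (let V = tpow_module R M (Suc k) in
      lift R V (\<lambda>(x, t). lift R V (\<lambda>xs. tpow_pure R M (Suc k) (x # xs)) t))"

text \<open>The endomorphism \<open>f\<^sub>1 \<otimes> \<dots> \<otimes> f\<^sub>k\<close> of the \<open>k\<close>-th tensor power of \<open>M\<close>.\<close>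

definition tpow_map ::
  "('a, 'r) ring_scheme \<Rightarrow> ('a, 'b, 'm) module_scheme \<Rightarrow> ('b \<Rightarrow> 'b) list
    \<Rightarrow> ('b list \<Rightarrow> 'a) set \<Rightarrow> ('b list \<Rightarrow> 'a) set"
  where "tpow_map R M fs =
    (let k = length fs in
      lift R (tpow_module R M k) (\<lambda>xs. tpow_pure R M k (map2 (\<lambda>f x. f x) fs xs)))"

text \<open>
  The left action of permutations: position \<open>i\<close> of the result holds the factor that was at
  position \<open>\<sigma>\<^bsup>-1\<^esup> i\<close>.
\<close>

definition tpow_act ::
  "('a, 'r) ring_scheme \<Rightarrow> ('a, 'b, 'm) module_scheme \<Rightarrow> nat \<Rightarrow> (nat \<Rightarrow> nat)
    \<Rightarrow> ('b list \<Rightarrow> 'a) set \<Rightarrow> ('b list \<Rightarrow> 'a) set"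
  where "tpow_act R M k \<sigma> =
    lift R (tpow_module R M k) (\<lambda>xs. tpow_pure R M k (permute_list (inv_into UNIV \<sigma>) xs))"

section \<open>Graded bialgebras\<close>

record ('a, 'b) graded_bialgebra = "('a, 'b) module" +
  comult :: "'b \<Rightarrow> ('b \<times> 'b \<Rightarrow> 'a) set"
  counit :: "'b \<Rightarrow> 'a"
  grade :: "nat \<Rightarrow> 'b set"

definition homogeneous_components ::
  "('a, 'b, 'm) graded_bialgebra_scheme \<Rightarrow> 'b \<Rightarrow> (nat \<Rightarrow> 'b) \<Rightarrow> bool"
  where "homogeneous_components H h c \<longleftrightarrow>
    (\<forall>n. c n \<in> grade H n) \<and> finite {n. c n \<noteq> \<zero>\<^bsub>H\<^esub>} \<and>
    h = (\<Oplus>\<^bsub>H\<^esub>n\<in>{n. c n \<noteq> \<zero>\<^bsub>H\<^esub>}. c n)"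

locale graded_bialgebra = module R H + H?: ring H
  for R :: "('a, 'r) ring_scheme" (structure)
    and H :: "('a, 'b, 'm) graded_bialgebra_scheme" (structure) +
  assumes smult_mult_left:
      "\<lbrakk>r \<in> carrier R; x \<in> carrier H; y \<in> carrier H\<rbrakk>
        \<Longrightarrow> (r \<odot>\<^bsub>H\<^esub> x) \<otimes>\<^bsub>H\<^esub> y = r \<odot>\<^bsub>H\<^esub> (x \<otimes>\<^bsub>H\<^esub> y)"
    and smult_mult_right:
      "\<lbrakk>r \<in> carrier R; x \<in> carrier H; y \<in> carrier H\<rbrakk>
        \<Longrightarrow> x \<otimes>\<^bsub>H\<^esub> (r \<odot>\<^bsub>H\<^esub> y) = r \<odot>\<^bsub>H\<^esub> (x \<otimes>\<^bsub>H\<^esub> y)"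
    and comult_linear: "linear_map R H (tensor_module R H H) (comult H)"
    and counit_linear: "linear_map R H (self_module R) (counit H)"
    and coassoc:
      "h \<in> carrier H \<Longrightarrow>
        tensor_assoc R H H H (tensor_map R (tensor_module R H H) H (comult H) (\<lambda>x. x) (comult H h)) =
        tensor_map R H (tensor_module R H H) (\<lambda>x. x) (comult H) (comult H h)"
    and counit_left:
      "h \<in> carrier H \<Longrightarrow> lift R H (\<lambda>(x, y). counit H x \<odot>\<^bsub>H\<^esub> y) (comult H h) = h"
    and counit_right:
      "h \<in> carrier H \<Longrightarrow> lift R H (\<lambda>(x, y). counit H y \<odot>\<^bsub>H\<^esub> x) (comult H h) = h"
    and comult_mult:
      "\<lbrakk>x \<in> carrier H; y \<in> carrier H\<rbrakk>
        \<Longrightarrow> comult H (x \<otimes>\<^bsub>H\<^esub> y) = comult H x \<otimes>\<^bsub>tensor_algebra R H H\<^esub> comult H y"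
    and comult_one: "comult H \<one>\<^bsub>H\<^esub> = \<one>\<^bsub>tensor_algebra R H H\<^esub>"
    and counit_mult:
      "\<lbrakk>x \<in> carrier H; y \<in> carrier H\<rbrakk> \<Longrightarrow> counit H (x \<otimes>\<^bsub>H\<^esub> y) = counit H x \<otimes>\<^bsub>R\<^esub> counit H y"
    and counit_one: "counit H \<one>\<^bsub>H\<^esub> = \<one>\<^bsub>R\<^esub>"
    and grade_submodule: "submodule (grade H n) R H"
    and grade_direct_sum: "h \<in> carrier H \<Longrightarrow> \<exists>!c. homogeneous_components H h c"
    and grade_mult:
      "\<lbrakk>x \<in> grade H i; y \<in> grade H j\<rbrakk> \<Longrightarrow> x \<otimes>\<^bsub>H\<^esub> y \<in> grade H (i + j)"
    and grade_one: "\<one>\<^bsub>H\<^esub> \<in> grade H 0"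
    and grade_comult:
      "h \<in> grade H n \<Longrightarrow> comult H h \<in> tensor_grade R H H (grade H) (grade H) n"
    \<comment> \<open>the base ring is concentrated in degree \<open>0\<close>\<close>
    and grade_counit: "\<lbrakk>h \<in> grade H n; n > 0\<rbrakk> \<Longrightarrow> counit H h = \<zero>\<^bsub>R\<^esub>"

text \<open>The projection \<open>p\<^sub>n\<close> onto the \<open>n\<close>-th homogeneous component.\<close>

definition grade_proj :: "('a, 'b, 'm) graded_bialgebra_scheme \<Rightarrow> nat \<Rightarrow> 'b \<Rightarrow> 'b"
  where "grade_proj H n h = (THE c. homogeneous_components H h c) n"

text \<open>
  The graded bialgebra \<open>H \<otimes> G\<close>. Its comultiplication sends \<open>h \<otimes> g\<close> to
  \<open>\<Sum> (h\<^sub>1 \<otimes> g\<^sub>1) \<otimes> (h\<^sub>2 \<otimes> g\<^sub>2)\<close> in Sweedler notation, its counit sends it to \<open>\<epsilon>(h) \<epsilon>(g)\<close>.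
\<close>

definition tensor_comult ::
  "('a, 'r) ring_scheme \<Rightarrow> ('a, 'b, 'm) graded_bialgebra_scheme \<Rightarrow> ('a, 'c, 'n) graded_bialgebra_scheme
    \<Rightarrow> ('b \<times> 'c \<Rightarrow> 'a) set \<Rightarrow> (('b \<times> 'c \<Rightarrow> 'a) set \<times> ('b \<times> 'c \<Rightarrow> 'a) set \<Rightarrow> 'a) set"
  where "tensor_comult R H G =
    (let T = tensor_module R H G; V = tensor_module R T T in
      lift R V (\<lambda>(h, g).
        lift R V (\<lambda>(h\<^sub>1, h\<^sub>2).
          lift R V (\<lambda>(g\<^sub>1, g\<^sub>2).
            tensor R T T (tensor R H G h\<^sub>1 g\<^sub>1) (tensor R H G h\<^sub>2 g\<^sub>2))
          (comult G g))
        (comult H h)))"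

definition tensor_bialgebra ::
  "('a, 'r) ring_scheme \<Rightarrow> ('a, 'b, 'm) graded_bialgebra_scheme \<Rightarrow> ('a, 'c, 'n) graded_bialgebra_scheme
    \<Rightarrow> ('a, ('b \<times> 'c \<Rightarrow> 'a) set) graded_bialgebra"
  where "tensor_bialgebra R H G =
    \<lparr>carrier = carrier (tensor_algebra R H G),
     monoid.mult = monoid.mult (tensor_algebra R H G),
     one = one (tensor_algebra R H G),
     zero = zero (tensor_algebra R H G),
     add = add (tensor_algebra R H G),
     smult = smult (tensor_algebra R H G),
     comult = tensor_comult R H G,
     counit = lift R (self_module R) (\<lambda>(h, g). counit H h \<otimes>\<^bsub>R\<^esub> counit G g),
     grade = tensor_grade R H G (grade H) (grade G)\<rparr>"

section \<open>Iterated (co)multiplication and the maps \<open>p\<^bsub>\<alpha>,\<sigma>\<^esub>\<close>\<close>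

definition iter_mult ::
  "('a, 'r) ring_scheme \<Rightarrow> ('a, 'b, 'm) graded_bialgebra_scheme \<Rightarrow> ('b list \<Rightarrow> 'a) set \<Rightarrow> 'b"
  where "iter_mult R H = lift R H (\<lambda>xs. foldr (monoid.mult H) xs \<one>\<^bsub>H\<^esub>)"

text \<open>
  For \<open>k = 0\<close> the base ring is identified with the \<open>0\<close>-th tensor power by
  \<open>r \<mapsto> r \<cdot> []\<close>.
\<close>

primrec iter_comult ::
  "('a, 'r) ring_scheme \<Rightarrow> ('a, 'b, 'm) graded_bialgebra_scheme \<Rightarrow> nat \<Rightarrow> 'b \<Rightarrow> ('b list \<Rightarrow> 'a) set"
  where
    "iter_comult R H 0 = (\<lambda>h. counit H h \<odot>\<^bsub>tpow_module R H 0\<^esub> tpow_pure R H 0 [])"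
  | "iter_comult R H (Suc k) = (\<lambda>h.
      tpow_Cons R H k (tensor_map R H (tpow_module R H k) (\<lambda>x. x) (iter_comult R H k) (comult H h)))"

text \<open>
  A weak composition of length \<open>k\<close> is a list of naturals of length \<open>k\<close>, and \<open>\<sigma>\<close> permutes the
  positions \<open>{..<k}\<close>.
\<close>

definition p_map ::
  "('a, 'r) ring_scheme \<Rightarrow> ('a, 'b, 'm) graded_bialgebra_scheme \<Rightarrow> nat list \<Rightarrow> (nat \<Rightarrow> nat) \<Rightarrow> 'b \<Rightarrow> 'b"
  where "p_map R H \<alpha> \<sigma> =
    iter_mult R H
    \<circ> tpow_map R H (map (grade_proj H) \<alpha>)
    \<circ> tpow_act R H (length \<alpha>) (inv_into UNIV \<sigma>)
    \<circ> iter_comult R H (length \<alpha>)"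

end

theory Submission
  imports Defs
begin

text \<open>
  Write \<open>T = H \<otimes> G\<close>. The factorwise interchange \<open>\<Phi> : H\<^bsup>\<otimes>k\<^esup> \<times> G\<^bsup>\<otimes>k\<^esup> \<rightarrow> T\<^bsup>\<otimes>k\<^esup>\<close> is compatible with
  iterated multiplication, iterated comultiplication and permutations of the factors:
  \<open>m\<^sub>T (\<Phi>(s, t)) = m\<^sub>H s \<otimes> m\<^sub>G t\<close>, \<open>\<Delta>\<^sub>T (h \<otimes> g) = \<Phi>(\<Delta>\<^sub>H h, \<Delta>\<^sub>G g)\<close>, and \<open>\<sigma> \<Phi>(s, t) = \<Phi>(\<sigma> s, \<sigma> t)\<close>.
  The projection onto the degree-\<open>n\<close> component of \<open>T\<close> is \<open>\<Sum>\<^bsub>i+j=n\<^esub> p\<^sub>i \<otimes> p\<^sub>j\<close>, so expanding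
  multilinearly gives \<open>P\<^sub>\<alpha> \<Phi>(s, t) = \<Sum>\<^bsub>\<beta>+\<gamma>=\<alpha>\<^esub> \<Phi>(P\<^sub>\<beta> s, P\<^sub>\<gamma> t)\<close>. Chaining these identities
  proves the formula on pure tensors, and both sides are linear.
\<close>

section \<open>Linear, bilinear and multilinear maps\<close>

text \<open>Every tensor product here is a concrete quotient of a free module, and
  \<open>lift\<close> is \<open>the_elem\<close> of the image of a coset: it says nothing until the
  map on generators is known to respect the relations. The nested lifts in
  \<open>tensor_mult\<close>, \<open>tensor_comult\<close> and \<open>tpow_Cons\<close> are
  therefore each given, once, a linearity statement and a value on pure tensors; later identities
  are mostly compared on pure tensors. For the same reason \<Phi> is kept as a bilinear map of two
  variables instead of a linear map out of a tensor product of tensor powers, so that extensionality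
  can be applied in one variable at a time. The second obstacle is \<open>grade_proj\<close>, a
  definite description. On H \<otimes> G it has a usable value only after homogeneous components are
  shown to exist and to be unique there. An explicit candidate for the projections settles both at
  once. The sum over \<beta> + \<gamma> = \<alpha> has a purely combinatorial origin: it is the
  expanded product of k sums, one for each tensor factor, the factor with entry a contributing one
  term for each pair with i + j = a.\<close>

lemma linear_mapI:
  assumes "\<And>x. x \<in> carrier M \<Longrightarrow> f x \<in> carrier N"
    and "\<And>x y. x \<in> carrier M \<Longrightarrow> y \<in> carrier M \<Longrightarrow> f (x \<oplus>\<^bsub>M\<^esub> y) = f x \<oplus>\<^bsub>N\<^esub> f y"
    and "\<And>r x. r \<in> carrier R \<Longrightarrow> x \<in> carrier M \<Longrightarrow> f (r \<odot>\<^bsub>M\<^esub> x) = r \<odot>\<^bsub>N\<^esub> f x"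
  shows "linear_map R M N f"
  using assms by (auto simp: linear_map_def)

lemma linear_mapD:
  assumes "linear_map R M N f"
  shows linear_map_closed: "x \<in> carrier M \<Longrightarrow> f x \<in> carrier N"
    and linear_map_add: "x \<in> carrier M \<Longrightarrow> y \<in> carrier M \<Longrightarrow> f (x \<oplus>\<^bsub>M\<^esub> y) = f x \<oplus>\<^bsub>N\<^esub> f y"
    and linear_map_smult: "r \<in> carrier R \<Longrightarrow> x \<in> carrier M \<Longrightarrow> f (r \<odot>\<^bsub>M\<^esub> x) = r \<odot>\<^bsub>N\<^esub> f x"
  using assms by (auto simp: linear_map_def)

lemma linear_map_id: "linear_map R M M (\<lambda>x. x)"
  by (auto simp: linear_map_def)

lemma linear_map_compose:
  assumes "linear_map R L M f" "linear_map R M N g"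
  shows "linear_map R L N (\<lambda>x. g (f x))"
  by (rule linear_mapI) (simp_all add: linear_mapD[OF assms(1)] linear_mapD[OF assms(2)])

context
  fixes R :: "('a, 'r) ring_scheme" and M :: "('a, 'b, 'm) module_scheme"
    and N :: "('a, 'c, 'n) module_scheme"
  assumes M: "module R M" and N: "module R N"
begin

interpretation M: module R M by (rule M)
interpretation N: module R N by (rule N)

text \<open>Preservation of zero is not a clause of \<open>linear_map\<close>; it follows by writing
  the zero vector as zero times itself.\<close>

lemma linear_map_zero:
  assumes "linear_map R M N f"
  shows "f \<zero>\<^bsub>M\<^esub> = \<zero>\<^bsub>N\<^esub>"
proof -
  have "f (\<zero>\<^bsub>R\<^esub> \<odot>\<^bsub>M\<^esub> \<zero>\<^bsub>M\<^esub>) = \<zero>\<^bsub>R\<^esub> \<odot>\<^bsub>N\<^esub> f \<zero>\<^bsub>M\<^esub>"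
    using assms by (intro linear_map_smult) auto
  then show ?thesis
    using linear_map_closed[OF assms] by simp
qed

lemma linear_map_minus:
  assumes "linear_map R M N f" "x \<in> carrier M" "y \<in> carrier M"
  shows "f (x \<ominus>\<^bsub>M\<^esub> y) = f x \<ominus>\<^bsub>N\<^esub> f y"
proof -
  have "f (\<ominus>\<^bsub>M\<^esub> y) \<oplus>\<^bsub>N\<^esub> f y = \<zero>\<^bsub>N\<^esub>"
    using linear_map_zero[OF assms(1)] assms linear_map_add[OF assms(1), of "\<ominus>\<^bsub>M\<^esub> y" y]
    by (simp add: M.l_neg)
  then have "f (\<ominus>\<^bsub>M\<^esub> y) = \<ominus>\<^bsub>N\<^esub> f y"
    using assms linear_map_closed[OF assms(1)] by (metis M.a_inv_closed N.minus_equality)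
  then show ?thesis
    using assms by (simp add: a_minus_def linear_map_add[OF assms(1)])
qed

lemma linear_map_finsum:
  assumes "linear_map R M N f" "finite I" "\<And>i. i \<in> I \<Longrightarrow> g i \<in> carrier M"
  shows "f (\<Oplus>\<^bsub>M\<^esub>i\<in>I. g i) = (\<Oplus>\<^bsub>N\<^esub>i\<in>I. f (g i))"
  using assms(2,3)
proof (induction I)
  case empty
  show ?case by (simp add: linear_map_zero[OF assms(1)])
next
  case (insert i I)
  then show ?case
    by (simp add: Pi_def linear_map_add[OF assms(1)] linear_map_closed[OF assms(1)])
qed

lemma linear_map_sum:
  assumes "linear_map R M N f" "linear_map R M N g"
  shows "linear_map R M N (\<lambda>x. f x \<oplus>\<^bsub>N\<^esub> g x)"
  by (rule linear_mapI)
    (simp_all add: linear_mapD[OF assms(1)] linear_mapD[OF assms(2)] N.smult_r_distr N.a_ac)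

text \<open>The scalars \<open>r\<close> and \<open>s\<close> have to change places, which is
  commutativity of R.\<close>

lemma linear_map_scale:
  assumes "linear_map R M N f" "r \<in> carrier R"
  shows "linear_map R M N (\<lambda>x. r \<odot>\<^bsub>N\<^esub> f x)"
proof (rule linear_mapI)
  fix s x assume "s \<in> carrier R" "x \<in> carrier M"
  then show "r \<odot>\<^bsub>N\<^esub> f (s \<odot>\<^bsub>M\<^esub> x) = s \<odot>\<^bsub>N\<^esub> (r \<odot>\<^bsub>N\<^esub> f x)"
    using assms
    by (simp add: linear_mapD[OF assms(1)] M.R.m_comm flip: N.smult_assoc1)
qed (simp_all add: linear_mapD[OF assms(1)] assms N.smult_r_distr)

lemma linear_map_const_zero: "linear_map R M N (\<lambda>x. \<zero>\<^bsub>N\<^esub>)"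
  by (rule linear_mapI) simp_all

lemma linear_map_finsum_fun:
  assumes "finite I" "\<And>i. i \<in> I \<Longrightarrow> linear_map R M N (f i)"
  shows "linear_map R M N (\<lambda>x. \<Oplus>\<^bsub>N\<^esub>i\<in>I. f i x)"
proof (rule linear_mapI)
  fix x assume x: "x \<in> carrier M"
  then have cl: "\<And>i. i \<in> I \<Longrightarrow> f i x \<in> carrier N"
    using assms(2) by (blast dest: linear_map_closed)
  then show "(\<Oplus>\<^bsub>N\<^esub>i\<in>I. f i x) \<in> carrier N"
    by (intro N.finsum_closed) auto
  fix y assume y: "y \<in> carrier M"
  then have cl': "\<And>i. i \<in> I \<Longrightarrow> f i y \<in> carrier N"
    using assms(2) by (blast dest: linear_map_closed)
  have "(\<Oplus>\<^bsub>N\<^esub>i\<in>I. f i (x \<oplus>\<^bsub>M\<^esub> y)) = (\<Oplus>\<^bsub>N\<^esub>i\<in>I. f i x \<oplus>\<^bsub>N\<^esub> f i y)"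
    using cl cl' linear_map_add[OF assms(2)] x y by (intro N.finsum_cong') auto
  also have "\<dots> = (\<Oplus>\<^bsub>N\<^esub>i\<in>I. f i x) \<oplus>\<^bsub>N\<^esub> (\<Oplus>\<^bsub>N\<^esub>i\<in>I. f i y)"
    using cl cl' by (intro N.finsum_addf) auto
  finally show "(\<Oplus>\<^bsub>N\<^esub>i\<in>I. f i (x \<oplus>\<^bsub>M\<^esub> y)) = \<dots>" .
next
  fix r x assume x: "r \<in> carrier R" "x \<in> carrier M"
  then have cl: "\<And>i. i \<in> I \<Longrightarrow> f i x \<in> carrier N"
    using assms(2) by (blast dest: linear_map_closed)
  have "(\<Oplus>\<^bsub>N\<^esub>i\<in>I. f i (r \<odot>\<^bsub>M\<^esub> x)) = (\<Oplus>\<^bsub>N\<^esub>i\<in>I. r \<odot>\<^bsub>N\<^esub> f i x)"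
    using cl linear_map_smult[OF assms(2)] x by (intro N.finsum_cong') auto
  also have "\<dots> = r \<odot>\<^bsub>N\<^esub> (\<Oplus>\<^bsub>N\<^esub>i\<in>I. f i x)"
    using cl assms(1) x by (intro N.finsum_smult_ldistr[symmetric]) auto
  finally show "(\<Oplus>\<^bsub>N\<^esub>i\<in>I. f i (r \<odot>\<^bsub>M\<^esub> x)) = \<dots>" .
qed

end

text \<open>The module axioms see only these four fields. This carries them from
  \<open>tensor_module\<close> to \<open>tensor_bialgebra\<close>, a record of another type with the
  same underlying module.\<close>

lemma module_cong:
  fixes M :: "('a, 'b, 'm) module_scheme" and M' :: "('a, 'b, 'n) module_scheme"
  assumes M: "module R M"
    and eqs: "carrier M' = carrier M" "add M' = add M" "\<zero>\<^bsub>M'\<^esub> = \<zero>\<^bsub>M\<^esub>" "smult M' = smult M"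
  shows "module R M'"
proof -
  interpret M: module R M by (rule M)
  have "\<exists>y\<in>carrier M. y \<oplus>\<^bsub>M\<^esub> x = \<zero>\<^bsub>M\<^esub>" if "x \<in> carrier M" for x
    using that by (intro bexI[of _ "\<ominus>\<^bsub>M\<^esub> x"]) (auto simp: M.l_neg)
  then show ?thesis
    by (intro moduleI abelian_groupI M.R.is_cring)
      (simp_all add: eqs M.a_ac M.smult_l_distr M.smult_r_distr M.smult_assoc1)
qed

lemma finsum_cong_ring:
  assumes "carrier M = carrier M'" "add M = add M'" "\<zero>\<^bsub>M\<^esub> = \<zero>\<^bsub>M'\<^esub>"
  shows "finsum M = finsum M'"
  by (simp add: fun_eq_iff finsum_def finprod_def assms)

lemma minus_eq_zeroD:
  assumes "abelian_group G" "x \<in> carrier G" "y \<in> carrier G" "x \<ominus>\<^bsub>G\<^esub> y = \<zero>\<^bsub>G\<^esub>"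
  shows "x = y"
proof -
  interpret G: abelian_group G by fact
  show ?thesis
    using assms(2-) G.minus_equality[of x "\<ominus>\<^bsub>G\<^esub> y"] by (simp add: a_minus_def)
qed

lemma linear_map_cong:
  assumes "linear_map R M N f" "module R M" "\<And>x. x \<in> carrier M \<Longrightarrow> f x = g x"
  shows "linear_map R M N g"
proof -
  interpret M: module R M by fact
  show ?thesis
    using assms(1) by (intro linear_mapI) (simp_all add: linear_mapD[OF assms(1)] flip: assms(3))
qed

section \<open>Bilinear maps in curried form\<close>

definition bilinear ::
  "('a, 'r) ring_scheme \<Rightarrow> ('a, 'b, 'm) module_scheme \<Rightarrow> ('a, 'c, 'n) module_scheme
    \<Rightarrow> ('a, 'v, 'o) module_scheme \<Rightarrow> ('b \<Rightarrow> 'c \<Rightarrow> 'v) \<Rightarrow> bool"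
  where "bilinear R M N V \<phi> \<longleftrightarrow>
    (\<forall>x\<in>carrier M. linear_map R N V (\<phi> x)) \<and> (\<forall>y\<in>carrier N. linear_map R M V (\<lambda>x. \<phi> x y))"

lemma bilinearI:
  assumes "\<And>x. x \<in> carrier M \<Longrightarrow> linear_map R N V (\<phi> x)"
    and "\<And>y. y \<in> carrier N \<Longrightarrow> linear_map R M V (\<lambda>x. \<phi> x y)"
  shows "bilinear R M N V \<phi>"
  using assms by (auto simp: bilinear_def)

lemma bilinearD:
  assumes "bilinear R M N V \<phi>"
  shows bilinear_right: "x \<in> carrier M \<Longrightarrow> linear_map R N V (\<phi> x)"
    and bilinear_left: "y \<in> carrier N \<Longrightarrow> linear_map R M V (\<lambda>x. \<phi> x y)"
  using assms by (auto simp: bilinear_def)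

lemma bilinear_closed:
  "bilinear R M N V \<phi> \<Longrightarrow> x \<in> carrier M \<Longrightarrow> y \<in> carrier N \<Longrightarrow> \<phi> x y \<in> carrier V"
  by (meson bilinear_right linear_map_closed)

lemma bilinear_compose:
  assumes "bilinear R M N V \<phi>" "linear_map R M' M f" "linear_map R N' N g" "linear_map R V W h"
  shows "bilinear R M' N' W (\<lambda>x y. h (\<phi> (f x) (g y)))"
proof (rule bilinearI)
  fix x assume "x \<in> carrier M'"
  then show "linear_map R N' W (\<lambda>y. h (\<phi> (f x) (g y)))"
    by (intro linear_map_compose[OF _ assms(4)] linear_map_compose[OF assms(3)]
        bilinear_right[OF assms(1)] linear_map_closed[OF assms(2)])
next
  fix y assume "y \<in> carrier N'"
  then show "linear_map R M' W (\<lambda>x. h (\<phi> (f x) (g y)))"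
    by (intro linear_map_compose[OF _ assms(4)] linear_map_compose[OF assms(2)]
        bilinear_left[OF assms(1)] linear_map_closed[OF assms(3)])
qed

lemmas bilinear_compose_args = bilinear_compose[OF _ _ _ linear_map_id]

lemma bilinear_compose_result:
  "bilinear R M N V \<phi> \<Longrightarrow> linear_map R V W h \<Longrightarrow> bilinear R M N W (\<lambda>x y. h (\<phi> x y))"
  by (rule bilinear_compose[OF _ linear_map_id linear_map_id])

lemma (in abelian_monoid) finsum_Times:
  assumes "finite A" "finite B" "\<And>i j. i \<in> A \<Longrightarrow> j \<in> B \<Longrightarrow> f (i, j) \<in> carrier G"
  shows "(\<Oplus>p\<in>A \<times> B. f p) = (\<Oplus>i\<in>A. \<Oplus>j\<in>B. f (i, j))"
  using assms(1,3)
proof (induction A)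
  case (insert a A)
  have "insert a A \<times> B = Pair a ` B \<union> A \<times> B" by auto
  moreover have "(\<Oplus>p\<in>Pair a ` B \<union> A \<times> B. f p) =
      (\<Oplus>p\<in>Pair a ` B. f p) \<oplus> (\<Oplus>p\<in>A \<times> B. f p)"
    using insert assms(2) by (intro finsum_Un_disjoint) auto
  moreover have "(\<Oplus>p\<in>Pair a ` B. f p) = (\<Oplus>j\<in>B. f (a, j))"
    using insert.prems by (intro finsum_reindex) (auto simp: inj_on_def)
  ultimately show ?case
    using insert by (simp add: Pi_def)
qed simp

text \<open>Distributivity in both arguments. The result is one sum over a product of index sets, so
  that it can later be reindexed in a single step.\<close>

lemma bilinear_finsum:
  assumes M: "module R M" and N: "module R N" and V: "module R V" and b: "bilinear R M N V b"
    and "finite I" "finite J" "\<And>i. i \<in> I \<Longrightarrow> f i \<in> carrier M" "\<And>j. j \<in> J \<Longrightarrow> g j \<in> carrier N"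
  shows "b (finsum M f I) (finsum N g J) = (\<Oplus>\<^bsub>V\<^esub>p\<in>I \<times> J. b (f (fst p)) (g (snd p)))"
proof -
  interpret M: module R M by (rule M)
  interpret N: module R N by (rule N)
  interpret V: module R V by (rule V)
  have "b (finsum M f I) (finsum N g J) = (\<Oplus>\<^bsub>V\<^esub>i\<in>I. b (f i) (finsum N g J))"
    using assms by (intro linear_map_finsum[OF M V bilinear_left[OF b]] N.finsum_closed) auto
  also have "\<dots> = (\<Oplus>\<^bsub>V\<^esub>i\<in>I. \<Oplus>\<^bsub>V\<^esub>j\<in>J. b (f i) (g j))"
    using assms bilinear_closed[OF b]
    by (intro V.finsum_cong' linear_map_finsum[OF N V bilinear_right[OF b]]) (auto intro!: V.finsum_closed)
  also have "\<dots> = (\<Oplus>\<^bsub>V\<^esub>p\<in>I \<times> J. b (f (fst p)) (g (snd p)))"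
    using assms bilinear_closed[OF b]
    by (subst V.finsum_Times) auto
  finally show ?thesis .
qed

lemma bilinear_finsum_fun:
  assumes M: "module R M" and N: "module R N" and V: "module R V"
    and I: "finite I" and b: "\<And>i. i \<in> I \<Longrightarrow> bilinear R M N V (b i)"
  shows "bilinear R M N V (\<lambda>x y. \<Oplus>\<^bsub>V\<^esub>i\<in>I. b i x y)"
  by (intro bilinearI linear_map_finsum_fun[OF N V I] linear_map_finsum_fun[OF M V I]
      bilinear_right[OF b] bilinear_left[OF b])

text \<open>A slot is singled out by splitting the list around it. Closure is a separate clause
  because for k = 0 there is no slot from which membership in V could be read off.\<close>

definition multilinear ::
  "('a, 'r) ring_scheme \<Rightarrow> ('a, 'b, 'm) module_scheme \<Rightarrow> nat
    \<Rightarrow> ('a, 'v, 'o) module_scheme \<Rightarrow> ('b list \<Rightarrow> 'v) \<Rightarrow> bool"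
  where "multilinear R M k V \<phi> \<longleftrightarrow>
    (\<forall>xs\<in>tpow_gens M k. \<phi> xs \<in> carrier V) \<and>
    (\<forall>xs ys. set xs \<subseteq> carrier M \<longrightarrow> set ys \<subseteq> carrier M \<longrightarrow> Suc (length xs + length ys) = k \<longrightarrow>
      linear_map R M V (\<lambda>x. \<phi> (xs @ x # ys)))"

lemma multilinearI:
  assumes "\<And>xs. length xs = k \<Longrightarrow> set xs \<subseteq> carrier M \<Longrightarrow> \<phi> xs \<in> carrier V"
    and "\<And>xs ys. set xs \<subseteq> carrier M \<Longrightarrow> set ys \<subseteq> carrier M \<Longrightarrow> Suc (length xs + length ys) = k \<Longrightarrow>
      linear_map R M V (\<lambda>x. \<phi> (xs @ x # ys))"
  shows "multilinear R M k V \<phi>"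
  using assms by (auto simp: multilinear_def tpow_gens_def)

lemma multilinearD:
  assumes "multilinear R M k V \<phi>"
  shows multilinear_closed: "xs \<in> tpow_gens M k \<Longrightarrow> \<phi> xs \<in> carrier V"
    and multilinear_linear: "set xs \<subseteq> carrier M \<Longrightarrow> set ys \<subseteq> carrier M \<Longrightarrow>
      Suc (length xs + length ys) = k \<Longrightarrow> linear_map R M V (\<lambda>x. \<phi> (xs @ x # ys))"
  using assms by (auto simp: multilinear_def)

text \<open>Permuting moves the free slot to another position and leaves a list whose other entries
  do not depend on \<open>x\<close>, so linearity in the new slot is linearity in the old
  one.\<close>

lemma multilinear_permute:
  assumes \<phi>: "multilinear R M k V \<phi>" and p: "p permutes {..<k}" and M: "module R M"
  shows "multilinear R M k V (\<lambda>xs. \<phi> (permute_list p xs))"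
proof (rule multilinearI)
  interpret M: module R M by (rule M)
  fix xs assume "length xs = k" "set xs \<subseteq> carrier M"
  then show "\<phi> (permute_list p xs) \<in> carrier V"
    using p by (intro multilinear_closed[OF \<phi>]) (auto simp: tpow_gens_def)
next
  interpret M: module R M by (rule M)
  fix xs ys assume lists: "set xs \<subseteq> carrier M" "set ys \<subseteq> carrier M" "Suc (length xs + length ys) = k"
  \<comment> \<open>Entry i of \<open>permute_list p zs\<close> is \<open>zs ! p i\<close>, so the
    slot at \<open>length xs\<close> reappears at its preimage under \<open>p\<close>.\<close>
  define j where "j = inv_into UNIV p (length xs)"
  \<comment> \<open>The zero is a placeholder: position \<open>j\<close> is overwritten by
    \<open>x\<close>.\<close>
  define L where "L = permute_list p (xs @ \<zero>\<^bsub>M\<^esub> # ys)"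
  have j: "j < k"
    using permutes_in_image[OF permutes_inv[OF p], of "length xs"] lists(3) by (simp add: j_def)
  have len: "length L = k" using lists(3) by (simp add: L_def)
  have L: "set L \<subseteq> carrier M"
    using p lists unfolding L_def by (subst set_permute_list) auto
  have eq: "permute_list p (xs @ x # ys) = take j L @ x # drop (Suc j) L" for x
  proof -
    have "permute_list p (xs @ x # ys) = L[j := x]"
    proof (rule nth_equalityI)
      fix i assume "i < length (permute_list p (xs @ x # ys))"
      then have i: "i < k" using lists(3) by simp
      have "p i = length xs \<longleftrightarrow> i = j"
        using p by (metis j_def permutes_inverses)
      then show "permute_list p (xs @ x # ys) ! i = L[j := x] ! i"
        using i lists(3) p j len
        by (auto simp: L_def permute_list_nth nth_list_update nth_append nth_Cons' )
    qed (simp add: L_def)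
    then show ?thesis
      using j len by (simp add: upd_conv_take_nth_drop)
  qed
  show "linear_map R M V (\<lambda>x. \<phi> (permute_list p (xs @ x # ys)))"
    unfolding eq using L j len
    by (intro multilinear_linear[OF \<phi>]) (auto dest: in_set_takeD in_set_dropD)
qed

text \<open>Only the function standing at the free slot meets the variable; it is linear, and it is
  composed with the linear dependence of \<phi> on that slot.\<close>

lemma multilinear_map2:
  assumes \<phi>: "multilinear R M' k V \<phi>" and len: "length fs = k"
    and fs: "\<And>f. f \<in> set fs \<Longrightarrow> linear_map R M M' f"
  shows "multilinear R M k V (\<lambda>xs. \<phi> (map2 (\<lambda>f x. f x) fs xs))"
proof -
  have set: "set (map2 (\<lambda>f x. f x) gs xs) \<subseteq> carrier M'"
    if "set gs \<subseteq> set fs" "set xs \<subseteq> carrier M" for gs xs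
    using that fs by (fastforce dest: set_zip_leftD set_zip_rightD linear_map_closed)
  show ?thesis
  proof (rule multilinearI)
    fix xs assume "length xs = k" "set xs \<subseteq> carrier M"
    then show "\<phi> (map2 (\<lambda>f x. f x) fs xs) \<in> carrier V"
      using set len by (intro multilinear_closed[OF \<phi>]) (simp add: tpow_gens_def)
  next
    fix xs ys assume lists: "set xs \<subseteq> carrier M" "set ys \<subseteq> carrier M" "Suc (length xs + length ys) = k"
    define fs1 f fs2 where "fs1 = take (length xs) fs" "f = fs ! length xs" "fs2 = drop (Suc (length xs)) fs"
    have eq: "fs = fs1 @ f # fs2"
      using lists(3) len unfolding fs1_f_fs2_def by (intro id_take_nth_drop) simp
    have len1: "length fs1 = length xs" "length fs2 = length ys"
      using lists(3) len by (auto simp: fs1_f_fs2_def)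
    have f: "linear_map R M M' f" using eq fs by auto
    have "linear_map R M V
      (\<lambda>x. \<phi> (map2 (\<lambda>f x. f x) fs1 xs @ f x # map2 (\<lambda>f x. f x) fs2 ys))"
      using len1 lists eq
      by (intro linear_map_compose[OF f] multilinear_linear[OF \<phi>] set) auto
    then show "linear_map R M V (\<lambda>x. \<phi> (map2 (\<lambda>f x. f x) fs (xs @ x # ys)))"
      using len1 by (simp add: eq)
  qed
qed

lemma multilinear_Cons:
  assumes \<phi>: "multilinear R M (Suc k) V \<phi>"
  shows multilinear_Cons_tail: "x \<in> carrier M \<Longrightarrow> multilinear R M k V (\<lambda>xs. \<phi> (x # xs))"
    and multilinear_Cons_head: "xs \<in> tpow_gens M k \<Longrightarrow> linear_map R M V (\<lambda>x. \<phi> (x # xs))"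
proof -
  show "multilinear R M k V (\<lambda>xs. \<phi> (x # xs))" if x: "x \<in> carrier M"
  proof (rule multilinearI)
    fix xs ys assume "set xs \<subseteq> carrier M" "set ys \<subseteq> carrier M" "Suc (length xs + length ys) = k"
    then show "linear_map R M V (\<lambda>y. \<phi> (x # xs @ y # ys))"
      using x multilinear_linear[OF \<phi>, of "x # xs" ys] by simp
  qed (use x in \<open>auto intro!: multilinear_closed[OF \<phi>] simp: tpow_gens_def\<close>)
  show "linear_map R M V (\<lambda>x. \<phi> (x # xs))" if "xs \<in> tpow_gens M k"
    using that multilinear_linear[OF \<phi>, of "[]" xs] by (simp add: tpow_gens_def)
qed

text \<open>Induction on the prefix before the free slot. With an empty prefix \<open>x\<close> is
  the left factor of \<open>b\<close>; every further entry in front composes with a multiplication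
  from the left, which is again linear.\<close>

lemma multilinear_foldr:
  assumes A: "module R A" and b: "bilinear R A A A b" and e: "e \<in> carrier A"
  shows "multilinear R A k A (\<lambda>xs. foldr b xs e)"
proof -
  have cl: "foldr b xs e \<in> carrier A" if "set xs \<subseteq> carrier A" for xs
    using that by (induction xs) (auto intro: e bilinear_closed[OF b])
  have "linear_map R A A (\<lambda>x. foldr b (xs @ x # ys) e)"
    if "set xs \<subseteq> carrier A" "set ys \<subseteq> carrier A" for xs ys
    using that
  proof (induction xs)
    case Nil
    then show ?case by (simp add: bilinear_left[OF b cl])
  next
    case (Cons y xs)
    then show ?case
      using linear_map_compose[OF Cons.IH bilinear_right[OF b, of y]] by simp
  qed
  with cl show ?thesis by (intro multilinearI)
qed

section \<open>Free modules, spans and quotients\<close>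

text \<open>The sum inside \<open>lift\<close>, evaluated at a single representative. Thus
  \<open>lift\<close> is \<open>the_elem\<close> of the image of a coset under
  \<open>lin_ext\<close>, and \<open>lin_ext\<close> is linear on the free module before any
  relation is considered.\<close>

definition lin_ext ::
  "('a, 'r) ring_scheme \<Rightarrow> ('a, 'v, 'm) module_scheme \<Rightarrow> ('x \<Rightarrow> 'v) \<Rightarrow> ('x \<Rightarrow> 'a) \<Rightarrow> 'v"
  where "lin_ext R V \<phi> c = (\<Oplus>\<^bsub>V\<^esub>x\<in>{x. c x \<noteq> \<zero>\<^bsub>R\<^esub>}. c x \<odot>\<^bsub>V\<^esub> \<phi> x)"

context
  fixes R :: "('a, 'r) ring_scheme"
  assumes R: "cring R"
begin

interpretation R: cring R by (rule R)

lemma free_module_sels: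
  "carrier (free_module R X) =
    {f. range f \<subseteq> carrier R \<and> finite {x. f x \<noteq> \<zero>\<^bsub>R\<^esub>} \<and> {x. f x \<noteq> \<zero>\<^bsub>R\<^esub>} \<subseteq> X}"
  "\<zero>\<^bsub>free_module R X\<^esub> = (\<lambda>_. \<zero>\<^bsub>R\<^esub>)"
  "c \<oplus>\<^bsub>free_module R X\<^esub> d = (\<lambda>x. c x \<oplus>\<^bsub>R\<^esub> d x)"
  "r \<odot>\<^bsub>free_module R X\<^esub> c = (\<lambda>x. r \<otimes>\<^bsub>R\<^esub> c x)"
  by (simp_all add: free_module_def)

lemma free_module_add_closed:
  assumes "c \<in> carrier (free_module R X)" "d \<in> carrier (free_module R X)"
  shows "(\<lambda>x. c x \<oplus>\<^bsub>R\<^esub> d x) \<in> carrier (free_module R X)"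
proof -
  have "{x. c x \<oplus>\<^bsub>R\<^esub> d x \<noteq> \<zero>\<^bsub>R\<^esub>} \<subseteq> {x. c x \<noteq> \<zero>\<^bsub>R\<^esub>} \<union> {x. d x \<noteq> \<zero>\<^bsub>R\<^esub>}"
    by auto
  with assms show ?thesis
    by (auto simp: free_module_sels image_subset_iff intro: finite_subset)
qed

lemma free_module_smult_closed:
  assumes "r \<in> carrier R" "c \<in> carrier (free_module R X)"
  shows "(\<lambda>x. r \<otimes>\<^bsub>R\<^esub> c x) \<in> carrier (free_module R X)"
proof -
  have "{x. r \<otimes>\<^bsub>R\<^esub> c x \<noteq> \<zero>\<^bsub>R\<^esub>} \<subseteq> {x. c x \<noteq> \<zero>\<^bsub>R\<^esub>}"
    using assms(1) by auto
  with assms show ?thesis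
    by (auto simp: free_module_sels image_subset_iff intro: finite_subset)
qed

lemma free_module_module: "module R (free_module R X)" (is "module R ?F")
proof (rule moduleI)
  show "cring R" by (rule R)
  show "abelian_group ?F"
  proof (rule abelian_groupI)
    fix c assume c: "c \<in> carrier ?F"
    \<comment> \<open>The inverse is taken as the multiple by minus one, since closure under
      scalars, including finiteness of the support, is already available.\<close>
    then have "(\<lambda>x. (\<ominus>\<^bsub>R\<^esub> \<one>\<^bsub>R\<^esub>) \<otimes>\<^bsub>R\<^esub> c x) \<in> carrier ?F"
      by (intro free_module_smult_closed) auto
    moreover have "(\<ominus>\<^bsub>R\<^esub> \<one>\<^bsub>R\<^esub>) \<otimes>\<^bsub>R\<^esub> c x \<oplus>\<^bsub>R\<^esub> c x = \<zero>\<^bsub>R\<^esub>" for x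
      using c by (auto simp: free_module_sels image_subset_iff R.l_minus R.l_neg)
    ultimately show "\<exists>d\<in>carrier ?F. d \<oplus>\<^bsub>?F\<^esub> c = \<zero>\<^bsub>?F\<^esub>"
      by (intro bexI[of _ "\<lambda>x. (\<ominus>\<^bsub>R\<^esub> \<one>\<^bsub>R\<^esub>) \<otimes>\<^bsub>R\<^esub> c x"]) (auto simp: free_module_sels)
  next
    fix c d assume "c \<in> carrier ?F" "d \<in> carrier ?F"
    then show "c \<oplus>\<^bsub>?F\<^esub> d \<in> carrier ?F"
      using free_module_add_closed by (simp add: free_module_sels(3))
  qed (auto simp: free_module_sels image_subset_iff fun_eq_iff R.a_ac)
next
  fix r c assume "r \<in> carrier R" "c \<in> carrier ?F"
  then show "r \<odot>\<^bsub>?F\<^esub> c \<in> carrier ?F"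
    using free_module_smult_closed by (simp add: free_module_sels(4))
qed (auto simp: free_module_sels image_subset_iff fun_eq_iff R.m_ac R.l_distr R.r_distr)

lemma free_gen_closed: "x \<in> X \<Longrightarrow> free_gen R x \<in> carrier (free_module R X)"
proof -
  assume "x \<in> X"
  moreover have "{y. free_gen R x y \<noteq> \<zero>\<^bsub>R\<^esub>} \<subseteq> {x}"
    by (auto simp: free_gen_def)
  moreover from this have "finite {y. free_gen R x y \<noteq> \<zero>\<^bsub>R\<^esub>}"
    by (rule finite_subset) simp
  ultimately show ?thesis
    by (auto simp: free_module_sels) (auto simp: free_gen_def)
qed

text \<open>Induction on the finite support: resetting one nonzero coefficient to zero gives an
  element of smaller support, and the difference is a scalar multiple of a generator.\<close>

lemma free_module_induct [consumes 1, case_names zero add smult gen]: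
  assumes c: "c \<in> carrier (free_module R X)"
    and zero: "P \<zero>\<^bsub>free_module R X\<^esub>"
    and add: "\<And>c d. c \<in> carrier (free_module R X) \<Longrightarrow> d \<in> carrier (free_module R X) \<Longrightarrow>
      P c \<Longrightarrow> P d \<Longrightarrow> P (c \<oplus>\<^bsub>free_module R X\<^esub> d)"
    and smult: "\<And>r c. r \<in> carrier R \<Longrightarrow> c \<in> carrier (free_module R X) \<Longrightarrow>
      P c \<Longrightarrow> P (r \<odot>\<^bsub>free_module R X\<^esub> c)"
    and gen: "\<And>x. x \<in> X \<Longrightarrow> P (free_gen R x)"
  shows "P c"
proof -
  let ?F = "free_module R X"
  have "finite {x. c x \<noteq> \<zero>\<^bsub>R\<^esub>}"
    using c by (simp add: free_module_sels)
  then show ?thesis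
    using c
  proof (induction "{x. c x \<noteq> \<zero>\<^bsub>R\<^esub>}" arbitrary: c rule: finite_psubset_induct)
    case (psubset c)
    show ?case
    proof (cases "\<forall>x. c x = \<zero>\<^bsub>R\<^esub>")
      case True
      then have "c = \<zero>\<^bsub>?F\<^esub>" by (auto simp: free_module_sels)
      with zero show ?thesis by simp
    next
      case False
      then obtain x where x: "c x \<noteq> \<zero>\<^bsub>R\<^esub>" by auto
      let ?d = "c(x := \<zero>\<^bsub>R\<^esub>)"
      have sub: "{y. ?d y \<noteq> \<zero>\<^bsub>R\<^esub>} \<subset> {y. c y \<noteq> \<zero>\<^bsub>R\<^esub>}"
        using x by auto
      have xX: "x \<in> X" "c x \<in> carrier R"
        using psubset.prems x by (auto simp: free_module_sels)
      have d: "?d \<in> carrier ?F"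
        unfolding free_module_sels mem_Collect_eq
      proof (intro conjI)
        show "range ?d \<subseteq> carrier R"
          using psubset.prems by (auto simp: free_module_sels)
        show "finite {y. ?d y \<noteq> \<zero>\<^bsub>R\<^esub>}"
          using finite_subset[OF psubset_imp_subset[OF sub]] psubset.hyps(1) by blast
        show "{y. ?d y \<noteq> \<zero>\<^bsub>R\<^esub>} \<subseteq> X"
          using psubset.prems by (auto simp: free_module_sels)
      qed
      have g: "c x \<odot>\<^bsub>?F\<^esub> free_gen R x \<in> carrier ?F"
        using xX by (intro module.smult_closed[OF free_module_module] free_gen_closed)
      have eq: "c = ?d \<oplus>\<^bsub>?F\<^esub> c x \<odot>\<^bsub>?F\<^esub> free_gen R x"
        using psubset.prems xX
        by (auto simp: free_module_sels free_gen_def fun_eq_iff image_subset_iff)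
      have "P (?d \<oplus>\<^bsub>?F\<^esub> c x \<odot>\<^bsub>?F\<^esub> free_gen R x)"
        using d g xX psubset.hyps(2)[OF sub d] by (intro add smult gen free_gen_closed)
      with eq show ?thesis by simp
    qed
  qed
qed

text \<open>The support of a sum may be smaller than the union of the supports. Additivity of
  \<open>lin_ext\<close> therefore needs all sums over one common finite set.\<close>

lemma lin_ext_superset:
  assumes V: "module R V" and \<phi>: "\<And>x. x \<in> X \<Longrightarrow> \<phi> x \<in> carrier V"
    and c: "range c \<subseteq> carrier R" and A: "finite A" "{x. c x \<noteq> \<zero>\<^bsub>R\<^esub>} \<subseteq> A" "A \<subseteq> X"
  shows "lin_ext R V \<phi> c = (\<Oplus>\<^bsub>V\<^esub>x\<in>A. c x \<odot>\<^bsub>V\<^esub> \<phi> x)"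
proof -
  interpret V: module R V by (rule V)
  show ?thesis
    unfolding lin_ext_def using A \<phi> c
    by (intro V.M.add.finprod_mono_neutral_cong_left) (auto simp: image_subset_iff)
qed

lemma lin_ext_linear:
  assumes V: "module R V" and \<phi>: "\<And>x. x \<in> X \<Longrightarrow> \<phi> x \<in> carrier V"
  shows "linear_map R (free_module R X) V (lin_ext R V \<phi>)"
proof -
  interpret V: module R V by (rule V)
  let ?F = "free_module R X"
  show ?thesis
  proof (rule linear_mapI)
    fix c assume c: "c \<in> carrier ?F"
    then show "lin_ext R V \<phi> c \<in> carrier V"
      unfolding lin_ext_def using \<phi>
      by (intro V.finsum_closed) (auto simp: free_module_sels image_subset_iff)
    fix d assume d: "d \<in> carrier ?F"
    let ?A = "{x. c x \<noteq> \<zero>\<^bsub>R\<^esub>} \<union> {x. d x \<noteq> \<zero>\<^bsub>R\<^esub>}"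
    have A: "finite ?A" "?A \<subseteq> X" and r: "range c \<subseteq> carrier R" "range d \<subseteq> carrier R"
      using c d by (auto simp: free_module_sels)
    have "lin_ext R V \<phi> (c \<oplus>\<^bsub>?F\<^esub> d) = (\<Oplus>\<^bsub>V\<^esub>x\<in>?A. (c \<oplus>\<^bsub>?F\<^esub> d) x \<odot>\<^bsub>V\<^esub> \<phi> x)"
      using A r by (intro lin_ext_superset[OF V \<phi>]) (auto simp: free_module_sels)
    also have "\<dots> = (\<Oplus>\<^bsub>V\<^esub>x\<in>?A. c x \<odot>\<^bsub>V\<^esub> \<phi> x \<oplus>\<^bsub>V\<^esub> d x \<odot>\<^bsub>V\<^esub> \<phi> x)"
      using A(2) r \<phi>
      by (intro V.finsum_cong' refl funcsetI)
        (auto simp: free_module_sels image_subset_iff subset_iff V.smult_l_distr)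
    also have "\<dots> = (\<Oplus>\<^bsub>V\<^esub>x\<in>?A. c x \<odot>\<^bsub>V\<^esub> \<phi> x) \<oplus>\<^bsub>V\<^esub> (\<Oplus>\<^bsub>V\<^esub>x\<in>?A. d x \<odot>\<^bsub>V\<^esub> \<phi> x)"
      using A(2) r \<phi> by (intro V.finsum_addf) (auto simp: image_subset_iff)
    also have "(\<Oplus>\<^bsub>V\<^esub>x\<in>?A. c x \<odot>\<^bsub>V\<^esub> \<phi> x) = lin_ext R V \<phi> c"
      using A r by (intro lin_ext_superset[OF V \<phi>, symmetric]) auto
    also have "(\<Oplus>\<^bsub>V\<^esub>x\<in>?A. d x \<odot>\<^bsub>V\<^esub> \<phi> x) = lin_ext R V \<phi> d"
      using A r by (intro lin_ext_superset[OF V \<phi>, symmetric]) auto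
    finally show "lin_ext R V \<phi> (c \<oplus>\<^bsub>?F\<^esub> d) = lin_ext R V \<phi> c \<oplus>\<^bsub>V\<^esub> lin_ext R V \<phi> d" .
  next
    fix r c assume r: "r \<in> carrier R" and c: "c \<in> carrier ?F"
    let ?A = "{x. c x \<noteq> \<zero>\<^bsub>R\<^esub>}"
    have A: "finite ?A" "?A \<subseteq> X" and c': "range c \<subseteq> carrier R"
      using c by (auto simp: free_module_sels)
    have "lin_ext R V \<phi> (r \<odot>\<^bsub>?F\<^esub> c) = (\<Oplus>\<^bsub>V\<^esub>x\<in>?A. (r \<odot>\<^bsub>?F\<^esub> c) x \<odot>\<^bsub>V\<^esub> \<phi> x)"
      using A r c' by (intro lin_ext_superset[OF V \<phi>]) (auto simp: free_module_sels)
    also have "\<dots> = (\<Oplus>\<^bsub>V\<^esub>x\<in>?A. r \<odot>\<^bsub>V\<^esub> (c x \<odot>\<^bsub>V\<^esub> \<phi> x))"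
      using A(2) r c' \<phi>
      by (intro V.finsum_cong' refl funcsetI)
        (auto simp: free_module_sels image_subset_iff subset_iff V.smult_assoc1)
    also have "\<dots> = r \<odot>\<^bsub>V\<^esub> lin_ext R V \<phi> c"
      unfolding lin_ext_def using A r c' \<phi>
      by (intro V.finsum_smult_ldistr[symmetric]) (auto simp: image_subset_iff)
    finally show "lin_ext R V \<phi> (r \<odot>\<^bsub>?F\<^esub> c) = r \<odot>\<^bsub>V\<^esub> lin_ext R V \<phi> c" .
  qed
qed

lemma lin_ext_free_gen:
  assumes V: "module R V" and \<phi>: "\<And>x. x \<in> X \<Longrightarrow> \<phi> x \<in> carrier V" and x: "x \<in> X"
  shows "lin_ext R V \<phi> (free_gen R x) = \<phi> x"
proof -
  interpret V: module R V by (rule V)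
  have "lin_ext R V \<phi> (free_gen R x) = (\<Oplus>\<^bsub>V\<^esub>y\<in>{x}. free_gen R x y \<odot>\<^bsub>V\<^esub> \<phi> y)"
    using x by (intro lin_ext_superset[OF V \<phi>]) (auto simp: free_gen_def)
  also have "\<dots> = \<phi> x"
    using \<phi>[OF x] by (simp add: free_gen_def)
  finally show ?thesis .
qed

end

section \<open>Spans and submodules\<close>

lemma submodule_span:
  assumes M: "module R M" and S: "S \<subseteq> carrier M"
  shows submodule_span_submodule: "submodule (submodule_span R M S) R M"
    and submodule_span_superset: "S \<subseteq> submodule_span R M S"
proof -
  interpret M: module R M by (rule M)
  show "S \<subseteq> submodule_span R M S" by (auto simp: submodule_span_def)
  show "submodule (submodule_span R M S) R M"
  proof (rule M.submoduleI)
    show "submodule_span R M S \<subseteq> carrier M"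
      using M.carrier_is_submodule S by (auto simp: submodule_span_def)
    show "\<zero>\<^bsub>M\<^esub> \<in> submodule_span R M S"
    proof (clarsimp simp: submodule_span_def)
      fix N assume "submodule N R M"
      then show "\<zero>\<^bsub>M\<^esub> \<in> N"
        using subgroup.one_closed[OF submodule.axioms(1)] by fastforce
    qed
  qed (auto simp: submodule_span_def dest: M.submoduleE)
qed

lemma submodule_span_least:
  "submodule N R M \<Longrightarrow> S \<subseteq> N \<Longrightarrow> submodule_span R M S \<subseteq> N"
  by (auto simp: submodule_span_def)

lemma submodule_zero_mem: "submodule N R M \<Longrightarrow> \<zero>\<^bsub>M\<^esub> \<in> N"
  using subgroup.one_closed[OF submodule.axioms(1)] by fastforce

text \<open>Negatives are multiples by minus one, so these closure conditions suffice. They refer to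
  the record only through carrier, zero, addition and scalars, which allows submodules to be
  transported between records that share these.\<close>

lemma submodule_iff:
  assumes "module R M"
  shows "submodule N R M \<longleftrightarrow> N \<subseteq> carrier M \<and> \<zero>\<^bsub>M\<^esub> \<in> N \<and>
    (\<forall>x\<in>N. \<forall>y\<in>N. x \<oplus>\<^bsub>M\<^esub> y \<in> N) \<and> (\<forall>r\<in>carrier R. \<forall>x\<in>N. r \<odot>\<^bsub>M\<^esub> x \<in> N)"
    (is "_ \<longleftrightarrow> ?R")
proof
  interpret M: module R M by fact
  show ?R if "submodule N R M"
    using M.submoduleE[OF that] submodule_zero_mem[OF that] by blast
  assume N: ?R
  then have "(\<ominus>\<^bsub>R\<^esub> \<one>\<^bsub>R\<^esub>) \<odot>\<^bsub>M\<^esub> x \<in> N" if "x \<in> N" for x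
    using that by auto
  with N show "submodule N R M"
    by (intro M.submoduleI) (auto simp: M.smult_l_minus subset_iff)
qed

lemma submodule_finsum:
  assumes M: "module R M" and N: "submodule N R M" and f: "\<And>i. i \<in> I \<Longrightarrow> f i \<in> N"
  shows "finsum M f I \<in> N"
proof -
  interpret M: module R M by (rule M)
  show ?thesis
    using f
  \<comment> \<open>Over an infinite index set \<open>finsum\<close> is zero by convention, so that
    case is membership of zero.\<close>
  proof (induction I rule: infinite_finite_induct)
    case (insert i I)
    then show ?case
      using M.submoduleE(1,5)[OF N] by (subst M.finsum_insert) auto
  qed (simp_all add: submodule_zero_mem[OF N])
qed

text \<open>Together with \<open>submodule_span_least\<close> this reduces an identity of linear
  maps on a span to its generators. Taking \<open>g\<close> to be zero gives kernels.\<close>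

lemma submodule_equalizer:
  assumes M: "module R M" and N: "module R N"
    and f: "linear_map R M N f" and g: "linear_map R M N g"
  shows "submodule {x \<in> carrier M. f x = g x} R M"
proof -
  interpret M: module R M by (rule M)
  interpret N: module R N by (rule N)
  note [simp] = linear_mapD[OF f] linear_mapD[OF g] linear_map_zero[OF M N f] linear_map_zero[OF M N g]
  have "f (\<ominus>\<^bsub>M\<^esub> x) = g (\<ominus>\<^bsub>M\<^esub> x)" if "x \<in> carrier M" "f x = g x" for x
    using linear_map_minus[OF M N f, of "\<zero>\<^bsub>M\<^esub>" x] linear_map_minus[OF M N g, of "\<zero>\<^bsub>M\<^esub>" x] that
    by (simp add: a_minus_def)
  then show ?thesis
    by (intro M.submoduleI) auto
qed

section \<open>Quotients by a submodule\<close>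

context
  fixes R :: "('a, 'r) ring_scheme" and M :: "('a, 'b, 'm) module_scheme" and N :: "'b set"
  assumes M: "module R M" and N: "submodule N R M"
begin

interpretation M: module R M by (rule M)

interpretation N: abelian_subgroup N M
  by (intro abelian_subgroupI3 additive_subgroup.intro submodule.axioms(1)[OF N])
    (rule M.abelian_group_axioms)

lemma quotient_module_carrier: "carrier (quotient_module M N) = (\<lambda>x. N +>\<^bsub>M\<^esub> x) ` carrier M"
  by (auto simp: quotient_module_def A_RCOSETS_def')

lemma quotient_module_zero: "\<zero>\<^bsub>quotient_module M N\<^esub> = N +>\<^bsub>M\<^esub> \<zero>\<^bsub>M\<^esub>"
  by (simp add: quotient_module_def M.a_coset_add_zero[OF N.a_subset])

lemma quotient_module_add:
  "x \<in> carrier M \<Longrightarrow> y \<in> carrier M \<Longrightarrow>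
    (N +>\<^bsub>M\<^esub> x) \<oplus>\<^bsub>quotient_module M N\<^esub> (N +>\<^bsub>M\<^esub> y) = N +>\<^bsub>M\<^esub> (x \<oplus>\<^bsub>M\<^esub> y)"
  by (simp add: quotient_module_def N.a_rcos_sum)

lemma a_r_coset_absorb:
  assumes "n \<in> N" "x \<in> carrier M"
  shows "N +>\<^bsub>M\<^esub> (n \<oplus>\<^bsub>M\<^esub> x) = N +>\<^bsub>M\<^esub> x"
proof -
  have "n \<oplus>\<^bsub>M\<^esub> x \<in> N +>\<^bsub>M\<^esub> x"
    using assms by (auto simp: a_r_coset_def')
  then show ?thesis
    using N.a_repr_independence' assms(2) by blast
qed

text \<open>The definition unites the results over all representatives. They are all the same coset,
  because \<open>N\<close> is stable under scalars, and the union is over a nonempty set.\<close>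

lemma quotient_module_smult:
  assumes "r \<in> carrier R" "x \<in> carrier M"
  shows "r \<odot>\<^bsub>quotient_module M N\<^esub> (N +>\<^bsub>M\<^esub> x) = N +>\<^bsub>M\<^esub> (r \<odot>\<^bsub>M\<^esub> x)"
proof -
  have "N +>\<^bsub>M\<^esub> (r \<odot>\<^bsub>M\<^esub> c) = N +>\<^bsub>M\<^esub> (r \<odot>\<^bsub>M\<^esub> x)" if "c \<in> N +>\<^bsub>M\<^esub> x" for c
  proof -
    from that obtain n where "n \<in> N" "c = n \<oplus>\<^bsub>M\<^esub> x"
      by (auto simp: a_r_coset_def')
    then show ?thesis
      using assms M.submoduleE(4)[OF N] N.a_subset
      by (simp add: M.smult_r_distr a_r_coset_absorb subset_iff)
  qed
  moreover have "x \<in> N +>\<^bsub>M\<^esub> x"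
    using assms(2) by (rule N.a_rcos_self)
  ultimately have "(\<Union>c\<in>N +>\<^bsub>M\<^esub> x. N +>\<^bsub>M\<^esub> (r \<odot>\<^bsub>M\<^esub> c)) = N +>\<^bsub>M\<^esub> (r \<odot>\<^bsub>M\<^esub> x)"
    by (metis (no_types, lifting) SUP_cong UN_constant empty_iff)
  then show ?thesis
    by (simp add: quotient_module_def)
qed

lemma quotient_module_module: "module R (quotient_module M N)" (is "module R ?Q")
proof -
  note [simp] = quotient_module_add quotient_module_smult quotient_module_zero
  show ?thesis
  proof (rule moduleI)
    show "cring R" by (rule M.R.is_cring)
    show "abelian_group ?Q"
    proof (rule abelian_groupI)
      fix C assume "C \<in> carrier ?Q"
      then obtain x where "x \<in> carrier M" "C = N +>\<^bsub>M\<^esub> x"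
        by (auto simp: quotient_module_carrier)
      then show "\<exists>D\<in>carrier ?Q. D \<oplus>\<^bsub>?Q\<^esub> C = \<zero>\<^bsub>?Q\<^esub>"
        by (intro bexI[of _ "N +>\<^bsub>M\<^esub> (\<ominus>\<^bsub>M\<^esub> x)"]) (auto simp: quotient_module_carrier M.l_neg)
    qed (auto simp: quotient_module_carrier M.a_ac)
  qed (auto simp: quotient_module_carrier M.smult_l_distr M.smult_r_distr M.smult_assoc1)
qed

lemma quotient_module_proj_linear: "linear_map R M (quotient_module M N) (\<lambda>x. N +>\<^bsub>M\<^esub> x)"
  by (rule linear_mapI)
    (auto simp: quotient_module_carrier quotient_module_add quotient_module_smult)

lemma quotient_module_eq_zero: "n \<in> N \<Longrightarrow> N +>\<^bsub>M\<^esub> n = \<zero>\<^bsub>quotient_module M N\<^esub>"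
  using a_r_coset_absorb[of n "\<zero>\<^bsub>M\<^esub>"] N.a_subset by (simp add: quotient_module_zero subset_iff)

text \<open>A linear map that vanishes on \<open>N\<close> is constant on each coset. This is what
  gives \<open>the_elem\<close> in \<open>lift\<close> a singleton to act on.\<close>

lemma image_coset_eq:
  assumes V: "module R V" and f: "linear_map R M V f" and 0: "\<And>n. n \<in> N \<Longrightarrow> f n = \<zero>\<^bsub>V\<^esub>"
    and x: "x \<in> carrier M"
  shows "f ` (N +>\<^bsub>M\<^esub> x) = {f x}"
proof -
  interpret V: module R V by (rule V)
  have "f c = f x" if "c \<in> N +>\<^bsub>M\<^esub> x" for c
    using that x 0 N.a_subset
    by (auto simp: a_r_coset_def' linear_mapD[OF f] subset_iff)
  then show ?thesis
    using N.a_rcos_self[OF x] by (metis (no_types, lifting) empty_iff image_cong image_constant_conv)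
qed

end

section \<open>Modules presented by generators and relations, the common form of binary tensor
  products and tensor powers\<close>

context
  fixes R :: "('a, 'r) ring_scheme" and X :: "'x set" and S :: "('x \<Rightarrow> 'a) set"
  assumes R: "cring R" and S: "S \<subseteq> carrier (free_module R X)"
begin

interpretation R: cring R by (rule R)

private abbreviation (input) "F \<equiv> free_module R X"
private abbreviation (input) "K \<equiv> submodule_span R F S"
private abbreviation (input) "Q \<equiv> quotient_module F K"

lemmas presented_facts = free_module_module[OF R, of X]
  submodule_span_submodule[OF free_module_module[OF R, of X] S]

lemma presented_module: "module R Q"
  by (intro quotient_module_module presented_facts)

lemma presented_gen_closed: "x \<in> X \<Longrightarrow> K +>\<^bsub>F\<^esub> free_gen R x \<in> carrier Q"
  by (simp add: quotient_module_carrier[OF presented_facts] free_gen_closed[OF R])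

lemma presented_relation:
  assumes "c \<in> carrier F" "d \<in> carrier F" "c \<ominus>\<^bsub>F\<^esub> d \<in> S"
  shows "K +>\<^bsub>F\<^esub> c = K +>\<^bsub>F\<^esub> d"
proof -
  interpret Q: module R Q by (rule presented_module)
  let ?cls = "\<lambda>x. K +>\<^bsub>F\<^esub> x"
  have lin: "linear_map R F Q ?cls"
    by (rule quotient_module_proj_linear[OF presented_facts])
  have "c \<ominus>\<^bsub>F\<^esub> d \<in> K"
    using assms(3) submodule_span_superset[OF presented_facts(1) S] by blast
  then have "?cls (c \<ominus>\<^bsub>F\<^esub> d) = \<zero>\<^bsub>Q\<^esub>"
    by (rule quotient_module_eq_zero[OF presented_facts])
  then have "?cls c \<ominus>\<^bsub>Q\<^esub> ?cls d = \<zero>\<^bsub>Q\<^esub>"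
    using linear_map_minus[OF presented_facts(1) presented_module lin assms(1,2)] by simp
  then show ?thesis
    using assms(1,2) linear_map_closed[OF lin] minus_eq_zeroD[OF Q.abelian_group_axioms] by blast
qed

lemma presented_induct [consumes 1, case_names zero add smult gen]:
  assumes t: "t \<in> carrier Q"
    and zero: "P \<zero>\<^bsub>Q\<^esub>"
    and add: "\<And>s t. s \<in> carrier Q \<Longrightarrow> t \<in> carrier Q \<Longrightarrow> P s \<Longrightarrow> P t \<Longrightarrow> P (s \<oplus>\<^bsub>Q\<^esub> t)"
    and smult: "\<And>r t. r \<in> carrier R \<Longrightarrow> t \<in> carrier Q \<Longrightarrow> P t \<Longrightarrow> P (r \<odot>\<^bsub>Q\<^esub> t)"
    and gen: "\<And>x. x \<in> X \<Longrightarrow> P (K +>\<^bsub>F\<^esub> free_gen R x)"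
  shows "P t"
proof -
  have lin: "linear_map R F Q (\<lambda>x. K +>\<^bsub>F\<^esub> x)"
    by (rule quotient_module_proj_linear[OF presented_facts])
  obtain c where c: "c \<in> carrier F" "t = K +>\<^bsub>F\<^esub> c"
    using t quotient_module_carrier[OF presented_facts] by auto
  have "P (K +>\<^bsub>F\<^esub> c)"
    using c(1)
  proof (induction rule: free_module_induct[OF R, consumes 1])
    case 1
    show ?case
      using zero quotient_module_zero[OF presented_facts] by simp
  next
    case (2 c d)
    then show ?case
      using add linear_map_closed[OF lin] by (simp add: linear_map_add[OF lin])
  next
    case (3 r c)
    then show ?case
      using smult linear_map_closed[OF lin] by (simp add: linear_map_smult[OF lin])
  next
    case (4 x)
    then show ?case by (rule gen)
  qed
  then show ?thesis using c(2) by simp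
qed

text \<open>Each \<open>L x\<close> is linear, so the elements \<open>t\<close> for which
  \<open>L x t\<close> is linear in \<open>x\<close> are closed under sums and scalars; it is enough
  to have the generators among them. This is how left linearity of a nested lift is obtained,
  although the lift has a closed formula only at generators.\<close>

lemma presented_bilinearI:
  assumes "module R M" "module R V"
    and L: "\<And>x. x \<in> carrier M \<Longrightarrow> linear_map R Q V (L x)"
    and gen: "\<And>x. x \<in> X \<Longrightarrow> linear_map R M V (\<lambda>z. L z (K +>\<^bsub>F\<^esub> free_gen R x))"
  shows "bilinear R M Q V L"
proof (rule bilinearI)
  fix t assume "t \<in> carrier Q"
  then show "linear_map R M V (\<lambda>x. L x t)"
  proof (induction rule: presented_induct)
    case zero
    show ?case
      by (rule linear_map_cong[OF linear_map_const_zero[OF assms(1,2)] assms(1)])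
        (simp add: linear_map_zero[OF presented_module assms(2) L])
  next
    case (add s t)
    show ?case
      by (rule linear_map_cong[OF linear_map_sum[OF assms(1,2) add(3,4)] assms(1)])
        (simp add: linear_map_add[OF L] add(1,2))
  next
    case (smult r t)
    show ?case
      by (rule linear_map_cong[OF linear_map_scale[OF assms(1,2) smult(3,1)] assms(1)])
        (simp add: linear_map_smult[OF L] smult(1,2))
  qed (rule gen)
qed (rule L)

lemma presented_ext:
  assumes "module R V" "linear_map R Q V f" "linear_map R Q V g"
    and "\<And>x. x \<in> X \<Longrightarrow> f (K +>\<^bsub>F\<^esub> free_gen R x) = g (K +>\<^bsub>F\<^esub> free_gen R x)"
    and "t \<in> carrier Q"
  shows "f t = g t"
  using assms(5)
proof (induction rule: presented_induct)
  case zero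
  then show ?case
    using linear_map_zero[OF presented_module assms(1)] assms(2,3) by metis
qed (simp_all add: linear_mapD[OF assms(2)] linear_mapD[OF assms(3)] assms(4))

context
  fixes V :: "('a, 'v, 'm) module_scheme" and \<phi> :: "'x \<Rightarrow> 'v"
  assumes V: "module R V" and \<phi>: "\<And>x. x \<in> X \<Longrightarrow> \<phi> x \<in> carrier V"
    and rel: "\<And>s. s \<in> S \<Longrightarrow> lin_ext R V \<phi> s = \<zero>\<^bsub>V\<^esub>"
begin

lemma presented_lift_class:
  assumes c: "c \<in> carrier F"
  shows "lift R V \<phi> (K +>\<^bsub>F\<^esub> c) = lin_ext R V \<phi> c"
proof -
  have lin: "linear_map R F V (lin_ext R V \<phi>)"
    by (rule lin_ext_linear[OF R V \<phi>])
  \<comment> \<open>The right side is a submodule, the kernel of the linear extension, and it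
    contains the relations; \<open>K\<close> is contained in every such submodule.\<close>
  have "K \<subseteq> {c \<in> carrier F. lin_ext R V \<phi> c = \<zero>\<^bsub>V\<^esub>}"
    using rel S
    by (intro submodule_span_least submodule_equalizer[OF presented_facts(1) V lin]
        linear_map_const_zero[OF presented_facts(1) V]) auto
  then have "lin_ext R V \<phi> ` (K +>\<^bsub>F\<^esub> c) = {lin_ext R V \<phi> c}"
    by (intro image_coset_eq[OF presented_facts V lin] c) auto
  then show ?thesis
    by (simp add: lift_def lin_ext_def[abs_def])
qed

lemma presented_lift_linear: "linear_map R Q V (lift R V \<phi>)"
proof -
  interpret F: module R F by (rule presented_facts)
  have lin: "linear_map R F V (lin_ext R V \<phi>)"
    by (rule lin_ext_linear[OF R V \<phi>])
  show ?thesis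
    by (rule linear_mapI)
      (auto simp: quotient_module_carrier[OF presented_facts]
        quotient_module_add[OF presented_facts] quotient_module_smult[OF presented_facts]
        presented_lift_class linear_mapD[OF lin])
qed

lemma presented_lift_gen: "x \<in> X \<Longrightarrow> lift R V \<phi> (K +>\<^bsub>F\<^esub> free_gen R x) = \<phi> x"
  by (simp add: presented_lift_class free_gen_closed[OF R] lin_ext_free_gen[OF R V \<phi>])

end

end

section \<open>Tensor products\<close>

lemma tensor_relations_subset:
  assumes "module R M" "module R N"
  shows "tensor_relations R M N \<subseteq> carrier (free_module R (carrier M \<times> carrier N))"
    (is "_ \<subseteq> carrier ?F")
proof -
  interpret M: module R M by fact
  interpret N: module R N by fact
  interpret F: module R ?F by (rule free_module_module[OF M.R.is_cring])
  show ?thesis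
    unfolding tensor_relations_def Let_def
    by (auto intro!: F.M.minus_closed F.M.a_closed F.smult_closed
        free_gen_closed[OF M.R.is_cring])
qed

context
  fixes R :: "('a, 'r) ring_scheme" and M :: "('a, 'b, 'm) module_scheme"
    and N :: "('a, 'c, 'n) module_scheme"
  assumes M: "module R M" and N: "module R N"
begin

interpretation M: module R M by (rule M)
interpretation N: module R N by (rule N)

private lemmas R = M.R.is_cring
private lemmas sub = tensor_relations_subset[OF M N]
private lemmas defs = tensor_module_def tensor_kernel_def tensor_def

lemma tensor_module_module: "module R (tensor_module R M N)"
  unfolding defs by (rule presented_module[OF R sub])

lemma tensor_bilinear: "bilinear R M N (tensor_module R M N) (tensor R M N)"
proof -
  let ?F = "free_module R (carrier M \<times> carrier N)"
  let ?K = "tensor_kernel R M N"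
  interpret F: module R ?F by (rule free_module_module[OF R])
  note facts = presented_facts[OF R sub, folded tensor_kernel_def]
  note rel = presented_relation[OF R sub, folded tensor_kernel_def]
  have g: "free_gen R (x, y) \<in> carrier ?F" if "x \<in> carrier M" "y \<in> carrier N" for x y
    using that by (intro free_gen_closed[OF R]) auto
  have pure: "tensor R M N x y \<in> carrier (tensor_module R M N)"
    if "x \<in> carrier M" "y \<in> carrier N" for x y
    unfolding defs using that by (intro presented_gen_closed[OF R sub]) auto
  have 1: "tensor R M N (x \<oplus>\<^bsub>M\<^esub> x') y =
      tensor R M N x y \<oplus>\<^bsub>tensor_module R M N\<^esub> tensor R M N x' y"
    if "x \<in> carrier M" "x' \<in> carrier M" "y \<in> carrier N" for x x' y
  proof -
    have "?K +>\<^bsub>?F\<^esub> free_gen R (x \<oplus>\<^bsub>M\<^esub> x', y) =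
        ?K +>\<^bsub>?F\<^esub> (free_gen R (x, y) \<oplus>\<^bsub>?F\<^esub> free_gen R (x', y))"
      using that g by (intro rel) (auto simp: tensor_relations_def Let_def)
    then show ?thesis
      using that g by (simp add: tensor_def tensor_module_def quotient_module_add[OF facts])
  qed
  have 2: "tensor R M N x (y \<oplus>\<^bsub>N\<^esub> y') =
      tensor R M N x y \<oplus>\<^bsub>tensor_module R M N\<^esub> tensor R M N x y'"
    if "x \<in> carrier M" "y \<in> carrier N" "y' \<in> carrier N" for x y y'
  proof -
    have "?K +>\<^bsub>?F\<^esub> free_gen R (x, y \<oplus>\<^bsub>N\<^esub> y') =
        ?K +>\<^bsub>?F\<^esub> (free_gen R (x, y) \<oplus>\<^bsub>?F\<^esub> free_gen R (x, y'))"
      using that g by (intro rel) (auto simp: tensor_relations_def Let_def)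
    then show ?thesis
      using that g by (simp add: tensor_def tensor_module_def quotient_module_add[OF facts])
  qed
  have 3: "tensor R M N (r \<odot>\<^bsub>M\<^esub> x) y = r \<odot>\<^bsub>tensor_module R M N\<^esub> tensor R M N x y"
    if "r \<in> carrier R" "x \<in> carrier M" "y \<in> carrier N" for r x y
  proof -
    have "?K +>\<^bsub>?F\<^esub> free_gen R (r \<odot>\<^bsub>M\<^esub> x, y) = ?K +>\<^bsub>?F\<^esub> (r \<odot>\<^bsub>?F\<^esub> free_gen R (x, y))"
      using that g by (intro rel) (auto simp: tensor_relations_def Let_def)
    then show ?thesis
      using that g by (simp add: tensor_def tensor_module_def quotient_module_smult[OF facts])
  qed
  have 4: "tensor R M N x (r \<odot>\<^bsub>N\<^esub> y) = r \<odot>\<^bsub>tensor_module R M N\<^esub> tensor R M N x y"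
    if "r \<in> carrier R" "x \<in> carrier M" "y \<in> carrier N" for r x y
  proof -
    have "?K +>\<^bsub>?F\<^esub> free_gen R (x, r \<odot>\<^bsub>N\<^esub> y) = ?K +>\<^bsub>?F\<^esub> (r \<odot>\<^bsub>?F\<^esub> free_gen R (x, y))"
      using that g by (intro rel) (auto simp: tensor_relations_def Let_def)
    then show ?thesis
      using that g by (simp add: tensor_def tensor_module_def quotient_module_smult[OF facts])
  qed
  show ?thesis
    by (intro bilinearI linear_mapI pure 1 2 3 4)
qed

lemma tensor_closed:
  "x \<in> carrier M \<Longrightarrow> y \<in> carrier N \<Longrightarrow> tensor R M N x y \<in> carrier (tensor_module R M N)"
  by (rule bilinear_closed[OF tensor_bilinear])

lemma tensor_induct [consumes 1, case_names zero add smult pure]: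
  assumes "t \<in> carrier (tensor_module R M N)"
    and "P \<zero>\<^bsub>tensor_module R M N\<^esub>"
    and "\<And>s t. s \<in> carrier (tensor_module R M N) \<Longrightarrow> t \<in> carrier (tensor_module R M N) \<Longrightarrow>
      P s \<Longrightarrow> P t \<Longrightarrow> P (s \<oplus>\<^bsub>tensor_module R M N\<^esub> t)"
    and "\<And>r t. r \<in> carrier R \<Longrightarrow> t \<in> carrier (tensor_module R M N) \<Longrightarrow>
      P t \<Longrightarrow> P (r \<odot>\<^bsub>tensor_module R M N\<^esub> t)"
    and "\<And>x y. x \<in> carrier M \<Longrightarrow> y \<in> carrier N \<Longrightarrow> P (tensor R M N x y)"
  shows "P t"
  using assms unfolding defs
  by - (rule presented_induct[OF R sub, where P = P and t = t], auto)

lemma tensor_ext: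
  assumes "module R V" "linear_map R (tensor_module R M N) V f"
    "linear_map R (tensor_module R M N) V g"
    and "\<And>x y. x \<in> carrier M \<Longrightarrow> y \<in> carrier N \<Longrightarrow> f (tensor R M N x y) = g (tensor R M N x y)"
    and "t \<in> carrier (tensor_module R M N)"
  shows "f t = g t"
  using assms unfolding defs by - (rule presented_ext[OF R sub, of V f g], auto)

lemma tensor_bilinearI:
  assumes "module R L" "module R V"
    and "\<And>z. z \<in> carrier L \<Longrightarrow> linear_map R (tensor_module R M N) V (\<phi> z)"
    and "\<And>x y. x \<in> carrier M \<Longrightarrow> y \<in> carrier N \<Longrightarrow> linear_map R L V (\<lambda>z. \<phi> z (tensor R M N x y))"
  shows "bilinear R L (tensor_module R M N) V \<phi>"
  using assms unfolding defs by - (rule presented_bilinearI[OF R sub], auto)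

context
  fixes V :: "('a, 'v, 'o) module_scheme" and \<phi> :: "'b \<Rightarrow> 'c \<Rightarrow> 'v"
  assumes V: "module R V" and \<phi>: "bilinear R M N V \<phi>"
begin

text \<open>Each relation is a difference of two elements of the free module on which the linear
  extension takes the same value by bilinearity of \<phi>.\<close>

lemma tensor_lift_relations:
  assumes "s \<in> tensor_relations R M N"
  shows "lin_ext R V (\<lambda>(x, y). \<phi> x y) s = \<zero>\<^bsub>V\<^esub>"
proof -
  let ?F = "free_module R (carrier M \<times> carrier N)"
  let ?e = "lin_ext R V (\<lambda>(x, y). \<phi> x y)"
  interpret V: module R V by (rule V)
  interpret F: module R ?F by (rule free_module_module[OF R])
  have cl: "(case p of (x, y) \<Rightarrow> \<phi> x y) \<in> carrier V" if "p \<in> carrier M \<times> carrier N" for p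
    using that bilinear_closed[OF \<phi>] by auto
  have lin: "linear_map R ?F V ?e"
    by (rule lin_ext_linear[OF R V]) (use cl in auto)
  have e: "?e (free_gen R (x, y)) = \<phi> x y" if "x \<in> carrier M" "y \<in> carrier N" for x y
    using lin_ext_free_gen[OF R V cl, where x = "(x, y)"] that by auto
  have g: "free_gen R (x, y) \<in> carrier ?F" if "x \<in> carrier M" "y \<in> carrier N" for x y
    using that by (intro free_gen_closed[OF R]) auto
  have "?e (c \<ominus>\<^bsub>?F\<^esub> d) = \<zero>\<^bsub>V\<^esub>" if "c \<in> carrier ?F" "d \<in> carrier ?F" "?e c = ?e d" for c d
    using that linear_map_minus[OF F.module_axioms V lin, of c d] linear_map_closed[OF lin]
    by (simp add: a_minus_def V.r_neg)
  note diff = this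
  show ?thesis
    using assms unfolding tensor_relations_def Let_def
    by (auto intro!: diff g F.M.a_closed F.smult_closed
        simp: e g linear_mapD[OF lin] linear_mapD[OF bilinear_left[OF \<phi>]]
        linear_mapD[OF bilinear_right[OF \<phi>]])
qed

lemma tensor_lift_linear: "linear_map R (tensor_module R M N) V (lift R V (\<lambda>(x, y). \<phi> x y))"
  unfolding defs
  by (rule presented_lift_linear[OF R sub V])
    (auto simp: bilinear_closed[OF \<phi>] tensor_lift_relations)

lemma tensor_lift_pure:
  assumes "x \<in> carrier M" "y \<in> carrier N"
  shows "lift R V (\<lambda>(x, y). \<phi> x y) (tensor R M N x y) = \<phi> x y"
  unfolding defs
  by (subst presented_lift_gen[OF R sub V])
    (auto simp: assms bilinear_closed[OF \<phi>] tensor_lift_relations)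

end

end

text \<open>Extensionality is applied in the first variable with \<open>t\<close> arbitrary, then in
  the second with a pure tensor in the first.\<close>

lemma tensor_bilinear_ext:
  assumes M: "module R M" and N: "module R N" and M': "module R M'" and N': "module R N'"
    and V: "module R V"
    and f: "bilinear R (tensor_module R M N) (tensor_module R M' N') V f"
    and g: "bilinear R (tensor_module R M N) (tensor_module R M' N') V g"
    and eq: "\<And>x y x' y'. x \<in> carrier M \<Longrightarrow> y \<in> carrier N \<Longrightarrow> x' \<in> carrier M' \<Longrightarrow> y' \<in> carrier N' \<Longrightarrow>
      f (tensor R M N x y) (tensor R M' N' x' y') = g (tensor R M N x y) (tensor R M' N' x' y')"
    and s: "s \<in> carrier (tensor_module R M N)" and t: "t \<in> carrier (tensor_module R M' N')"
  shows "f s t = g s t"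
proof (rule tensor_ext[OF M N V bilinear_left[OF f t] bilinear_left[OF g t] _ s])
  fix x y assume xy: "x \<in> carrier M" "y \<in> carrier N"
  then have xy': "tensor R M N x y \<in> carrier (tensor_module R M N)"
    by (rule tensor_closed[OF M N])
  show "f (tensor R M N x y) t = g (tensor R M N x y) t"
    by (rule tensor_ext[OF M' N' V bilinear_right[OF f xy'] bilinear_right[OF g xy'] _ t])
      (rule eq[OF xy])
qed

context
  fixes R :: "('a, 'r) ring_scheme"
    and M :: "('a, 'b, 'm) module_scheme" and N :: "('a, 'c, 'n) module_scheme"
    and M' :: "('a, 'd, 'o) module_scheme" and N' :: "('a, 'e, 'p) module_scheme"
    and f g
  assumes M: "module R M" and N: "module R N" and M': "module R M'" and N': "module R N'"
    and f: "linear_map R M M' f" and g: "linear_map R N N' g"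
begin

private lemma tensor_map_bilinear:
  "bilinear R M N (tensor_module R M' N') (\<lambda>x y. tensor R M' N' (f x) (g y))"
  by (rule bilinear_compose_args[OF tensor_bilinear[OF M' N'] f g])

lemma tensor_map_linear:
  "linear_map R (tensor_module R M N) (tensor_module R M' N') (tensor_map R M' N' f g)"
  unfolding tensor_map_def
  by (rule tensor_lift_linear[OF M N tensor_module_module[OF M' N'] tensor_map_bilinear])

lemma tensor_map_pure:
  "x \<in> carrier M \<Longrightarrow> y \<in> carrier N \<Longrightarrow>
    tensor_map R M' N' f g (tensor R M N x y) = tensor R M' N' (f x) (g y)"
  unfolding tensor_map_def
  by (rule tensor_lift_pure[OF M N tensor_module_module[OF M' N'] tensor_map_bilinear])

end

text \<open>The shape shared by \<open>tensor_mult\<close> and the core of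
  \<open>tensor_comult\<close>: a map of four variables, bilinear in each of the two pairs, is
  extended to both tensor products by nesting two lifts.\<close>

lemma tensor_lift2:
  assumes M: "module R M" and N: "module R N" and M': "module R M'" and N': "module R N'"
    and V: "module R V"
    and right: "\<And>x y. x \<in> carrier M \<Longrightarrow> y \<in> carrier N \<Longrightarrow> bilinear R M' N' V (\<phi> x y)"
    and left: "\<And>x' y'. x' \<in> carrier M' \<Longrightarrow> y' \<in> carrier N' \<Longrightarrow>
      bilinear R M N V (\<lambda>x y. \<phi> x y x' y')"
  defines "\<Phi> \<equiv> \<lambda>s t. lift R V (\<lambda>(x, y). lift R V (\<lambda>(x', y'). \<phi> x y x' y') t) s"
  shows tensor_lift2_bilinear: "bilinear R (tensor_module R M N) (tensor_module R M' N') V \<Phi>"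
    and tensor_lift2_pure: "\<And>x y x' y'. x \<in> carrier M \<Longrightarrow> y \<in> carrier N \<Longrightarrow> x' \<in> carrier M' \<Longrightarrow>
      y' \<in> carrier N' \<Longrightarrow> \<Phi> (tensor R M N x y) (tensor R M' N' x' y') = \<phi> x y x' y'"
proof -
  define I where "I x y t = lift R V (\<lambda>(x', y'). \<phi> x y x' y') t" for x y t
  have I_lin: "linear_map R (tensor_module R M' N') V (I x y)" if "x \<in> carrier M" "y \<in> carrier N" for x y
    unfolding I_def by (rule tensor_lift_linear[OF M' N' V right[OF that]])
  have I_pure: "I x y (tensor R M' N' x' y') = \<phi> x y x' y'"
    if "x \<in> carrier M" "y \<in> carrier N" "x' \<in> carrier M'" "y' \<in> carrier N'" for x y x' y'
    unfolding I_def by (rule tensor_lift_pure[OF M' N' V right[OF that(1,2)] that(3,4)])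
  have I_bil: "bilinear R M N V (\<lambda>x y. I x y t)" if t: "t \<in> carrier (tensor_module R M' N')" for t
  \<comment> \<open>For an arbitrary \<open>t\<close> the inner lift has no formula. With one of
    \<open>x\<close>, \<open>y\<close> fixed, bilinearity in the other one and \<open>t\<close> is
    reduced to pure \<open>t\<close>, where \<open>left\<close> applies.\<close>
  proof (rule bilinearI)
    fix x assume x: "x \<in> carrier M"
    have "bilinear R N (tensor_module R M' N') V (I x)"
      by (intro tensor_bilinearI[OF M' N' N V] I_lin[OF x]
          linear_map_cong[OF bilinear_right[OF left] N]) (auto simp: I_pure x)
    then show "linear_map R N V (\<lambda>y. I x y t)" by (rule bilinear_left[OF _ t])
  next
    fix y assume y: "y \<in> carrier N"
    have "bilinear R M (tensor_module R M' N') V (\<lambda>x. I x y)"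
      by (intro tensor_bilinearI[OF M' N' M V] I_lin[OF _ y]
          linear_map_cong[OF bilinear_left[OF left] M]) (auto simp: I_pure y)
    then show "linear_map R M V (\<lambda>x. I x y t)" by (rule bilinear_left[OF _ t])
  qed
  have \<Phi>: "\<Phi> s t = lift R V (\<lambda>(x, y). I x y t) s" for s t
    by (simp add: \<Phi>_def I_def)
  have left_pure: "\<Phi> (tensor R M N x y) t = I x y t"
    if "x \<in> carrier M" "y \<in> carrier N" "t \<in> carrier (tensor_module R M' N')" for x y t
    unfolding \<Phi> by (rule tensor_lift_pure[OF M N V I_bil[OF that(3)] that(1,2)])
  \<comment> \<open>The arguments are exchanged because \<open>tensor_bilinearI\<close> reduces its
    second variable to pure tensors, and here that must be \<open>s\<close>.\<close>
  have "bilinear R (tensor_module R M' N') (tensor_module R M N) V (\<lambda>t s. \<Phi> s t)"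
  proof (rule tensor_bilinearI[OF M N tensor_module_module[OF M' N'] V])
    show "linear_map R (tensor_module R M N) V (\<lambda>s. \<Phi> s t)"
      if "t \<in> carrier (tensor_module R M' N')" for t
      unfolding \<Phi> by (rule tensor_lift_linear[OF M N V I_bil[OF that]])
    show "linear_map R (tensor_module R M' N') V (\<lambda>t. \<Phi> (tensor R M N x y) t)"
      if "x \<in> carrier M" "y \<in> carrier N" for x y
      by (rule linear_map_cong[OF I_lin[OF that] tensor_module_module[OF M' N']])
        (simp add: left_pure that)
  qed
  then show "bilinear R (tensor_module R M N) (tensor_module R M' N') V \<Phi>"
    by (auto simp: bilinear_def)
  show "\<Phi> (tensor R M N x y) (tensor R M' N' x' y') = \<phi> x y x' y'"
    if "x \<in> carrier M" "y \<in> carrier N" "x' \<in> carrier M'" "y' \<in> carrier N'" for x y x' y'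
    using that by (simp add: left_pure I_pure tensor_closed[OF M' N'])
qed

text \<open>
  \<^const>\<open>tensor_module\<close> reads only the carrier, addition and scalar multiplication of its
  arguments, so it does not see the bialgebra structure of \<^const>\<open>tensor_bialgebra\<close>.
\<close>

lemma tensor_module_cong:
  fixes M :: "('a, 'b, 'm) module_scheme" and M' :: "('a, 'b, 'n) module_scheme"
  assumes "carrier M = carrier M'" "add M = add M'" "smult M = smult M'"
  shows "tensor_module R M M = tensor_module R M' M'" "tensor R M M = tensor R M' M'"
  by (simp_all add: tensor_module_def tensor_def[abs_def] tensor_kernel_def tensor_relations_def assms)

section \<open>Tensor powers\<close>

lemma tpow_relationsE:
  assumes "s \<in> tpow_relations R M k"
  obtains (add) xs x y ys where "xs @ x # ys \<in> tpow_gens M k" "y \<in> carrier M"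
      "s = free_gen R (xs @ (x \<oplus>\<^bsub>M\<^esub> y) # ys) \<ominus>\<^bsub>free_module R (tpow_gens M k)\<^esub>
        (free_gen R (xs @ x # ys) \<oplus>\<^bsub>free_module R (tpow_gens M k)\<^esub> free_gen R (xs @ y # ys))"
  | (smult) r xs x ys where "xs @ x # ys \<in> tpow_gens M k" "r \<in> carrier R"
      "s = free_gen R (xs @ (r \<odot>\<^bsub>M\<^esub> x) # ys) \<ominus>\<^bsub>free_module R (tpow_gens M k)\<^esub>
        r \<odot>\<^bsub>free_module R (tpow_gens M k)\<^esub> free_gen R (xs @ x # ys)"
  using assms unfolding tpow_relations_def Let_def by blast

lemma tpow_gens_replace:
  assumes "xs @ x # ys \<in> tpow_gens M k"
  shows tpow_gens_slot: "x \<in> carrier M"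
    and tpow_gens_update: "y \<in> carrier M \<Longrightarrow> xs @ y # ys \<in> tpow_gens M k"
  using assms by (auto simp: tpow_gens_def)

lemma tpow_relations_subset:
  assumes "module R M"
  shows "tpow_relations R M k \<subseteq> carrier (free_module R (tpow_gens M k))" (is "_ \<subseteq> carrier ?F")
proof
  interpret M: module R M by fact
  interpret F: module R ?F by (rule free_module_module[OF M.R.is_cring])
  note g = free_gen_closed[OF M.R.is_cring]
  fix s assume "s \<in> tpow_relations R M k"
  then show "s \<in> carrier ?F"
  proof (cases rule: tpow_relationsE)
    case (add xs x y ys)
    note tpow_gens_update[OF add(1)]
    with add(2) tpow_gens_slot[OF add(1)] show ?thesis
      unfolding add(3) by (simp add: F.M.minus_closed F.M.a_closed g M.M.a_closed)
  next
    case (smult r xs x ys)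
    note tpow_gens_update[OF smult(1)]
    with smult(2) tpow_gens_slot[OF smult(1)] show ?thesis
      unfolding smult(3) by (simp add: F.M.minus_closed F.smult_closed g M.smult_closed)
  qed
qed

context
  fixes R :: "('a, 'r) ring_scheme" and M :: "('a, 'b, 'm) module_scheme" and k :: nat
  assumes M: "module R M"
begin

interpretation M: module R M by (rule M)

private lemmas base = M.R.is_cring
private lemmas rels = tpow_relations_subset[OF M, of k]
private lemmas unfolds = tpow_module_def tpow_kernel_def tpow_pure_def

lemma tpow_module_module: "module R (tpow_module R M k)"
  unfolding unfolds by (rule presented_module[OF base rels])

lemma tpow_pure_multilinear: "multilinear R M k (tpow_module R M k) (tpow_pure R M k)"
proof -
  let ?F = "free_module R (tpow_gens M k)"
  let ?K = "tpow_kernel R M k"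
  interpret F: module R ?F by (rule free_module_module[OF base])
  note facts = presented_facts[OF base rels, folded tpow_kernel_def]
  note rel = presented_relation[OF base rels, folded tpow_kernel_def]
  have g: "free_gen R xs \<in> carrier ?F" if "xs \<in> tpow_gens M k" for xs
    using that by (intro free_gen_closed[OF base])
  have pure: "tpow_pure R M k xs \<in> carrier (tpow_module R M k)" if "xs \<in> tpow_gens M k" for xs
    unfolding unfolds using that by (intro presented_gen_closed[OF base rels])
  show ?thesis
  proof (rule multilinearI)
    fix xs ys assume lists: "set xs \<subseteq> carrier M" "set ys \<subseteq> carrier M" "Suc (length xs + length ys) = k"
    have gens: "xs @ x # ys \<in> tpow_gens M k" if "x \<in> carrier M" for x
      using that lists by (auto simp: tpow_gens_def)
    show "linear_map R M (tpow_module R M k) (\<lambda>x. tpow_pure R M k (xs @ x # ys))"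
    proof (rule linear_mapI)
      fix x y assume xy: "x \<in> carrier M" "y \<in> carrier M"
      have "?K +>\<^bsub>?F\<^esub> free_gen R (xs @ (x \<oplus>\<^bsub>M\<^esub> y) # ys) =
          ?K +>\<^bsub>?F\<^esub> (free_gen R (xs @ x # ys) \<oplus>\<^bsub>?F\<^esub> free_gen R (xs @ y # ys))"
      proof (rule rel)
        show "free_gen R (xs @ (x \<oplus>\<^bsub>M\<^esub> y) # ys) \<ominus>\<^bsub>?F\<^esub>
            (free_gen R (xs @ x # ys) \<oplus>\<^bsub>?F\<^esub> free_gen R (xs @ y # ys)) \<in> tpow_relations R M k"
          unfolding tpow_relations_def Let_def using gens xy by blast
      qed (auto simp: g gens xy)
      then show "tpow_pure R M k (xs @ (x \<oplus>\<^bsub>M\<^esub> y) # ys) =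
          tpow_pure R M k (xs @ x # ys) \<oplus>\<^bsub>tpow_module R M k\<^esub> tpow_pure R M k (xs @ y # ys)"
        using xy g gens by (simp add: tpow_pure_def tpow_module_def quotient_module_add[OF facts])
    next
      fix r x assume rx: "r \<in> carrier R" "x \<in> carrier M"
      have "?K +>\<^bsub>?F\<^esub> free_gen R (xs @ (r \<odot>\<^bsub>M\<^esub> x) # ys) =
          ?K +>\<^bsub>?F\<^esub> (r \<odot>\<^bsub>?F\<^esub> free_gen R (xs @ x # ys))"
      proof (rule rel)
        show "free_gen R (xs @ (r \<odot>\<^bsub>M\<^esub> x) # ys) \<ominus>\<^bsub>?F\<^esub> r \<odot>\<^bsub>?F\<^esub> free_gen R (xs @ x # ys)
            \<in> tpow_relations R M k"
          unfolding tpow_relations_def Let_def using gens rx by blast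
      qed (auto simp: g gens rx)
      then show "tpow_pure R M k (xs @ (r \<odot>\<^bsub>M\<^esub> x) # ys) =
          r \<odot>\<^bsub>tpow_module R M k\<^esub> tpow_pure R M k (xs @ x # ys)"
        using rx g gens by (simp add: tpow_pure_def tpow_module_def quotient_module_smult[OF facts])
    qed (use pure gens in blast)
  qed (simp add: pure tpow_gens_def)
qed

lemma tpow_pure_closed: "xs \<in> tpow_gens M k \<Longrightarrow> tpow_pure R M k xs \<in> carrier (tpow_module R M k)"
  by (rule multilinear_closed[OF tpow_pure_multilinear])

lemma tpow_ext:
  assumes "module R V" "linear_map R (tpow_module R M k) V f" "linear_map R (tpow_module R M k) V g"
    and "\<And>xs. xs \<in> tpow_gens M k \<Longrightarrow> f (tpow_pure R M k xs) = g (tpow_pure R M k xs)"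
    and "t \<in> carrier (tpow_module R M k)"
  shows "f t = g t"
  using assms unfolding unfolds by - (rule presented_ext[OF base rels, of V f g], auto)

lemma tpow_bilinearI:
  assumes "module R L" "module R V"
    and "\<And>z. z \<in> carrier L \<Longrightarrow> linear_map R (tpow_module R M k) V (\<phi> z)"
    and "\<And>xs. xs \<in> tpow_gens M k \<Longrightarrow> linear_map R L V (\<lambda>z. \<phi> z (tpow_pure R M k xs))"
  shows "bilinear R L (tpow_module R M k) V \<phi>"
  using assms unfolding unfolds by - (rule presented_bilinearI[OF base rels], auto)

context
  fixes V :: "('a, 'v, 'o) module_scheme" and \<phi> :: "'b list \<Rightarrow> 'v"
  assumes V: "module R V" and \<phi>: "multilinear R M k V \<phi>"
begin

lemma tpow_lift_relations:
  assumes "s \<in> tpow_relations R M k"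
  shows "lin_ext R V \<phi> s = \<zero>\<^bsub>V\<^esub>"
proof -
  let ?F = "free_module R (tpow_gens M k)"
  let ?e = "lin_ext R V \<phi>"
  interpret V: module R V by (rule V)
  interpret F: module R ?F by (rule free_module_module[OF base])
  have lin: "linear_map R ?F V ?e"
    by (rule lin_ext_linear[OF base V]) (rule multilinear_closed[OF \<phi>])
  have e: "?e (free_gen R xs) = \<phi> xs" if "xs \<in> tpow_gens M k" for xs
    by (rule lin_ext_free_gen[OF base V multilinear_closed[OF \<phi>] that])
  have g: "free_gen R xs \<in> carrier ?F" if "xs \<in> tpow_gens M k" for xs
    using that by (intro free_gen_closed[OF base])
  have diff: "?e (c \<ominus>\<^bsub>?F\<^esub> d) = \<zero>\<^bsub>V\<^esub>" if "c \<in> carrier ?F" "d \<in> carrier ?F" "?e c = ?e d" for c d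
    using that linear_map_minus[OF F.module_axioms V lin, of c d] linear_map_closed[OF lin]
    by (simp add: a_minus_def V.r_neg)
  have ml: "linear_map R M V (\<lambda>x. \<phi> (xs @ x # ys))" if "xs @ x # ys \<in> tpow_gens M k" for xs x ys
    using that by (intro multilinear_linear[OF \<phi>]) (auto simp: tpow_gens_def)
  from assms show ?thesis
  proof (cases rule: tpow_relationsE)
    case (add xs x y ys)
    note x = tpow_gens_slot[OF add(1)] and G = tpow_gens_update[OF add(1)]
    show ?thesis
      unfolding add(3)
      by (rule diff)
        (simp_all add: g G x add(2) e linear_map_add[OF lin] linear_map_add[OF ml[OF add(1)]])
  next
    case (smult r xs x ys)
    note x = tpow_gens_slot[OF smult(1)] and G = tpow_gens_update[OF smult(1)]
    show ?thesis
      unfolding smult(3)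
      by (rule diff)
        (simp_all add: g G x smult(2) e linear_map_smult[OF lin] linear_map_smult[OF ml[OF smult(1)]])
  qed
qed

lemma tpow_lift_linear: "linear_map R (tpow_module R M k) V (lift R V \<phi>)"
  unfolding unfolds
  by (rule presented_lift_linear[OF base rels V])
    (auto simp: multilinear_closed[OF \<phi>] tpow_lift_relations)

lemma tpow_lift_pure:
  assumes "xs \<in> tpow_gens M k"
  shows "lift R V \<phi> (tpow_pure R M k xs) = \<phi> xs"
  unfolding unfolds
  by (subst presented_lift_gen[OF base rels V])
    (auto simp: assms multilinear_closed[OF \<phi>] tpow_lift_relations)

end

end

lemma tpow_bilinear_ext:
  assumes M: "module R M" and N: "module R N" and V: "module R V"
    and f: "bilinear R (tpow_module R M k) (tpow_module R N l) V f"
    and g: "bilinear R (tpow_module R M k) (tpow_module R N l) V g"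
    and eq: "\<And>xs ys. xs \<in> tpow_gens M k \<Longrightarrow> ys \<in> tpow_gens N l \<Longrightarrow>
      f (tpow_pure R M k xs) (tpow_pure R N l ys) = g (tpow_pure R M k xs) (tpow_pure R N l ys)"
    and s: "s \<in> carrier (tpow_module R M k)" and t: "t \<in> carrier (tpow_module R N l)"
  shows "f s t = g s t"
proof (rule tpow_ext[OF M V bilinear_left[OF f t] bilinear_left[OF g t] _ s])
  fix xs assume xs: "xs \<in> tpow_gens M k"
  then have xs': "tpow_pure R M k xs \<in> carrier (tpow_module R M k)"
    by (rule tpow_pure_closed[OF M])
  show "f (tpow_pure R M k xs) t = g (tpow_pure R M k xs) t"
    by (rule tpow_ext[OF N V bilinear_right[OF f xs'] bilinear_right[OF g xs'] _ t])
      (rule eq[OF xs])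
qed

text \<open>For maps that also depend on an element \<open>t\<close> of another module: slotwise
  linearity at an arbitrary \<open>t\<close> is read off from joint bilinearity in the slot and
  \<open>t\<close>, which can itself be checked at generators.\<close>

lemma multilinear_of_bilinear_slots:
  assumes M: "module R M" and closed: "\<And>xs. xs \<in> tpow_gens M k \<Longrightarrow> \<phi> xs t \<in> carrier V"
    and slot: "\<And>xs ys. set xs \<subseteq> carrier M \<Longrightarrow> set ys \<subseteq> carrier M \<Longrightarrow>
      Suc (length xs + length ys) = k \<Longrightarrow> bilinear R M W V (\<lambda>x. \<phi> (xs @ x # ys))"
    and t: "t \<in> carrier W"
  shows "multilinear R M k V (\<lambda>xs. \<phi> xs t)"
  by (intro multilinearI bilinear_left[OF slot t] closed) (auto simp: tpow_gens_def)

lemma tpow_gens_Cons: "x \<in> carrier M \<Longrightarrow> xs \<in> tpow_gens M k \<Longrightarrow> x # xs \<in> tpow_gens M (Suc k)"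
  by (auto simp: tpow_gens_def)

text \<open>The inner lift of \<open>tpow_Cons\<close>, named so that it can be used as a bilinear
  map of the new first factor and the remaining tensor.\<close>

definition tpow_prepend ::
  "('a, 'r) ring_scheme \<Rightarrow> ('a, 'b, 'm) module_scheme \<Rightarrow> nat
    \<Rightarrow> 'b \<Rightarrow> ('b list \<Rightarrow> 'a) set \<Rightarrow> ('b list \<Rightarrow> 'a) set"
  where "tpow_prepend R M k x =
    lift R (tpow_module R M (Suc k)) (\<lambda>xs. tpow_pure R M (Suc k) (x # xs))"

context
  fixes R :: "('a, 'r) ring_scheme" and M :: "('a, 'b, 'm) module_scheme" and k :: nat
  assumes M: "module R M"
begin

interpretation M: module R M by (rule M)

lemma tpow_prepend_pure:
  "x \<in> carrier M \<Longrightarrow> xs \<in> tpow_gens M k \<Longrightarrow>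
    tpow_prepend R M k x (tpow_pure R M k xs) = tpow_pure R M (Suc k) (x # xs)"
  unfolding tpow_prepend_def
  by (rule tpow_lift_pure[OF M tpow_module_module[OF M]
      multilinear_Cons_tail[OF tpow_pure_multilinear[OF M]]])

lemma tpow_prepend_bilinear:
  "bilinear R M (tpow_module R M k) (tpow_module R M (Suc k)) (tpow_prepend R M k)"
proof (rule tpow_bilinearI[OF M M tpow_module_module[OF M]])
  show "linear_map R (tpow_module R M k) (tpow_module R M (Suc k)) (tpow_prepend R M k z)"
    if "z \<in> carrier M" for z
    unfolding tpow_prepend_def
    by (rule tpow_lift_linear[OF M tpow_module_module[OF M]
        multilinear_Cons_tail[OF tpow_pure_multilinear[OF M] that]])
  show "linear_map R M (tpow_module R M (Suc k)) (\<lambda>z. tpow_prepend R M k z (tpow_pure R M k xs))"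
    if xs: "xs \<in> tpow_gens M k" for xs
    by (rule linear_map_cong[OF multilinear_Cons_head[OF tpow_pure_multilinear[OF M] xs] M])
      (simp add: tpow_prepend_pure xs)
qed

lemma tpow_Cons_linear:
  "linear_map R (tensor_module R M (tpow_module R M k)) (tpow_module R M (Suc k)) (tpow_Cons R M k)"
  unfolding tpow_Cons_def Let_def tpow_prepend_def[symmetric]
  by (rule tensor_lift_linear[OF M tpow_module_module[OF M] tpow_module_module[OF M]
      tpow_prepend_bilinear])

lemma tpow_Cons_tensor:
  "x \<in> carrier M \<Longrightarrow> t \<in> carrier (tpow_module R M k) \<Longrightarrow>
    tpow_Cons R M k (tensor R M (tpow_module R M k) x t) = tpow_prepend R M k x t"
  unfolding tpow_Cons_def Let_def tpow_prepend_def[symmetric]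
  by (rule tensor_lift_pure[OF M tpow_module_module[OF M] tpow_module_module[OF M]
      tpow_prepend_bilinear])

lemma tpow_map_linear:
  assumes "length fs = k" "\<And>f. f \<in> set fs \<Longrightarrow> linear_map R M M f"
  shows "linear_map R (tpow_module R M k) (tpow_module R M k) (tpow_map R M fs)"
  using tpow_lift_linear[OF M tpow_module_module[OF M]
      multilinear_map2[OF tpow_pure_multilinear[OF M, of k] assms]]
  by (simp add: tpow_map_def assms(1))

lemma tpow_map_pure:
  assumes "length fs = k" "\<And>f. f \<in> set fs \<Longrightarrow> linear_map R M M f" "xs \<in> tpow_gens M k"
  shows "tpow_map R M fs (tpow_pure R M k xs) = tpow_pure R M k (map2 (\<lambda>f x. f x) fs xs)"
  using tpow_lift_pure[OF M tpow_module_module[OF M]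
      multilinear_map2[OF tpow_pure_multilinear[OF M, of k] assms(1,2)] assms(3)]
  by (simp add: tpow_map_def assms(1))

context
  fixes \<sigma> :: "nat \<Rightarrow> nat"
  assumes \<sigma>: "\<sigma> permutes {..<k}"
begin

private lemma act_multilinear:
  "multilinear R M k (tpow_module R M k) (\<lambda>xs. tpow_pure R M k (permute_list (inv_into UNIV \<sigma>) xs))"
  by (rule multilinear_permute[OF tpow_pure_multilinear[OF M] permutes_inv[OF \<sigma>] M])

lemma tpow_act_linear: "linear_map R (tpow_module R M k) (tpow_module R M k) (tpow_act R M k \<sigma>)"
  unfolding tpow_act_def by (rule tpow_lift_linear[OF M tpow_module_module[OF M] act_multilinear])

lemma tpow_act_pure:
  "xs \<in> tpow_gens M k \<Longrightarrow>
    tpow_act R M k \<sigma> (tpow_pure R M k xs) = tpow_pure R M k (permute_list (inv_into UNIV \<sigma>) xs)"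
  unfolding tpow_act_def by (rule tpow_lift_pure[OF M tpow_module_module[OF M] act_multilinear])

end

end

text \<open>
  For \<open>T = M \<otimes> N\<close> and \<open>b\<close> the pure tensor this is the interchange
  \<open>M\<^bsup>\<otimes>k\<^esup> \<times> N\<^bsup>\<otimes>k\<^esup> \<rightarrow> (M \<otimes> N)\<^bsup>\<otimes>k\<^esup>\<close>.
\<close>

definition tpow_zip ::
  "('a, 'r) ring_scheme \<Rightarrow> ('a, 't, 'm) module_scheme \<Rightarrow> ('b \<Rightarrow> 'c \<Rightarrow> 't) \<Rightarrow> nat
    \<Rightarrow> ('b list \<Rightarrow> 'a) set \<Rightarrow> ('c list \<Rightarrow> 'a) set \<Rightarrow> ('t list \<Rightarrow> 'a) set"
  where "tpow_zip R T b k s t =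
    lift R (tpow_module R T k)
      (\<lambda>xs. lift R (tpow_module R T k) (\<lambda>ys. tpow_pure R T k (map2 b xs ys)) t) s"

text \<open>With one list fixed, zipping through \<open>b\<close> is the application of a list of
  linear maps, the partial applications of \<open>b\<close>. In this form, and its mirror image
  below, \<open>multilinear_map2\<close> covers it.\<close>

lemma map2_apply_map1: "map2 (\<lambda>f x. f x) (map b xs) ys = map2 b xs ys"
  by (simp add: zip_map1 comp_def case_prod_unfold)

lemma map2_apply_map2: "map2 (\<lambda>f x. f x) (map (\<lambda>y x. b x y) ys) xs = map2 b xs ys"
proof -
  have "zip ys xs = map (\<lambda>(x, y). (y, x)) (zip xs ys)"
    by (rule zip_commute)
  then show ?thesis
    by (simp add: zip_map1 comp_def case_prod_unfold)
qed

context
  fixes R :: "('a, 'r) ring_scheme" and M :: "('a, 'b, 'm) module_scheme"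
    and N :: "('a, 'c, 'n) module_scheme" and T :: "('a, 't, 'o) module_scheme"
    and b :: "'b \<Rightarrow> 'c \<Rightarrow> 't"
  assumes M: "module R M" and N: "module R N" and T: "module R T" and b: "bilinear R M N T b"
begin

interpretation M: module R M by (rule M)
interpretation N: module R N by (rule N)
interpretation T: module R T by (rule T)

lemma tpow_gens_map2: "xs \<in> tpow_gens M k \<Longrightarrow> ys \<in> tpow_gens N k \<Longrightarrow> map2 b xs ys \<in> tpow_gens T k"
  by (fastforce simp: tpow_gens_def intro: bilinear_closed[OF b] dest: set_zip_leftD set_zip_rightD)

private definition I where
  "I k xs = lift R (tpow_module R T k) (\<lambda>ys. tpow_pure R T k (map2 b xs ys))"

private lemma multi_right:
  assumes "xs \<in> tpow_gens M k"
  shows "multilinear R N k (tpow_module R T k) (\<lambda>ys. tpow_pure R T k (map2 b xs ys))"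
proof -
  have "multilinear R N k (tpow_module R T k)
      (\<lambda>ys. tpow_pure R T k (map2 (\<lambda>f x. f x) (map b xs) ys))"
    by (rule multilinear_map2[OF tpow_pure_multilinear[OF T]])
      (use assms in \<open>auto simp: tpow_gens_def bilinear_right[OF b]\<close>)
  then show ?thesis by (simp only: map2_apply_map1)
qed

private lemma multi_left:
  assumes "ys \<in> tpow_gens N k"
  shows "multilinear R M k (tpow_module R T k) (\<lambda>xs. tpow_pure R T k (map2 b xs ys))"
proof -
  have "multilinear R M k (tpow_module R T k)
      (\<lambda>xs. tpow_pure R T k (map2 (\<lambda>f x. f x) (map (\<lambda>y x. b x y) ys) xs))"
    by (rule multilinear_map2[OF tpow_pure_multilinear[OF T]])
      (use assms in \<open>auto simp: tpow_gens_def bilinear_left[OF b]\<close>)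
  then show ?thesis by (simp only: map2_apply_map2)
qed

private lemma I_linear:
  "xs \<in> tpow_gens M k \<Longrightarrow> linear_map R (tpow_module R N k) (tpow_module R T k) (I k xs)"
  unfolding I_def by (rule tpow_lift_linear[OF N tpow_module_module[OF T] multi_right])

private lemma I_pure:
  "xs \<in> tpow_gens M k \<Longrightarrow> ys \<in> tpow_gens N k \<Longrightarrow>
    I k xs (tpow_pure R N k ys) = tpow_pure R T k (map2 b xs ys)"
  unfolding I_def by (rule tpow_lift_pure[OF N tpow_module_module[OF T] multi_right])

text \<open>The second argument \<open>t\<close> is an arbitrary tensor. Linearity in a slot of
  \<open>xs\<close> is visible only for pure \<open>t\<close>, from \<open>multi_left\<close>, and
  is carried over to all \<open>t\<close> by \<open>tpow_bilinearI\<close>.\<close>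

private lemma I_multilinear:
  assumes t: "t \<in> carrier (tpow_module R N k)"
  shows "multilinear R M k (tpow_module R T k) (\<lambda>xs. I k xs t)"
proof (rule multilinear_of_bilinear_slots[OF M _ _ t])
  show "I k xs t \<in> carrier (tpow_module R T k)" if "xs \<in> tpow_gens M k" for xs
    by (rule linear_map_closed[OF I_linear[OF that] t])
  fix xs ys assume lists: "set xs \<subseteq> carrier M" "set ys \<subseteq> carrier M" "Suc (length xs + length ys) = k"
  then have gens: "xs @ x # ys \<in> tpow_gens M k" if "x \<in> carrier M" for x
    using that by (auto simp: tpow_gens_def)
  show "bilinear R M (tpow_module R N k) (tpow_module R T k) (\<lambda>x. I k (xs @ x # ys))"
  proof (rule tpow_bilinearI[OF N M tpow_module_module[OF T]])
    show "linear_map R (tpow_module R N k) (tpow_module R T k) (I k (xs @ z # ys))"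
      if "z \<in> carrier M" for z
      by (rule I_linear[OF gens[OF that]])
    show "linear_map R M (tpow_module R T k) (\<lambda>z. I k (xs @ z # ys) (tpow_pure R N k zs))"
      if zs: "zs \<in> tpow_gens N k" for zs
      by (rule linear_map_cong[OF multilinear_linear[OF multi_left[OF zs] lists] M])
        (simp add: I_pure gens zs)
  qed
qed

lemma tpow_zip_pure_left:
  "xs \<in> tpow_gens M k \<Longrightarrow> t \<in> carrier (tpow_module R N k) \<Longrightarrow>
    tpow_zip R T b k (tpow_pure R M k xs) t = I k xs t"
  unfolding tpow_zip_def I_def[symmetric]
  by (rule tpow_lift_pure[OF M tpow_module_module[OF T] I_multilinear])

lemma tpow_zip_pure:
  "xs \<in> tpow_gens M k \<Longrightarrow> ys \<in> tpow_gens N k \<Longrightarrow>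
    tpow_zip R T b k (tpow_pure R M k xs) (tpow_pure R N k ys) = tpow_pure R T k (map2 b xs ys)"
  by (simp add: tpow_zip_pure_left tpow_pure_closed[OF N] I_pure)

lemma tpow_zip_bilinear:
  "bilinear R (tpow_module R M k) (tpow_module R N k) (tpow_module R T k) (tpow_zip R T b k)"
proof -
  have "bilinear R (tpow_module R N k) (tpow_module R M k) (tpow_module R T k)
      (\<lambda>t s. tpow_zip R T b k s t)"
  proof (rule tpow_bilinearI[OF M tpow_module_module[OF N] tpow_module_module[OF T]])
    show "linear_map R (tpow_module R M k) (tpow_module R T k) (\<lambda>s. tpow_zip R T b k s t)"
      if "t \<in> carrier (tpow_module R N k)" for t
      unfolding tpow_zip_def I_def[symmetric]
      by (rule tpow_lift_linear[OF M tpow_module_module[OF T] I_multilinear[OF that]])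
    show "linear_map R (tpow_module R N k) (tpow_module R T k)
        (\<lambda>t. tpow_zip R T b k (tpow_pure R M k xs) t)" if "xs \<in> tpow_gens M k" for xs
      by (rule linear_map_cong[OF I_linear[OF that] tpow_module_module[OF N]])
        (simp add: tpow_zip_pure_left that)
  qed
  then show ?thesis by (auto simp: bilinear_def)
qed

text \<open>The recursion of the interchange along the first factor. It drives the induction step
  for the iterated comultiplication.\<close>

lemma tpow_zip_prepend:
  assumes xy: "x \<in> carrier M" "y \<in> carrier N"
    and s: "s \<in> carrier (tpow_module R M k)" and t: "t \<in> carrier (tpow_module R N k)"
  shows "tpow_zip R T b (Suc k) (tpow_prepend R M k x s) (tpow_prepend R N k y t) =
    tpow_prepend R T k (b x y) (tpow_zip R T b k s t)"
proof (rule tpow_bilinear_ext[OF M N tpow_module_module[OF T, of "Suc k"] _ _ _ s t])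
  show "bilinear R (tpow_module R M k) (tpow_module R N k) (tpow_module R T (Suc k))
      (\<lambda>s t. tpow_zip R T b (Suc k) (tpow_prepend R M k x s) (tpow_prepend R N k y t))"
    by (rule bilinear_compose_args[OF tpow_zip_bilinear
          bilinear_right[OF tpow_prepend_bilinear[OF M] xy(1)]
          bilinear_right[OF tpow_prepend_bilinear[OF N] xy(2)]])
  show "bilinear R (tpow_module R M k) (tpow_module R N k) (tpow_module R T (Suc k))
      (\<lambda>s t. tpow_prepend R T k (b x y) (tpow_zip R T b k s t))"
    by (rule bilinear_compose_result[OF tpow_zip_bilinear
          bilinear_right[OF tpow_prepend_bilinear[OF T] bilinear_closed[OF b xy]]])
qed (simp add: tpow_prepend_pure M N T xy tpow_zip_pure tpow_gens_Cons tpow_gens_map2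
      bilinear_closed[OF b])

text \<open>On pure tensors both sides reorder the same pairs: zipping commutes with applying one
  permutation to both lists.\<close>

lemma tpow_zip_act:
  assumes \<sigma>: "\<sigma> permutes {..<k}"
    and s: "s \<in> carrier (tpow_module R M k)" and t: "t \<in> carrier (tpow_module R N k)"
  shows "tpow_act R T k \<sigma> (tpow_zip R T b k s t) =
    tpow_zip R T b k (tpow_act R M k \<sigma> s) (tpow_act R N k \<sigma> t)"
proof (rule tpow_bilinear_ext[OF M N tpow_module_module[OF T, of k] _ _ _ s t])
  show "bilinear R (tpow_module R M k) (tpow_module R N k) (tpow_module R T k)
      (\<lambda>s t. tpow_act R T k \<sigma> (tpow_zip R T b k s t))"
    by (rule bilinear_compose_result[OF tpow_zip_bilinear tpow_act_linear[OF T \<sigma>]])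
  show "bilinear R (tpow_module R M k) (tpow_module R N k) (tpow_module R T k)
      (\<lambda>s t. tpow_zip R T b k (tpow_act R M k \<sigma> s) (tpow_act R N k \<sigma> t))"
    by (rule bilinear_compose_args[OF tpow_zip_bilinear tpow_act_linear[OF M \<sigma>]
          tpow_act_linear[OF N \<sigma>]])
  fix xs ys assume xs: "xs \<in> tpow_gens M k" and ys: "ys \<in> tpow_gens N k"
  let ?p = "inv_into UNIV \<sigma>"
  have p: "?p permutes {..<length xs}" "?p permutes {..<length ys}" "length xs = length ys"
    using permutes_inv[OF \<sigma>] xs ys by (auto simp: tpow_gens_def)
  then have "permute_list ?p xs \<in> tpow_gens M k" "permute_list ?p ys \<in> tpow_gens N k"
    using xs ys by (auto simp: tpow_gens_def)
  moreover have "permute_list ?p (map2 b xs ys) = map2 b (permute_list ?p xs) (permute_list ?p ys)"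
    using p by (simp add: permute_list_map permute_list_zip[of ?p "{..<length xs}"])
  ultimately show "tpow_act R T k \<sigma> (tpow_zip R T b k (tpow_pure R M k xs) (tpow_pure R N k ys)) =
      tpow_zip R T b k (tpow_act R M k \<sigma> (tpow_pure R M k xs)) (tpow_act R N k \<sigma> (tpow_pure R N k ys))"
    using xs ys by (simp add: tpow_zip_pure tpow_act_pure M N T \<sigma> tpow_gens_map2)
qed

end

section \<open>Graded structures\<close>

text \<open>
  Linearity of the maps entering \<^const>\<open>p_map\<close> does not need the bialgebra axioms; these
  weaker assumptions can be checked for a tensor product without proving that it is a bialgebra.
\<close>

locale prebialgebra = module R A
  for R :: "('a, 'r) ring_scheme" (structure)
    and A :: "('a, 'b, 'm) graded_bialgebra_scheme" (structure) +
  assumes mult_bilinear: "bilinear R A A A (monoid.mult A)"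
    and one_mem: "\<one>\<^bsub>A\<^esub> \<in> carrier A"
    and comult_lin: "linear_map R A (tensor_module R A A) (comult A)"
    and counit_lin: "linear_map R A (self_module R) (counit A)"
    and grade_proj_lin: "linear_map R A A (grade_proj A n)"
begin

lemma module: "module R A" by (rule module_axioms)

lemma iter_mult_linear: "linear_map R (tpow_module R A k) A (iter_mult R A)"
  unfolding iter_mult_def
  by (rule tpow_lift_linear[OF module module multilinear_foldr[OF module mult_bilinear one_mem]])

lemma iter_mult_pure:
  "xs \<in> tpow_gens A k \<Longrightarrow> iter_mult R A (tpow_pure R A k xs) = foldr (monoid.mult A) xs \<one>\<^bsub>A\<^esub>"
  unfolding iter_mult_def
  by (rule tpow_lift_pure[OF module module multilinear_foldr[OF module mult_bilinear one_mem]])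

lemma iter_comult_linear: "linear_map R A (tpow_module R A k) (iter_comult R A k)"
proof (induction k)
  case 0
  interpret P: module R "tpow_module R A 0" by (rule tpow_module_module[OF module])
  have pure: "tpow_pure R A 0 [] \<in> carrier (tpow_module R A 0)"
    by (rule tpow_pure_closed[OF module]) (simp add: tpow_gens_def)
  have "linear_map R (self_module R) (tpow_module R A 0)
      (\<lambda>r. r \<odot>\<^bsub>tpow_module R A 0\<^esub> tpow_pure R A 0 [])"
    by (rule linear_mapI) (simp_all add: self_module_def pure P.smult_l_distr P.smult_assoc1)
  from linear_map_compose[OF counit_lin this] show ?case by simp
next
  case (Suc k)
  note map = tensor_map_linear[OF module module module tpow_module_module[OF module]
      linear_map_id Suc]
  from linear_map_compose[OF linear_map_compose[OF comult_lin map] tpow_Cons_linear[OF module]]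
  show ?case by simp
qed

lemma p_map_linear:
  assumes "\<sigma> permutes {..<length \<alpha>}"
  shows "linear_map R A A (p_map R A \<alpha> \<sigma>)"
proof -
  have map: "linear_map R (tpow_module R A (length \<alpha>)) (tpow_module R A (length \<alpha>))
      (tpow_map R A (map (grade_proj A) \<alpha>))"
    using grade_proj_lin by (intro tpow_map_linear[OF module]) auto
  show ?thesis
    unfolding p_map_def comp_def
    by (rule linear_map_compose[OF linear_map_compose[OF linear_map_compose[OF iter_comult_linear
              tpow_act_linear[OF module permutes_inv[OF assms]]] map] iter_mult_linear])
qed

lemma tpow_gens_grade_proj:
  assumes "length \<alpha> = k" "xs \<in> tpow_gens A k"
  shows "map2 (\<lambda>f x. f x) (map (grade_proj A) \<alpha>) xs \<in> tpow_gens A k"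
proof -
  have "f x \<in> carrier A" if fx: "(f, x) \<in> set (zip (map (grade_proj A) \<alpha>) xs)" for f x
  proof -
    obtain n where "f = grade_proj A n"
      using set_zip_leftD[OF fx] by auto
    moreover have "x \<in> carrier A"
      using set_zip_rightD[OF fx] assms(2) by (auto simp: tpow_gens_def)
    ultimately show ?thesis
      using linear_map_closed[OF grade_proj_lin] by simp
  qed
  then show ?thesis
    using assms by (auto simp: tpow_gens_def)
qed

lemma tpow_map_grade_proj_linear:
  "length \<alpha> = k \<Longrightarrow>
    linear_map R (tpow_module R A k) (tpow_module R A k) (tpow_map R A (map (grade_proj A) \<alpha>))"
  using grade_proj_lin by (intro tpow_map_linear[OF module]) auto

lemma tpow_map_grade_proj_pure:
  "length \<alpha> = k \<Longrightarrow> xs \<in> tpow_gens A k \<Longrightarrow> tpow_map R A (map (grade_proj A) \<alpha>) (tpow_pure R A k xs) =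
    tpow_pure R A k (map2 (\<lambda>f x. f x) (map (grade_proj A) \<alpha>) xs)"
  using grade_proj_lin by (intro tpow_map_pure[OF module]) auto

end

text \<open>The definition sums over the exact support of \<open>c\<close>, which is awkward for
  sums of decompositions; any finite set outside which \<open>c\<close> vanishes may be used
  instead.\<close>

lemma homogeneous_componentsI:
  assumes A: "module R A" and sub: "\<And>n. submodule (grade A n) R A"
    and c: "\<And>n. c n \<in> grade A n" and N: "finite N" "\<And>n. n \<notin> N \<Longrightarrow> c n = \<zero>\<^bsub>A\<^esub>"
    and h: "h = (\<Oplus>\<^bsub>A\<^esub>n\<in>N. c n)"
  shows "homogeneous_components A h c"
proof -
  interpret A: module R A by (rule A)
  have "{n. c n \<noteq> \<zero>\<^bsub>A\<^esub>} \<subseteq> N" using N(2) by auto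
  moreover have "c n \<in> carrier A" for n using A.submoduleE(1)[OF sub] c by blast
  ultimately show ?thesis
    unfolding homogeneous_components_def h using N(1) c
    by (auto intro: finite_subset intro!: A.M.add.finprod_mono_neutral_cong_right)
qed

section \<open>Homogeneous projections of a graded bialgebra\<close>

context graded_bialgebra
begin

lemma module: "module R H" by (rule module_axioms)

lemma grade_closed: "x \<in> grade H n \<Longrightarrow> x \<in> carrier H"
  using submoduleE(1)[OF grade_submodule] by blast

lemma grade_proj_components:
  "h \<in> carrier H \<Longrightarrow> homogeneous_components H h (\<lambda>n. grade_proj H n h)"
  unfolding grade_proj_def by (rule theI'[OF grade_direct_sum])

lemma grade_proj_mem: "h \<in> carrier H \<Longrightarrow> grade_proj H n h \<in> grade H n"
  using grade_proj_components by (simp add: homogeneous_components_def)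

lemma grade_proj_closed: "h \<in> carrier H \<Longrightarrow> grade_proj H n h \<in> carrier H"
  by (rule grade_closed[OF grade_proj_mem])

lemma grade_proj_unique:
  assumes "h \<in> carrier H" "homogeneous_components H h c"
  shows "grade_proj H n h = c n"
  using the1_equality[where P = "homogeneous_components H h", OF grade_direct_sum[OF assms(1)] assms(2)] by (simp add: grade_proj_def)

lemma grade_decomposition:
  assumes "h \<in> carrier H"
  obtains N where "finite N" "\<And>n. n \<notin> N \<Longrightarrow> grade_proj H n h = \<zero>\<^bsub>H\<^esub>"
    "h = (\<Oplus>\<^bsub>H\<^esub>n\<in>N. grade_proj H n h)"
  using grade_proj_components[OF assms] that[of "{n. grade_proj H n h \<noteq> \<zero>\<^bsub>H\<^esub>}"]
  unfolding homogeneous_components_def by blast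

lemma grade_proj_homogeneous:
  assumes "h \<in> grade H i"
  shows "grade_proj H n h = (if n = i then h else \<zero>\<^bsub>H\<^esub>)"
proof (rule grade_proj_unique[OF grade_closed[OF assms]])
  show "homogeneous_components H h (\<lambda>n. if n = i then h else \<zero>\<^bsub>H\<^esub>)"
    using assms grade_closed[OF assms]
    by (intro homogeneous_componentsI[OF module grade_submodule, where N = "{i}"])
      (auto simp: submodule_zero_mem[OF grade_submodule])
qed

text \<open>Adding or scaling the components of given elements yields homogeneous components of the
  sum or multiple, and uniqueness identifies them with the projections. For sums both decompositions
  are first extended to the union of their index sets.\<close>

lemma grade_proj_linear: "linear_map R H H (grade_proj H n)"
proof (rule linear_mapI)
  fix x y assume xy: "x \<in> carrier H" "y \<in> carrier H"
  obtain N where N: "finite N" "\<And>n. n \<notin> N \<Longrightarrow> grade_proj H n x = \<zero>\<^bsub>H\<^esub>"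
    "x = (\<Oplus>\<^bsub>H\<^esub>n\<in>N. grade_proj H n x)"
    by (rule grade_decomposition[OF xy(1)]) blast
  obtain N' where N': "finite N'" "\<And>n. n \<notin> N' \<Longrightarrow> grade_proj H n y = \<zero>\<^bsub>H\<^esub>"
    "y = (\<Oplus>\<^bsub>H\<^esub>n\<in>N'. grade_proj H n y)"
    by (rule grade_decomposition[OF xy(2)]) blast
  have "(\<Oplus>\<^bsub>H\<^esub>n\<in>N. grade_proj H n x) = (\<Oplus>\<^bsub>H\<^esub>n\<in>N \<union> N'. grade_proj H n x)"
    using N(1,2) N'(1) xy grade_proj_closed by (intro M.add.finprod_mono_neutral_cong_left) auto
  moreover have "(\<Oplus>\<^bsub>H\<^esub>n\<in>N'. grade_proj H n y) = (\<Oplus>\<^bsub>H\<^esub>n\<in>N \<union> N'. grade_proj H n y)"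
    using N(1) N'(1,2) xy grade_proj_closed by (intro M.add.finprod_mono_neutral_cong_left) auto
  moreover have "(\<Oplus>\<^bsub>H\<^esub>n\<in>N \<union> N'. grade_proj H n x \<oplus>\<^bsub>H\<^esub> grade_proj H n y) =
      (\<Oplus>\<^bsub>H\<^esub>n\<in>N \<union> N'. grade_proj H n x) \<oplus>\<^bsub>H\<^esub> (\<Oplus>\<^bsub>H\<^esub>n\<in>N \<union> N'. grade_proj H n y)"
    using xy grade_proj_closed by (intro M.finsum_addf) auto
  ultimately have "x \<oplus>\<^bsub>H\<^esub> y = (\<Oplus>\<^bsub>H\<^esub>n\<in>N \<union> N'. grade_proj H n x \<oplus>\<^bsub>H\<^esub> grade_proj H n y)"
    using N(3) N'(3) by simp
  then have "homogeneous_components H (x \<oplus>\<^bsub>H\<^esub> y) (\<lambda>n. grade_proj H n x \<oplus>\<^bsub>H\<^esub> grade_proj H n y)"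
    using N(1,2) N'(1,2) xy grade_proj_mem submoduleE(5)[OF grade_submodule]
    by (intro homogeneous_componentsI[OF module grade_submodule, where N = "N \<union> N'"]) auto
  then show "grade_proj H n (x \<oplus>\<^bsub>H\<^esub> y) = grade_proj H n x \<oplus>\<^bsub>H\<^esub> grade_proj H n y"
    using xy by (intro grade_proj_unique) auto
next
  fix r x assume rx: "r \<in> carrier R" "x \<in> carrier H"
  obtain N where N: "finite N" "\<And>n. n \<notin> N \<Longrightarrow> grade_proj H n x = \<zero>\<^bsub>H\<^esub>"
    "x = (\<Oplus>\<^bsub>H\<^esub>n\<in>N. grade_proj H n x)"
    by (rule grade_decomposition[OF rx(2)]) blast
  have "r \<odot>\<^bsub>H\<^esub> (\<Oplus>\<^bsub>H\<^esub>n\<in>N. grade_proj H n x) = (\<Oplus>\<^bsub>H\<^esub>n\<in>N. r \<odot>\<^bsub>H\<^esub> grade_proj H n x)"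
    using N(1) rx grade_proj_closed by (intro finsum_smult_ldistr) auto
  then have "homogeneous_components H (r \<odot>\<^bsub>H\<^esub> x) (\<lambda>n. r \<odot>\<^bsub>H\<^esub> grade_proj H n x)"
    using N rx grade_proj_mem submoduleE(4)[OF grade_submodule]
    by (intro homogeneous_componentsI[OF module grade_submodule, where N = N]) auto
  then show "grade_proj H n (r \<odot>\<^bsub>H\<^esub> x) = r \<odot>\<^bsub>H\<^esub> grade_proj H n x"
    using rx by (intro grade_proj_unique) auto
qed (rule grade_proj_closed)

lemma prebialgebra: "prebialgebra R H"
proof (intro prebialgebra.intro prebialgebra_axioms.intro module grade_proj_linear)
  show "bilinear R H H H (monoid.mult H)"
    by (intro bilinearI linear_mapI)
      (auto simp: smult_mult_left smult_mult_right H.l_distr H.r_distr)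
qed (auto intro: comult_linear counit_linear)

end

lemma self_module_module: "cring R \<Longrightarrow> module R (self_module R)"
proof -
  assume R: "cring R"
  interpret R: cring R by (rule R)
  have "\<exists>y\<in>carrier R. y \<oplus>\<^bsub>R\<^esub> x = \<zero>\<^bsub>R\<^esub>" if "x \<in> carrier R" for x
    using that by (intro bexI[of _ "\<ominus>\<^bsub>R\<^esub> x"]) (auto simp: R.l_neg)
  then show ?thesis
    by (intro moduleI abelian_groupI R)
      (simp_all add: self_module_def R.l_distr R.r_distr R.m_assoc R.a_ac)
qed

lemma self_module_mult_bilinear:
  "cring R \<Longrightarrow> bilinear R (self_module R) (self_module R) (self_module R) (monoid.mult R)"
proof -
  assume "cring R"
  then interpret R: cring R .
  show ?thesis
    by (intro bilinearI linear_mapI)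
      (simp_all add: self_module_def R.l_distr R.r_distr R.m_ac)
qed

section \<open>The tensor product of two graded bialgebras\<close>

text \<open>The length conditions are essential: \<open>map2\<close> truncates to the shorter list,
  so the entrywise equation alone would admit arbitrary excess entries in one of the lists.\<close>

definition splittings :: "nat list \<Rightarrow> (nat list \<times> nat list) set"
  where "splittings \<alpha> =
    {(\<beta>, \<gamma>). length \<beta> = length \<alpha> \<and> length \<gamma> = length \<alpha> \<and> map2 (+) \<beta> \<gamma> = \<alpha>}"

lemma splittings_length:
  assumes "p \<in> splittings \<alpha>"
  shows "length (fst p) = length \<alpha>" "length (snd p) = length \<alpha>"
  using assms by (simp_all add: splittings_def case_prod_unfold)

lemma splittings_Nil: "splittings [] = {([], [])}"
  by (auto simp: splittings_def)

text \<open>Written as the image of a product so that the index set produced by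
  \<open>bilinear_finsum\<close>, a splitting of the head entry paired with one of the tail, can be
  reindexed to it.\<close>

lemma splittings_Cons:
  "splittings (a # \<alpha>) =
    (\<lambda>q. (fst (fst q) # fst (snd q), snd (fst q) # snd (snd q))) `
      ({p. fst p + snd p = a} \<times> splittings \<alpha>)"
  (is "_ = ?f ` ?S")
proof (intro equalityI subsetI)
  fix p assume "p \<in> splittings (a # \<alpha>)"
  then obtain i \<beta> j \<gamma> where "p = (i # \<beta>, j # \<gamma>)" "i + j = a" "(\<beta>, \<gamma>) \<in> splittings \<alpha>"
    by (auto simp: splittings_def length_Suc_conv)
  then show "p \<in> ?f ` ?S"
    by (intro image_eqI[of _ _ "((i, j), (\<beta>, \<gamma>))"]) auto
next
  fix p assume "p \<in> ?f ` ?S"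
  then obtain q where "q \<in> ?S" and p: "p = ?f q" by (rule imageE)
  then have "fst (fst q) + snd (fst q) = a" "snd q \<in> splittings \<alpha>"
    by (simp_all add: mem_Times_iff)
  then show "p \<in> splittings (a # \<alpha>)"
    unfolding p by (simp add: splittings_def case_prod_unfold)
qed

lemma finite_sum_pairs: "finite {p :: nat \<times> nat. fst p + snd p = n}"
  by (rule finite_subset[of _ "{..n} \<times> {..n}"]) auto

lemma finite_splittings: "finite (splittings \<alpha>)"
  by (induction \<alpha>) (simp_all add: splittings_Nil splittings_Cons finite_sum_pairs)

context
  fixes R :: "('a, 'r) ring_scheme"
    and H :: "('a, 'h, 'm) graded_bialgebra_scheme"
    and G :: "('a, 'g, 'n) graded_bialgebra_scheme"
  assumes H: "graded_bialgebra R H" and G: "graded_bialgebra R G"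
begin

interpretation H: graded_bialgebra R H by (rule H)
interpretation G: graded_bialgebra R G by (rule G)
interpretation HP: prebialgebra R H by (rule H.prebialgebra)
interpretation GP: prebialgebra R G by (rule G.prebialgebra)

private abbreviation (input) "HG \<equiv> tensor_module R H G"
private abbreviation (input) "T \<equiv> tensor_bialgebra R H G"
private abbreviation (input) "b \<equiv> tensor R H G"

private lemmas mods = H.module G.module
private lemmas HG_module = tensor_module_module[OF mods]

interpretation HG: module R HG by (rule HG_module)

lemma tensor_bialgebra_sels:
  "carrier T = carrier HG" "add T = add HG" "zero T = zero HG" "smult T = smult HG"
  "one T = b \<one>\<^bsub>H\<^esub> \<one>\<^bsub>G\<^esub>" "monoid.mult T = tensor_mult R H G" "comult T = tensor_comult R H G"
  "counit T = lift R (self_module R) (\<lambda>(h, g). counit H h \<otimes>\<^bsub>R\<^esub> counit G g)"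
  "grade T = tensor_grade R H G (grade H) (grade G)"
  by (simp_all add: tensor_bialgebra_def tensor_algebra_def)

text \<open>\<open>T\<close> and \<open>HG\<close> are records of different types over the same
  module. These equivalences let facts about the plain tensor product be used for the bialgebra
  record and back.\<close>

lemma tensor_bialgebra_linear_map:
  "linear_map R T N f \<longleftrightarrow> linear_map R HG N f"
  "linear_map R M T g \<longleftrightarrow> linear_map R M HG g"
  by (simp_all add: linear_map_def tensor_bialgebra_sels)

lemma tensor_bialgebra_bilinear:
  "bilinear R T T V \<phi> \<longleftrightarrow> bilinear R HG HG V \<phi>"
  "bilinear R M N T \<psi> \<longleftrightarrow> bilinear R M N HG \<psi>"
  by (simp_all add: bilinear_def tensor_bialgebra_linear_map tensor_bialgebra_sels)

lemma tensor_bialgebra_finsum: "finsum T = finsum HG"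
  by (rule finsum_cong_ring) (simp_all add: tensor_bialgebra_sels)

private lemma T_module: "module R T"
  by (rule module_cong[OF HG_module]) (simp_all add: tensor_bialgebra_sels)

private lemma T_submodule: "submodule N R T \<longleftrightarrow> submodule N R HG"
  by (simp add: submodule_iff[OF T_module] submodule_iff[OF HG_module] tensor_bialgebra_sels)

private lemma tensor_TT:
  "tensor_module R T T = tensor_module R HG HG" "tensor R T T = tensor R HG HG"
  by (rule tensor_module_cong; simp add: tensor_bialgebra_sels)+

private lemma b_bilinear: "bilinear R H G T b"
  by (simp add: tensor_bialgebra_bilinear tensor_bilinear[OF mods])

private lemma b_closed: "x \<in> carrier H \<Longrightarrow> y \<in> carrier G \<Longrightarrow> b x y \<in> carrier T"
  by (rule bilinear_closed[OF b_bilinear])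

section \<open>Structure maps of H \<otimes> G on pure tensors\<close>

lemma tensor_mult_facts:
  shows tensor_mult_bilinear: "bilinear R HG HG HG (tensor_mult R H G)"
    and tensor_mult_pure: "\<And>x y x' y'. x \<in> carrier H \<Longrightarrow> y \<in> carrier G \<Longrightarrow>
      x' \<in> carrier H \<Longrightarrow> y' \<in> carrier G \<Longrightarrow>
      tensor_mult R H G (b x y) (b x' y') = b (x \<otimes>\<^bsub>H\<^esub> x') (y \<otimes>\<^bsub>G\<^esub> y')"
proof -
  have eq: "tensor_mult R H G = (\<lambda>s t. lift R HG (\<lambda>(x, y). lift R HG (\<lambda>(x', y').
      b (x \<otimes>\<^bsub>H\<^esub> x') (y \<otimes>\<^bsub>G\<^esub> y')) t) s)"
    by (simp add: fun_eq_iff tensor_mult_def Let_def)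
  note right = bilinear_compose_args[OF tensor_bilinear[OF mods]
      bilinear_right[OF HP.mult_bilinear] bilinear_right[OF GP.mult_bilinear]]
  note left = bilinear_compose_args[OF tensor_bilinear[OF mods]
      bilinear_left[OF HP.mult_bilinear] bilinear_left[OF GP.mult_bilinear]]
  show "bilinear R HG HG HG (tensor_mult R H G)"
    unfolding eq by (rule tensor_lift2_bilinear[OF mods mods HG_module right left])
  show "tensor_mult R H G (b x y) (b x' y') = b (x \<otimes>\<^bsub>H\<^esub> x') (y \<otimes>\<^bsub>G\<^esub> y')"
    if "x \<in> carrier H" "y \<in> carrier G" "x' \<in> carrier H" "y' \<in> carrier G" for x y x' y'
    unfolding eq by (rule tensor_lift2_pure[OF mods mods HG_module right left that])
qed

text \<open>The exchange of the two middle factors, extracted from \<open>tensor_comult\<close> as a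
  bilinear map of a tensor over H and a tensor over G. It can then be applied to comultiplications,
  which need not be pure tensors.\<close>

definition interchange where
  "interchange s t = lift R (tensor_module R HG HG) (\<lambda>(h\<^sub>1, h\<^sub>2). lift R (tensor_module R HG HG)
    (\<lambda>(g\<^sub>1, g\<^sub>2). tensor R HG HG (b h\<^sub>1 g\<^sub>1) (b h\<^sub>2 g\<^sub>2)) t) s"

lemma interchange_facts:
  shows interchange_bilinear:
      "bilinear R (tensor_module R H H) (tensor_module R G G) (tensor_module R HG HG) interchange"
    and interchange_pure: "\<And>h\<^sub>1 h\<^sub>2 g\<^sub>1 g\<^sub>2. h\<^sub>1 \<in> carrier H \<Longrightarrow> h\<^sub>2 \<in> carrier H \<Longrightarrow> g\<^sub>1 \<in> carrier G \<Longrightarrow>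
      g\<^sub>2 \<in> carrier G \<Longrightarrow> interchange (tensor R H H h\<^sub>1 h\<^sub>2) (tensor R G G g\<^sub>1 g\<^sub>2) =
        tensor R HG HG (b h\<^sub>1 g\<^sub>1) (b h\<^sub>2 g\<^sub>2)"
proof -
  note right = bilinear_compose_args[OF tensor_bilinear[OF HG_module HG_module]
      bilinear_right[OF tensor_bilinear[OF mods]] bilinear_right[OF tensor_bilinear[OF mods]]]
  note left = bilinear_compose_args[OF tensor_bilinear[OF HG_module HG_module]
      bilinear_left[OF tensor_bilinear[OF mods]] bilinear_left[OF tensor_bilinear[OF mods]]]
  note facts = H.module H.module G.module G.module tensor_module_module[OF HG_module HG_module]
  show "bilinear R (tensor_module R H H) (tensor_module R G G) (tensor_module R HG HG) interchange"
    unfolding interchange_def[abs_def] by (rule tensor_lift2_bilinear[OF facts right left])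
  show "interchange (tensor R H H h\<^sub>1 h\<^sub>2) (tensor R G G g\<^sub>1 g\<^sub>2) = tensor R HG HG (b h\<^sub>1 g\<^sub>1) (b h\<^sub>2 g\<^sub>2)"
    if "h\<^sub>1 \<in> carrier H" "h\<^sub>2 \<in> carrier H" "g\<^sub>1 \<in> carrier G" "g\<^sub>2 \<in> carrier G" for h\<^sub>1 h\<^sub>2 g\<^sub>1 g\<^sub>2
    unfolding interchange_def by (rule tensor_lift2_pure[OF facts right left that])
qed

lemma tensor_comult_facts:
  shows tensor_comult_linear: "linear_map R HG (tensor_module R HG HG) (tensor_comult R H G)"
    and tensor_comult_pure: "\<And>h g. h \<in> carrier H \<Longrightarrow> g \<in> carrier G \<Longrightarrow>
      tensor_comult R H G (b h g) = interchange (comult H h) (comult G g)"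
proof -
  have eq: "tensor_comult R H G =
      lift R (tensor_module R HG HG) (\<lambda>(h, g). interchange (comult H h) (comult G g))"
    by (simp add: tensor_comult_def Let_def interchange_def)
  note bil = bilinear_compose_args[OF interchange_bilinear H.comult_linear G.comult_linear]
  note V = tensor_module_module[OF HG_module HG_module]
  show "linear_map R HG (tensor_module R HG HG) (tensor_comult R H G)"
    unfolding eq by (rule tensor_lift_linear[OF mods V bil])
  show "tensor_comult R H G (b h g) = interchange (comult H h) (comult G g)"
    if "h \<in> carrier H" "g \<in> carrier G" for h g
    unfolding eq by (rule tensor_lift_pure[OF mods V bil that])
qed

lemma tensor_counit_facts:
  shows tensor_counit_linear: "linear_map R T (self_module R) (counit T)"
    and tensor_counit_pure: "\<And>h g. h \<in> carrier H \<Longrightarrow> g \<in> carrier G \<Longrightarrow>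
      counit T (b h g) = counit H h \<otimes>\<^bsub>R\<^esub> counit G g"
proof -
  note bil = bilinear_compose_args[OF self_module_mult_bilinear[OF H.R.is_cring]
      H.counit_linear G.counit_linear]
  note V = self_module_module[OF H.R.is_cring]
  show "linear_map R T (self_module R) (counit T)"
    unfolding tensor_bialgebra_linear_map tensor_bialgebra_sels
    by (rule tensor_lift_linear[OF mods V bil])
  show "counit T (b h g) = counit H h \<otimes>\<^bsub>R\<^esub> counit G g" if "h \<in> carrier H" "g \<in> carrier G" for h g
    unfolding tensor_bialgebra_sels by (rule tensor_lift_pure[OF mods V bil that])
qed

text \<open>
  The degree-\<open>n\<close> projection of \<open>H \<otimes> G\<close> is \<open>\<Sum>\<^bsub>i+j=n\<^esub> p\<^sub>i \<otimes> p\<^sub>j\<close>: this map fixes the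
  degree-\<open>n\<close> component and kills the others, which also shows that the components are independent.
\<close>

private definition degree_part where
  "degree_part n t = (\<Oplus>\<^bsub>HG\<^esub>p\<in>{p. fst p + snd p = n}.
    tensor_map R H G (grade_proj H (fst p)) (grade_proj G (snd p)) t)"

private lemmas proj_tensor_linear =
  tensor_map_linear[OF mods mods H.grade_proj_linear G.grade_proj_linear]
private lemmas proj_tensor_pure =
  tensor_map_pure[OF mods mods H.grade_proj_linear G.grade_proj_linear]

private lemma degree_part_linear: "linear_map R HG HG (degree_part n)"
  unfolding degree_part_def[abs_def]
  by (rule linear_map_finsum_fun[OF HG_module HG_module finite_sum_pairs proj_tensor_linear])

private lemma degree_part_pure:
  "h \<in> carrier H \<Longrightarrow> g \<in> carrier G \<Longrightarrow>
    degree_part n (b h g) = (\<Oplus>\<^bsub>HG\<^esub>p\<in>{p. fst p + snd p = n}. b (grade_proj H (fst p) h) (grade_proj G (snd p) g))"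
  by (simp add: degree_part_def proj_tensor_pure)

private lemma tensor_grade_submodule: "submodule (tensor_grade R H G (grade H) (grade G) n) R HG"
  unfolding tensor_grade_def
  by (intro submodule_span_submodule[OF HG_module])
    (auto intro!: tensor_closed[OF mods] H.grade_closed G.grade_closed)

private lemma tensor_grade_pure:
  "x \<in> grade H i \<Longrightarrow> y \<in> grade G j \<Longrightarrow> b x y \<in> tensor_grade R H G (grade H) (grade G) (i + j)"
  unfolding tensor_grade_def
  by (rule subsetD[OF submodule_span_superset[OF HG_module]])
    (auto intro!: tensor_closed[OF mods] H.grade_closed G.grade_closed)

text \<open>Every summand at a pure tensor is a tensor of homogeneous elements whose degrees add up
  to \<open>n\<close>; the rest is linearity.\<close>

private lemma degree_part_mem:
  assumes "t \<in> carrier HG"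
  shows "degree_part n t \<in> tensor_grade R H G (grade H) (grade G) n" (is "_ \<in> ?D")
  using assms
proof (induction rule: tensor_induct[OF mods, consumes 1, case_names zero add smult pure])
  case zero
  show ?case
    using linear_map_zero[OF HG_module HG_module degree_part_linear] submodule_zero_mem[OF tensor_grade_submodule]
    by simp
next
  case (add s t)
  then show ?case
    using HG.submoduleE(5)[OF tensor_grade_submodule] by (simp add: linear_map_add[OF degree_part_linear])
next
  case (smult r t)
  then show ?case
    using HG.submoduleE(4)[OF tensor_grade_submodule] by (simp add: linear_map_smult[OF degree_part_linear])
next
  case (pure h g)
  then show ?case
    by (auto simp: degree_part_pure intro!: submodule_finsum[OF HG_module tensor_grade_submodule]
        tensor_grade_pure H.grade_proj_mem G.grade_proj_mem)
qed

text \<open>Of all the products of projections only the one with index (i, j) does not kill the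
  tensor, and this index occurs in the sum exactly when n = i + j.\<close>

private lemma degree_part_homogeneous_pure:
  assumes x: "x \<in> grade H i" and y: "y \<in> grade G j"
  shows "degree_part n (b x y) = (if n = i + j then b x y else \<zero>\<^bsub>HG\<^esub>)"
proof -
  note xy = H.grade_closed[OF x] G.grade_closed[OF y]
  note zero = linear_map_zero[OF H.module HG_module bilinear_left[OF tensor_bilinear[OF mods]]]
    linear_map_zero[OF G.module HG_module bilinear_right[OF tensor_bilinear[OF mods]]]
  have "degree_part n (b x y) = (\<Oplus>\<^bsub>HG\<^esub>p\<in>{p. fst p + snd p = n}. if p = (i, j) then b x y else \<zero>\<^bsub>HG\<^esub>)"
    unfolding degree_part_pure[OF xy] using xy
    by (intro HG.finsum_cong')
      (auto simp: H.grade_proj_homogeneous[OF x] G.grade_proj_homogeneous[OF y] zero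
        prod_eq_iff tensor_closed[OF mods])
  also have "\<dots> = (if n = i + j then b x y else \<zero>\<^bsub>HG\<^esub>)"
  proof (cases "n = i + j")
    case True
    then show ?thesis
      using HG.M.add.finprod_singleton_swap[OF _ finite_sum_pairs, of "(i, j)" n "\<lambda>_. b x y"]
        tensor_closed[OF mods xy] by simp
  next
    case False
    have "(\<Oplus>\<^bsub>HG\<^esub>p\<in>{p. fst p + snd p = n}. if p = (i, j) then b x y else \<zero>\<^bsub>HG\<^esub>) = \<zero>\<^bsub>HG\<^esub>"
      by (rule HG.M.add.finprod_one_eqI) (use False in auto)
    with False show ?thesis by simp
  qed
  finally show ?thesis .
qed

private lemma degree_part_homogeneous:
  assumes t: "t \<in> tensor_grade R H G (grade H) (grade G) m"
  shows "degree_part n t = (if n = m then t else \<zero>\<^bsub>HG\<^esub>)"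
proof -
  have "linear_map R HG HG (\<lambda>t. if n = m then t else \<zero>\<^bsub>HG\<^esub>)"
    using linear_map_id linear_map_const_zero[OF HG_module HG_module] by (cases "n = m") simp_all
  note sub = submodule_equalizer[OF HG_module HG_module degree_part_linear this, of n]
  have "tensor_grade R H G (grade H) (grade G) m
      \<subseteq> {t \<in> carrier HG. degree_part n t = (if n = m then t else \<zero>\<^bsub>HG\<^esub>)}"
    unfolding tensor_grade_def
    by (rule submodule_span_least[OF sub])
      (auto simp: degree_part_homogeneous_pure intro!: tensor_closed[OF mods] H.grade_closed G.grade_closed)
  with t show ?thesis by blast
qed

text \<open>The sum formula is claimed for every finite set containing \<open>N\<close>, not just
  for \<open>N\<close>. This makes the property stable under addition: the union of the two sets
  works for both summands, although neither set alone need work for the other.\<close>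

private lemma degree_part_decomposition:
  assumes "t \<in> carrier HG"
  shows "\<exists>N. finite N \<and> (\<forall>n. n \<notin> N \<longrightarrow> degree_part n t = \<zero>\<^bsub>HG\<^esub>) \<and>
    (\<forall>N'. finite N' \<longrightarrow> N \<subseteq> N' \<longrightarrow> (\<Oplus>\<^bsub>HG\<^esub>n\<in>N'. degree_part n t) = t)" (is "?D t")
proof -
  note sum_lin = linear_map_finsum_fun[OF HG_module HG_module _ degree_part_linear]
  note degree_part_zero = linear_map_zero[OF HG_module HG_module degree_part_linear]
  have D_zero: "?D \<zero>\<^bsub>HG\<^esub>"
    by (rule exI[of _ "{}"]) (simp add: degree_part_zero)
  have D_add: "?D (s \<oplus>\<^bsub>HG\<^esub> t)" if st: "s \<in> carrier HG" "t \<in> carrier HG" and D: "?D s" "?D t" for s t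
  proof -
    from D(1) obtain N where N: "finite N" "\<forall>n. n \<notin> N \<longrightarrow> degree_part n s = \<zero>\<^bsub>HG\<^esub>"
      "\<forall>L. finite L \<longrightarrow> N \<subseteq> L \<longrightarrow> (\<Oplus>\<^bsub>HG\<^esub>n\<in>L. degree_part n s) = s"
      by (elim exE conjE)
    from D(2) obtain N' where N': "finite N'" "\<forall>n. n \<notin> N' \<longrightarrow> degree_part n t = \<zero>\<^bsub>HG\<^esub>"
      "\<forall>L. finite L \<longrightarrow> N' \<subseteq> L \<longrightarrow> (\<Oplus>\<^bsub>HG\<^esub>n\<in>L. degree_part n t) = t"
      by (elim exE conjE)
    show ?thesis
    proof (intro exI[of _ "N \<union> N'"] conjI allI impI)
      show "finite (N \<union> N')" using N(1) N'(1) by simp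
      show "degree_part n (s \<oplus>\<^bsub>HG\<^esub> t) = \<zero>\<^bsub>HG\<^esub>" if "n \<notin> N \<union> N'" for n
        using that N(2) N'(2) by (simp add: linear_map_add[OF degree_part_linear] st)
      show "(\<Oplus>\<^bsub>HG\<^esub>n\<in>L. degree_part n (s \<oplus>\<^bsub>HG\<^esub> t)) = s \<oplus>\<^bsub>HG\<^esub> t" if "finite L" "N \<union> N' \<subseteq> L" for L
        using that N(3) N'(3) by (simp only: linear_map_add[OF sum_lin] st) simp
    qed
  qed
  have D_hom: "?D (b x y)" if xy: "x \<in> grade H i" "y \<in> grade G j" for x y i j
  proof (intro exI[of _ "{i + j}"] conjI allI impI)
    fix L assume L: "finite L" "{i + j} \<subseteq> L"
    have cl: "b x y \<in> carrier HG"
      using xy by (intro tensor_closed[OF mods] H.grade_closed G.grade_closed)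
    then show "(\<Oplus>\<^bsub>HG\<^esub>n\<in>L. degree_part n (b x y)) = b x y"
      using HG.M.add.finprod_singleton_swap[OF _ L(1), of "i + j" "\<lambda>_. b x y"] L(2)
      by (simp add: degree_part_homogeneous_pure[OF xy])
  qed (simp_all add: degree_part_homogeneous_pure[OF xy])
  have D_finsum: "?D (finsum HG f I)" if "finite I" "\<And>i. i \<in> I \<Longrightarrow> f i \<in> carrier HG \<and> ?D (f i)"
    for I :: "(nat \<times> nat) set" and f
    using that
  proof (induction I)
    case empty
    show ?case using D_zero by simp
  next
    case (insert i I)
    then have "finsum HG f (insert i I) = f i \<oplus>\<^bsub>HG\<^esub> finsum HG f I" "finsum HG f I \<in> carrier HG"
      by (auto intro!: HG.finsum_insert HG.finsum_closed)
    then show ?case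
      using insert D_add[of "f i" "finsum HG f I"] by simp
  qed
  show ?thesis
    using assms
  proof (induction rule: tensor_induct[OF mods, consumes 1, case_names zero add smult pure])
    case (smult r t)
    from smult(3) obtain N where N: "finite N" "\<forall>n. n \<notin> N \<longrightarrow> degree_part n t = \<zero>\<^bsub>HG\<^esub>"
      "\<forall>L. finite L \<longrightarrow> N \<subseteq> L \<longrightarrow> (\<Oplus>\<^bsub>HG\<^esub>n\<in>L. degree_part n t) = t"
      by (elim exE conjE)
    show ?case
    proof (intro exI[of _ N] conjI allI impI)
      show "degree_part n (r \<odot>\<^bsub>HG\<^esub> t) = \<zero>\<^bsub>HG\<^esub>" if "n \<notin> N" for n
        using that N(2) smult(1,2) by (simp add: linear_map_smult[OF degree_part_linear])
      show "(\<Oplus>\<^bsub>HG\<^esub>n\<in>L. degree_part n (r \<odot>\<^bsub>HG\<^esub> t)) = r \<odot>\<^bsub>HG\<^esub> t" if "finite L" "N \<subseteq> L" for L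
        using that N(3) smult(1,2) by (simp only: linear_map_smult[OF sum_lin])
    qed (rule N(1))
  next
    case (pure h g)
    \<comment> \<open>A pure tensor need not be homogeneous. Splitting both factors into components
      writes it as a finite sum of homogeneous pure tensors, to which \<open>D_hom\<close> and
      \<open>D_finsum\<close> apply.\<close>
    obtain I where I: "finite I" "h = (\<Oplus>\<^bsub>H\<^esub>i\<in>I. grade_proj H i h)"
      by (rule H.grade_decomposition[OF pure(1)]) blast
    obtain J where J: "finite J" "g = (\<Oplus>\<^bsub>G\<^esub>j\<in>J. grade_proj G j g)"
      by (rule G.grade_decomposition[OF pure(2)]) blast
    have "b h g = b (\<Oplus>\<^bsub>H\<^esub>i\<in>I. grade_proj H i h) (\<Oplus>\<^bsub>G\<^esub>j\<in>J. grade_proj G j g)"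
      using I(2) J(2) by simp
    also have "\<dots> = (\<Oplus>\<^bsub>HG\<^esub>p\<in>I \<times> J. b (grade_proj H (fst p) h) (grade_proj G (snd p) g))"
      using pure by (intro bilinear_finsum[OF mods HG_module tensor_bilinear[OF mods] I(1) J(1)]
          H.grade_proj_closed G.grade_proj_closed)
    finally have eq: "b h g = \<dots>" .
    have "?D (\<Oplus>\<^bsub>HG\<^esub>p\<in>I \<times> J. b (grade_proj H (fst p) h) (grade_proj G (snd p) g))"
    proof (rule D_finsum)
      show "b (grade_proj H (fst p) h) (grade_proj G (snd p) g) \<in> carrier HG \<and>
          ?D (b (grade_proj H (fst p) h) (grade_proj G (snd p) g))" for p
        using pure by (intro conjI tensor_closed[OF mods] H.grade_proj_closed G.grade_proj_closed
            D_hom[OF H.grade_proj_mem G.grade_proj_mem])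
    qed (simp add: I(1) J(1))
    then show ?case by (simp only: eq[symmetric])
  qed (rule D_zero, rule D_add)
qed

text \<open>Existence of components is \<open>degree_part_decomposition\<close>. For uniqueness,
  \<open>degree_part n\<close> applied to any homogeneous decomposition returns its entry in degree
  \<open>n\<close>, so the entry depends only on \<open>t\<close>.\<close>

lemma tensor_grade_proj:
  assumes t: "t \<in> carrier HG"
  shows "grade_proj T n t = (\<Oplus>\<^bsub>HG\<^esub>p\<in>{p. fst p + snd p = n}.
    tensor_map R H G (grade_proj H (fst p)) (grade_proj G (snd p)) t)"
proof -
  have "(THE c. homogeneous_components T t c) = (\<lambda>n. degree_part n t)"
  proof (rule the_equality)
    from degree_part_decomposition[OF t] obtain N where N: "finite N" "\<And>n. n \<notin> N \<Longrightarrow> degree_part n t = \<zero>\<^bsub>HG\<^esub>"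
      "(\<Oplus>\<^bsub>HG\<^esub>n\<in>N. degree_part n t) = t" by (metis order_refl)
    show "homogeneous_components T t (\<lambda>n. degree_part n t)"
    proof (rule homogeneous_componentsI[OF T_module _ _ N(1)])
      show "submodule (grade T n) R T" for n
        using tensor_grade_submodule[of n] by (simp add: T_submodule tensor_bialgebra_sels)
    qed (simp_all add: tensor_bialgebra_sels tensor_bialgebra_finsum N degree_part_mem t)
  next
    fix c assume c: "homogeneous_components T t c"
    let ?I = "{m. c m \<noteq> \<zero>\<^bsub>HG\<^esub>}"
    have c': "\<And>m. c m \<in> tensor_grade R H G (grade H) (grade G) m"
      and I: "finite ?I" and t': "t = (\<Oplus>\<^bsub>HG\<^esub>m\<in>?I. c m)"
      using c by (simp_all add: homogeneous_components_def tensor_bialgebra_sels tensor_bialgebra_finsum)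
    have cl: "c m \<in> carrier HG" for m
      using HG.submoduleE(1)[OF tensor_grade_submodule] c' by blast
    show "c = (\<lambda>n. degree_part n t)"
    proof
      fix n
      have "degree_part n t = (\<Oplus>\<^bsub>HG\<^esub>m\<in>?I. degree_part n (c m))"
        by (subst t', rule linear_map_finsum[OF HG_module HG_module degree_part_linear I cl])
      also have "\<dots> = (\<Oplus>\<^bsub>HG\<^esub>m\<in>?I. if m = n then c m else \<zero>\<^bsub>HG\<^esub>)"
        by (intro HG.finsum_cong') (auto simp: degree_part_homogeneous[OF c'] cl)
      moreover have "(\<Oplus>\<^bsub>HG\<^esub>m\<in>?I. if m = n then c m else \<zero>\<^bsub>HG\<^esub>) = c n"
      \<comment> \<open>The set \<open>?I\<close> is the exact support of \<open>c\<close>, so an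
        \<open>n\<close> outside it has c n = 0, in agreement with a sum all of whose terms are
        zero.\<close>
      proof (cases "n \<in> ?I")
        case True
        have "c \<in> ?I \<rightarrow> carrier HG" by (rule funcsetI) (rule cl)
        then show ?thesis
          by (rule HG.M.add.finprod_singleton_swap[OF True I])
      next
        case False
        then have "c n = \<zero>\<^bsub>HG\<^esub>" by simp
        moreover have "(\<Oplus>\<^bsub>HG\<^esub>m\<in>?I. if m = n then c m else \<zero>\<^bsub>HG\<^esub>) = \<zero>\<^bsub>HG\<^esub>"
          by (rule HG.M.add.finprod_one_eqI) (use False in simp)
        ultimately show ?thesis by (simp only:)
      qed
      ultimately show "c n = degree_part n t" by (simp only:)
    qed
  qed
  then show ?thesis by (simp only: grade_proj_def degree_part_def)
qed

lemma tensor_grade_proj_pure: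
  "h \<in> carrier H \<Longrightarrow> g \<in> carrier G \<Longrightarrow>
    grade_proj T n (b h g) =
      (\<Oplus>\<^bsub>HG\<^esub>p\<in>{p. fst p + snd p = n}. b (grade_proj H (fst p) h) (grade_proj G (snd p) g))"
  by (simp add: tensor_grade_proj[OF tensor_closed[OF mods]] proj_tensor_pure)

lemma tensor_prebialgebra: "prebialgebra R T"
proof (intro prebialgebra.intro prebialgebra_axioms.intro T_module)
  show "bilinear R T T T (monoid.mult T)"
    unfolding tensor_bialgebra_bilinear tensor_bialgebra_sels by (rule tensor_mult_bilinear)
  show "\<one>\<^bsub>T\<^esub> \<in> carrier T"
    by (simp add: tensor_bialgebra_sels tensor_closed[OF mods])
  show "linear_map R T (tensor_module R T T) (comult T)"
    unfolding tensor_bialgebra_linear_map tensor_TT tensor_bialgebra_sels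
    by (rule tensor_comult_linear)
  show "linear_map R T (self_module R) (counit T)" by (rule tensor_counit_linear)
  show "linear_map R T T (grade_proj T n)" for n
    unfolding tensor_bialgebra_linear_map
    by (rule linear_map_cong[OF degree_part_linear HG_module]) (simp add: tensor_grade_proj degree_part_def)
qed

section \<open>The interchange and the iterated structure maps\<close>

interpretation TP: prebialgebra R T by (rule tensor_prebialgebra)

text \<open>Induction on k. The base case compares counits: both scalars come out of the two
  arguments of the bilinear interchange as their product. In the induction step the two sides are
  bilinear in the comultiplications of \<open>h\<close> and \<open>g\<close>, so these are replaced
  by pure tensors, where the induction hypothesis and \<open>tpow_zip_prepend\<close>
  finish.\<close>

lemma tensor_iter_comult:
  "h \<in> carrier H \<Longrightarrow> g \<in> carrier G \<Longrightarrow>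
    iter_comult R T k (b h g) = tpow_zip R T b k (iter_comult R H k h) (iter_comult R G k g)"
proof (induction k arbitrary: h g)
  case 0
  interpret P: module R "tpow_module R T 0" by (rule tpow_module_module[OF T_module])
  have nil: "[] \<in> tpow_gens H 0" "[] \<in> tpow_gens G 0" "[] \<in> tpow_gens T 0"
    by (simp_all add: tpow_gens_def)
  note bil = tpow_zip_bilinear[OF mods T_module b_bilinear, of 0]
  have c: "counit H h \<in> carrier R" "counit G g \<in> carrier R"
    using linear_map_closed[OF H.counit_linear] linear_map_closed[OF G.counit_linear] 0
    by (simp_all add: self_module_def)
  note pc = tpow_pure_closed[OF H.module nil(1)] tpow_pure_closed[OF G.module nil(2)]
    tpow_pure_closed[OF T_module nil(3)]
  note GH = module.smult_closed[OF tpow_module_module[OF G.module]]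
  show ?case
    using 0 c
    by (simp add: tensor_counit_pure linear_map_smult[OF bilinear_left[OF bil]] pc GH
        linear_map_smult[OF bilinear_right[OF bil]] P.smult_assoc1
        tpow_zip_pure[OF mods T_module b_bilinear nil(1,2)])
next
  case (Suc k)
  \<comment> \<open>These are the recursion steps of \<open>iter_comult\<close> as maps on arbitrary
    tensors, detached from the comultiplication that feeds them.\<close>
  let ?DH = "\<lambda>t. tpow_Cons R H k (tensor_map R H (tpow_module R H k) (\<lambda>x. x) (iter_comult R H k) t)"
  let ?DG = "\<lambda>t. tpow_Cons R G k (tensor_map R G (tpow_module R G k) (\<lambda>x. x) (iter_comult R G k) t)"
  let ?DT = "\<lambda>t. tpow_Cons R T k (tensor_map R T (tpow_module R T k) (\<lambda>x. x) (iter_comult R T k) t)"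
  note lin = linear_map_compose[OF tensor_map_linear[OF _ _ _ tpow_module_module linear_map_id] tpow_Cons_linear]
  have DH: "linear_map R (tensor_module R H H) (tpow_module R H (Suc k)) ?DH"
    by (rule lin) (rule H.module HP.iter_comult_linear)+
  have DG: "linear_map R (tensor_module R G G) (tpow_module R G (Suc k)) ?DG"
    by (rule lin) (rule G.module GP.iter_comult_linear)+
  have DT: "linear_map R (tensor_module R HG HG) (tpow_module R T (Suc k)) ?DT"
    unfolding tensor_TT[symmetric] by (rule lin) (rule T_module TP.iter_comult_linear)+
  note map_pure = tensor_map_pure[OF _ _ _ tpow_module_module linear_map_id]
  have DH_pure: "?DH (tensor R H H x y) = tpow_prepend R H k x (iter_comult R H k y)"
    if "x \<in> carrier H" "y \<in> carrier H" for x y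
    using that linear_map_closed[OF HP.iter_comult_linear]
    by (simp add: map_pure[OF H.module H.module H.module H.module HP.iter_comult_linear]
        tpow_Cons_tensor[OF H.module])
  have DG_pure: "?DG (tensor R G G x y) = tpow_prepend R G k x (iter_comult R G k y)"
    if "x \<in> carrier G" "y \<in> carrier G" for x y
    using that linear_map_closed[OF GP.iter_comult_linear]
    by (simp add: map_pure[OF G.module G.module G.module G.module GP.iter_comult_linear]
        tpow_Cons_tensor[OF G.module])
  have DT_pure: "?DT (tensor R HG HG x y) = tpow_prepend R T k x (iter_comult R T k y)"
    if "x \<in> carrier T" "y \<in> carrier T" for x y
    using that linear_map_closed[OF TP.iter_comult_linear]
    by (simp add: map_pure[OF T_module T_module T_module T_module TP.iter_comult_linear]
        tpow_Cons_tensor[OF T_module] flip: tensor_TT)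
  have "?DT (interchange u v) = tpow_zip R T b (Suc k) (?DH u) (?DG v)"
    if u: "u \<in> carrier (tensor_module R H H)" and v: "v \<in> carrier (tensor_module R G G)" for u v
  proof (rule tensor_bilinear_ext[OF H.module H.module G.module G.module
        tpow_module_module[OF T_module] _ _ _ u v])
    show "bilinear R (tensor_module R H H) (tensor_module R G G) (tpow_module R T (Suc k))
        (\<lambda>u v. ?DT (interchange u v))"
      by (rule bilinear_compose_result[OF interchange_bilinear DT])
    show "bilinear R (tensor_module R H H) (tensor_module R G G) (tpow_module R T (Suc k))
        (\<lambda>u v. tpow_zip R T b (Suc k) (?DH u) (?DG v))"
      by (rule bilinear_compose_args[OF tpow_zip_bilinear[OF mods T_module b_bilinear] DH DG])
    fix x y x' y' assume xy: "x \<in> carrier H" "y \<in> carrier H" "x' \<in> carrier G" "y' \<in> carrier G"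
    then show "?DT (interchange (tensor R H H x y) (tensor R G G x' y')) =
        tpow_zip R T b (Suc k) (?DH (tensor R H H x y)) (?DG (tensor R G G x' y'))"
      by (simp add: interchange_pure DH_pure DG_pure DT_pure b_closed Suc.IH
          tpow_zip_prepend[OF mods T_module b_bilinear]
          linear_map_closed[OF HP.iter_comult_linear] linear_map_closed[OF GP.iter_comult_linear])
  qed
  then show ?case
    using Suc.prems linear_map_closed[OF H.comult_linear] linear_map_closed[OF G.comult_linear]
    by (simp add: tensor_bialgebra_sels tensor_comult_pure)
qed

text \<open>On pure tensors this is the factorwise product of H \<otimes> G, repeated along two
  lists of equal length; the units match at the end of the fold.\<close>

lemma tensor_iter_mult:
  assumes s: "s \<in> carrier (tpow_module R H k)" and t: "t \<in> carrier (tpow_module R G k)"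
  shows "iter_mult R T (tpow_zip R T b k s t) = b (iter_mult R H s) (iter_mult R G t)"
proof (rule tpow_bilinear_ext[OF mods T_module _ _ _ s t])
  show "bilinear R (tpow_module R H k) (tpow_module R G k) T
      (\<lambda>s t. iter_mult R T (tpow_zip R T b k s t))"
    by (rule bilinear_compose_result[OF tpow_zip_bilinear[OF mods T_module b_bilinear]
          TP.iter_mult_linear])
  show "bilinear R (tpow_module R H k) (tpow_module R G k) T
      (\<lambda>s t. b (iter_mult R H s) (iter_mult R G t))"
    by (rule bilinear_compose_args[OF b_bilinear HP.iter_mult_linear GP.iter_mult_linear])
  fix xs ys assume xs: "xs \<in> tpow_gens H k" and ys: "ys \<in> tpow_gens G k"
  have cl: "foldr (monoid.mult H) zs \<one>\<^bsub>H\<^esub> \<in> carrier H" if "set zs \<subseteq> carrier H" for zs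
    using that by (induction zs) auto
  have cl': "foldr (monoid.mult G) zs \<one>\<^bsub>G\<^esub> \<in> carrier G" if "set zs \<subseteq> carrier G" for zs
    using that by (induction zs) auto
  have "length xs = length ys" "set xs \<subseteq> carrier H" "set ys \<subseteq> carrier G"
    using xs ys by (auto simp: tpow_gens_def)
  then have "foldr (monoid.mult T) (map2 b xs ys) \<one>\<^bsub>T\<^esub> =
      b (foldr (monoid.mult H) xs \<one>\<^bsub>H\<^esub>) (foldr (monoid.mult G) ys \<one>\<^bsub>G\<^esub>)"
    by (induction xs ys rule: list_induct2)
      (simp_all add: tensor_bialgebra_sels tensor_mult_pure cl cl')
  then show "iter_mult R T (tpow_zip R T b k (tpow_pure R H k xs) (tpow_pure R G k ys)) =
      b (iter_mult R H (tpow_pure R H k xs)) (iter_mult R G (tpow_pure R G k ys))"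
    using xs ys
    by (simp add: tpow_zip_pure[OF mods T_module b_bilinear] TP.iter_mult_pure HP.iter_mult_pure
        GP.iter_mult_pure tpow_gens_map2[OF mods T_module b_bilinear])
qed

section \<open>Homogeneous projections on tensor powers\<close>

private abbreviation (input) "apply_list fs xs \<equiv> map2 (\<lambda>f x. f x) fs xs"

text \<open>Induction on \<alpha>. The head factor contributes a sum over pairs, the tail a sum over
  splittings by induction, and bilinearity of \<open>tpow_prepend\<close> multiplies the two sums
  out.\<close>

private lemma tensor_grade_proj_list:
  assumes "length \<alpha> = k" "xs \<in> tpow_gens H k" "ys \<in> tpow_gens G k"
  shows "tpow_pure R T k (apply_list (map (grade_proj T) \<alpha>) (map2 b xs ys)) =
    (\<Oplus>\<^bsub>tpow_module R T k\<^esub>p\<in>splittings \<alpha>.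
      tpow_pure R T k (map2 b (apply_list (map (grade_proj H) (fst p)) xs)
        (apply_list (map (grade_proj G) (snd p)) ys)))"
  using assms
proof (induction \<alpha> arbitrary: k xs ys)
  case Nil
  interpret P: module R "tpow_module R T 0" by (rule tpow_module_module[OF T_module])
  have "tpow_pure R T 0 [] \<in> carrier (tpow_module R T 0)"
    by (rule tpow_pure_closed[OF T_module]) (simp add: tpow_gens_def)
  with Nil show ?case by (simp add: splittings_Nil)
next
  case (Cons a \<alpha> k' xs' ys')
  then obtain k x xs y ys where k: "k' = Suc k" "length \<alpha> = k"
    and xs': "xs' = x # xs" "x \<in> carrier H" "xs \<in> tpow_gens H k"
    and ys': "ys' = y # ys" "y \<in> carrier G" "ys \<in> tpow_gens G k"
    by (cases xs'; cases ys') (auto simp: tpow_gens_def)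
  interpret P: module R "tpow_module R T (Suc k)" by (rule tpow_module_module[OF T_module])
  let ?P = "{p. fst p + snd p = a}"
  let ?u = "\<lambda>p. b (grade_proj H (fst p) x) (grade_proj G (snd p) y)"
  let ?v = "\<lambda>p. map2 b (apply_list (map (grade_proj H) (fst p)) xs)
      (apply_list (map (grade_proj G) (snd p)) ys)"
  have u: "?u p \<in> carrier T" for p
    using xs'(2) ys'(2) by (intro b_closed H.grade_proj_closed G.grade_proj_closed)
  have v: "?v p \<in> tpow_gens T k" if "p \<in> splittings \<alpha>" for p
    using splittings_length[OF that] k(2) xs'(3) ys'(3)
    by (intro tpow_gens_map2[OF mods T_module b_bilinear] HP.tpow_gens_grade_proj
        GP.tpow_gens_grade_proj) simp_all
  have w: "apply_list (map (grade_proj T) \<alpha>) (map2 b xs ys) \<in> tpow_gens T k"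
    by (intro TP.tpow_gens_grade_proj tpow_gens_map2[OF mods T_module b_bilinear] k xs' ys')
  \<comment> \<open>The injective map behind \<open>splittings_Cons\<close>; it attaches the two
    parts of the head entry to the splitting of the tail.\<close>
  let ?ext = "\<lambda>q. (fst (fst q) # fst (snd q), snd (fst q) # snd (snd q))"
  let ?F = "\<lambda>p. tpow_pure R T k' (map2 b (apply_list (map (grade_proj H) (fst p)) xs')
      (apply_list (map (grade_proj G) (snd p)) ys'))"
  have F: "?F (?ext q) = tpow_prepend R T k (?u (fst q)) (tpow_pure R T k (?v (snd q)))"
    if "q \<in> ?P \<times> splittings \<alpha>" for q
    using that by (simp add: k(1) xs'(1) ys'(1) tpow_prepend_pure[OF T_module u v] mem_Times_iff)
  have closed: "tpow_prepend R T k (?u (fst q)) (tpow_pure R T k (?v (snd q)))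
      \<in> carrier (tpow_module R T (Suc k))" if "q \<in> ?P \<times> splittings \<alpha>" for q
    using that by (intro bilinear_closed[OF tpow_prepend_bilinear[OF T_module]] u
        tpow_pure_closed[OF T_module] v) (simp add: mem_Times_iff)
  have F_closed: "?F (?ext q) \<in> carrier (tpow_module R T (Suc k))"
    if "q \<in> ?P \<times> splittings \<alpha>" for q
    by (subst F[OF that]) (rule closed[OF that])
  have "tpow_pure R T k' (apply_list (map (grade_proj T) (a # \<alpha>)) (map2 b xs' ys')) =
      tpow_prepend R T k (grade_proj T a (b x y))
        (tpow_pure R T k (apply_list (map (grade_proj T) \<alpha>) (map2 b xs ys)))"
    using linear_map_closed[OF TP.grade_proj_lin b_closed[OF xs'(2) ys'(2)]] w
    by (simp add: k(1) xs'(1) ys'(1) tpow_prepend_pure[OF T_module])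
  also have "\<dots> = tpow_prepend R T k (\<Oplus>\<^bsub>T\<^esub>p\<in>?P. ?u p)
      (\<Oplus>\<^bsub>tpow_module R T k\<^esub>p\<in>splittings \<alpha>. tpow_pure R T k (?v p))"
    by (simp only: tensor_grade_proj_pure[OF xs'(2) ys'(2)] Cons.IH[OF k(2) xs'(3) ys'(3)]
        tensor_bialgebra_finsum)
  also have "\<dots> = (\<Oplus>\<^bsub>tpow_module R T (Suc k)\<^esub>q\<in>?P \<times> splittings \<alpha>.
      tpow_prepend R T k (?u (fst q)) (tpow_pure R T k (?v (snd q))))"
    by (rule bilinear_finsum[OF T_module tpow_module_module[OF T_module]
          tpow_module_module[OF T_module] tpow_prepend_bilinear[OF T_module]
          finite_sum_pairs finite_splittings u tpow_pure_closed[OF T_module v]])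
  also have "\<dots> = (\<Oplus>\<^bsub>tpow_module R T (Suc k)\<^esub>q\<in>?P \<times> splittings \<alpha>. ?F (?ext q))"
    by (rule P.finsum_cong'[OF refl funcsetI]) (rule F_closed F[symmetric], assumption)+
  also have "\<dots> = (\<Oplus>\<^bsub>tpow_module R T (Suc k)\<^esub>p\<in>?ext ` (?P \<times> splittings \<alpha>). ?F p)"
  proof (rule P.finsum_reindex[symmetric])
    show "?F \<in> ?ext ` (?P \<times> splittings \<alpha>) \<rightarrow> carrier (tpow_module R T (Suc k))"
      by (rule funcsetI, elim imageE) (simp only: F_closed)
    show "inj_on ?ext (?P \<times> splittings \<alpha>)"
      by (rule inj_onI) (simp add: prod_eq_iff)
  qed
  finally show ?case
    by (simp only: splittings_Cons k(1))
qed

text \<open>Both sides are bilinear in \<open>s\<close> and \<open>t\<close>, so the list identity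
  above, which is about pure tensors, extends to all of them.\<close>

private lemma tensor_tpow_map_grade_proj:
  assumes \<alpha>: "length \<alpha> = k"
    and s: "s \<in> carrier (tpow_module R H k)" and t: "t \<in> carrier (tpow_module R G k)"
  shows "tpow_map R T (map (grade_proj T) \<alpha>) (tpow_zip R T b k s t) =
    (\<Oplus>\<^bsub>tpow_module R T k\<^esub>p\<in>splittings \<alpha>.
      tpow_zip R T b k (tpow_map R H (map (grade_proj H) (fst p)) s)
        (tpow_map R G (map (grade_proj G) (snd p)) t))"
proof (rule tpow_bilinear_ext[OF mods tpow_module_module[OF T_module] _ _ _ s t])
  interpret P: module R "tpow_module R T k" by (rule tpow_module_module[OF T_module])
  have len: "length (fst p) = k" "length (snd p) = k" if "p \<in> splittings \<alpha>" for p
    using splittings_length[OF that] \<alpha> by simp_all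
  note bil = tpow_zip_bilinear[OF mods T_module b_bilinear]
  show "bilinear R (tpow_module R H k) (tpow_module R G k) (tpow_module R T k)
      (\<lambda>s t. tpow_map R T (map (grade_proj T) \<alpha>) (tpow_zip R T b k s t))"
    by (rule bilinear_compose_result[OF bil TP.tpow_map_grade_proj_linear[OF \<alpha>]])
  show "bilinear R (tpow_module R H k) (tpow_module R G k) (tpow_module R T k)
      (\<lambda>s t. \<Oplus>\<^bsub>tpow_module R T k\<^esub>p\<in>splittings \<alpha>.
        tpow_zip R T b k (tpow_map R H (map (grade_proj H) (fst p)) s)
          (tpow_map R G (map (grade_proj G) (snd p)) t))"
    by (rule bilinear_finsum_fun[OF tpow_module_module[OF H.module] tpow_module_module[OF G.module]
          tpow_module_module[OF T_module] finite_splittings])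
      (rule bilinear_compose_args[OF bil HP.tpow_map_grade_proj_linear[OF len(1)]
          GP.tpow_map_grade_proj_linear[OF len(2)]])
  fix xs ys assume xs: "xs \<in> tpow_gens H k" and ys: "ys \<in> tpow_gens G k"
  note gens = HP.tpow_gens_grade_proj[OF len(1) xs] GP.tpow_gens_grade_proj[OF len(2) ys]
  have "tpow_map R T (map (grade_proj T) \<alpha>) (tpow_zip R T b k (tpow_pure R H k xs) (tpow_pure R G k ys)) =
      tpow_pure R T k (apply_list (map (grade_proj T) \<alpha>) (map2 b xs ys))"
    using xs ys by (simp add: tpow_zip_pure[OF mods T_module b_bilinear]
        TP.tpow_map_grade_proj_pure[OF \<alpha>] tpow_gens_map2[OF mods T_module b_bilinear])
  also note tensor_grade_proj_list[OF \<alpha> xs ys]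
  also have "(\<Oplus>\<^bsub>tpow_module R T k\<^esub>p\<in>splittings \<alpha>.
      tpow_pure R T k (map2 b (apply_list (map (grade_proj H) (fst p)) xs)
        (apply_list (map (grade_proj G) (snd p)) ys))) =
    (\<Oplus>\<^bsub>tpow_module R T k\<^esub>p\<in>splittings \<alpha>.
      tpow_zip R T b k (tpow_map R H (map (grade_proj H) (fst p)) (tpow_pure R H k xs))
        (tpow_map R G (map (grade_proj G) (snd p)) (tpow_pure R G k ys)))"
  proof (rule P.finsum_cong'[OF refl])
    show "tpow_pure R T k (map2 b (apply_list (map (grade_proj H) (fst p)) xs)
        (apply_list (map (grade_proj G) (snd p)) ys)) =
      tpow_zip R T b k (tpow_map R H (map (grade_proj H) (fst p)) (tpow_pure R H k xs))
        (tpow_map R G (map (grade_proj G) (snd p)) (tpow_pure R G k ys))"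
      if "p \<in> splittings \<alpha>" for p
      using gens[OF that]
      by (simp only: HP.tpow_map_grade_proj_pure[OF len(1)[OF that] xs]
          GP.tpow_map_grade_proj_pure[OF len(2)[OF that] ys]
          tpow_zip_pure[OF mods T_module b_bilinear])
    show "(\<lambda>p. tpow_zip R T b k (tpow_map R H (map (grade_proj H) (fst p)) (tpow_pure R H k xs))
        (tpow_map R G (map (grade_proj G) (snd p)) (tpow_pure R G k ys)))
      \<in> splittings \<alpha> \<rightarrow> carrier (tpow_module R T k)"
      using len xs ys
      by (intro funcsetI bilinear_closed[OF bil] linear_map_closed[OF HP.tpow_map_grade_proj_linear]
          linear_map_closed[OF GP.tpow_map_grade_proj_linear] tpow_pure_closed[OF H.module]
          tpow_pure_closed[OF G.module])
  qed
  finally show "tpow_map R T (map (grade_proj T) \<alpha>)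
      (tpow_zip R T b k (tpow_pure R H k xs) (tpow_pure R G k ys)) = \<dots>" .
qed

text \<open>The splitting is chosen only at the projections. Everything before them is the same for
  all summands and is moved through the interchange once; multiplication afterwards acts on each
  summand separately.\<close>

lemma tensor_p_map_pure:
  assumes \<alpha>: "length \<alpha> = k" and \<sigma>: "\<sigma> permutes {..<k}"
    and h: "h \<in> carrier H" and g: "g \<in> carrier G"
  shows "p_map R T \<alpha> \<sigma> (b h g) =
    (\<Oplus>\<^bsub>HG\<^esub>p\<in>splittings \<alpha>. b (p_map R H (fst p) \<sigma> h) (p_map R G (snd p) \<sigma> g))"
proof -
  \<comment> \<open>The common input of all projections. The acting permutation is the inverse of
    \<sigma>, as in \<open>p_map\<close>, so \<open>tpow_zip_act\<close> is used with the
    inverse.\<close>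
  define s t where "s = tpow_act R H k (inv_into UNIV \<sigma>) (iter_comult R H k h)"
    and "t = tpow_act R G k (inv_into UNIV \<sigma>) (iter_comult R G k g)"
  note \<sigma>' = permutes_inv[OF \<sigma>]
  have ic: "iter_comult R H k h \<in> carrier (tpow_module R H k)"
    "iter_comult R G k g \<in> carrier (tpow_module R G k)"
    using h g by (auto intro: linear_map_closed[OF HP.iter_comult_linear]
        linear_map_closed[OF GP.iter_comult_linear])
  have st: "s \<in> carrier (tpow_module R H k)" "t \<in> carrier (tpow_module R G k)"
    unfolding s_def t_def
    by (intro linear_map_closed[OF tpow_act_linear[OF H.module \<sigma>']]
        linear_map_closed[OF tpow_act_linear[OF G.module \<sigma>']] ic)+
  have len: "length (fst p) = k" "length (snd p) = k" if "p \<in> splittings \<alpha>" for p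
    using splittings_length[OF that] \<alpha> by simp_all
  have cl: "tpow_map R H (map (grade_proj H) (fst p)) s \<in> carrier (tpow_module R H k)"
    "tpow_map R G (map (grade_proj G) (snd p)) t \<in> carrier (tpow_module R G k)"
    if "p \<in> splittings \<alpha>" for p
    using len[OF that] st by (auto intro: linear_map_closed[OF HP.tpow_map_grade_proj_linear]
        linear_map_closed[OF GP.tpow_map_grade_proj_linear])
  have "p_map R T \<alpha> \<sigma> (b h g) =
      iter_mult R T (tpow_map R T (map (grade_proj T) \<alpha>) (tpow_zip R T b k s t))"
    by (simp add: p_map_def \<alpha> tensor_iter_comult[OF h g] s_def t_def
        tpow_zip_act[OF mods T_module b_bilinear \<sigma>' ic])
  also have "\<dots> = (\<Oplus>\<^bsub>T\<^esub>p\<in>splittings \<alpha>. iter_mult R T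
      (tpow_zip R T b k (tpow_map R H (map (grade_proj H) (fst p)) s)
        (tpow_map R G (map (grade_proj G) (snd p)) t)))"
    unfolding tensor_tpow_map_grade_proj[OF \<alpha> st]
    by (rule linear_map_finsum[OF tpow_module_module[OF T_module] T_module TP.iter_mult_linear
          finite_splittings bilinear_closed[OF tpow_zip_bilinear[OF mods T_module b_bilinear] cl]])
  also have "\<dots> = (\<Oplus>\<^bsub>HG\<^esub>p\<in>splittings \<alpha>. b (p_map R H (fst p) \<sigma> h) (p_map R G (snd p) \<sigma> g))"
    unfolding tensor_bialgebra_finsum
  proof (rule HG.finsum_cong'[OF refl])
    show "(\<lambda>p. b (p_map R H (fst p) \<sigma> h) (p_map R G (snd p) \<sigma> g)) \<in> splittings \<alpha> \<rightarrow> carrier HG"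
      using len \<sigma> h g
      by (intro funcsetI tensor_closed[OF mods] linear_map_closed[OF HP.p_map_linear]
          linear_map_closed[OF GP.p_map_linear]) simp_all
    show "iter_mult R T (tpow_zip R T b k (tpow_map R H (map (grade_proj H) (fst p)) s)
        (tpow_map R G (map (grade_proj G) (snd p)) t)) =
      b (p_map R H (fst p) \<sigma> h) (p_map R G (snd p) \<sigma> g)" if "p \<in> splittings \<alpha>" for p
      unfolding tensor_iter_mult[OF cl[OF that]]
      \<comment> \<open>\<open>p_map\<close> reads the tensor power off the length of its weak
        composition. Both parts of a splitting have length \<open>k\<close>, which is why
        \<open>s\<close> and \<open>t\<close> serve every summand.\<close>
      using len[OF that] by (simp add: p_map_def s_def t_def)
  qed
  finally show ?thesis .
qed

text \<open>On pure tensors \<open>tensor_map\<close> evaluates to the tensors of the previous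
  formula. Linearity of both sides does the rest.\<close>

lemma tensor_p_map:
  assumes \<alpha>: "length \<alpha> = k" and \<sigma>: "\<sigma> permutes {..<k}" and t: "t \<in> carrier T"
  shows "p_map R T \<alpha> \<sigma> t =
    (\<Oplus>\<^bsub>T\<^esub>p\<in>splittings \<alpha>. tensor_map R H G (p_map R H (fst p) \<sigma>) (p_map R G (snd p) \<sigma>) t)"
proof -
  have lin: "linear_map R H H (p_map R H (fst p) \<sigma>)" "linear_map R G G (p_map R G (snd p) \<sigma>)"
    if "p \<in> splittings \<alpha>" for p
    using splittings_length[OF that] \<alpha> \<sigma> by (simp_all add: HP.p_map_linear GP.p_map_linear)
  show ?thesis
    unfolding tensor_bialgebra_finsum
  proof (rule tensor_ext[OF mods HG_module, where f = "p_map R T \<alpha> \<sigma>" and t = t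
        and g = "\<lambda>t. \<Oplus>\<^bsub>HG\<^esub>p\<in>splittings \<alpha>.
          tensor_map R H G (p_map R H (fst p) \<sigma>) (p_map R G (snd p) \<sigma>) t"])
    show "linear_map R HG HG (p_map R T \<alpha> \<sigma>)"
      using TP.p_map_linear[of \<sigma> \<alpha>] \<alpha> \<sigma> by (simp add: tensor_bialgebra_linear_map)
    show "linear_map R HG HG (\<lambda>t. \<Oplus>\<^bsub>HG\<^esub>p\<in>splittings \<alpha>.
        tensor_map R H G (p_map R H (fst p) \<sigma>) (p_map R G (snd p) \<sigma>) t)"
      by (rule linear_map_finsum_fun[OF HG_module HG_module finite_splittings
            tensor_map_linear[OF mods mods lin]])
    show "p_map R T \<alpha> \<sigma> (b h g) = (\<Oplus>\<^bsub>HG\<^esub>p\<in>splittings \<alpha>.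
        tensor_map R H G (p_map R H (fst p) \<sigma>) (p_map R G (snd p) \<sigma>) (b h g))"
      if "h \<in> carrier H" "g \<in> carrier G" for h g
      unfolding tensor_p_map_pure[OF \<alpha> \<sigma> that]
    proof (rule HG.finsum_cong'[OF refl])
      show "b (p_map R H (fst p) \<sigma> h) (p_map R G (snd p) \<sigma> g) =
          tensor_map R H G (p_map R H (fst p) \<sigma>) (p_map R G (snd p) \<sigma>) (b h g)"
        if p: "p \<in> splittings \<alpha>" for p
        by (rule tensor_map_pure[OF mods mods lin[OF p] \<open>h \<in> carrier H\<close> \<open>g \<in> carrier G\<close>, symmetric])
      show "(\<lambda>p. tensor_map R H G (p_map R H (fst p) \<sigma>) (p_map R G (snd p) \<sigma>) (b h g))
          \<in> splittings \<alpha> \<rightarrow> carrier HG"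
        by (rule funcsetI)
          (rule linear_map_closed[OF tensor_map_linear[OF mods mods lin] tensor_closed[OF mods that]])
    qed
    show "t \<in> carrier HG" using t by (simp add: tensor_bialgebra_sels)
  qed
qed

end

theorem proposition1p39:
  fixes R :: "'a ring"
    and H :: "('a, 'h) graded_bialgebra"
    and G :: "('a, 'g) graded_bialgebra"
    and k :: nat and \<alpha> :: "nat list" and \<sigma> :: "nat \<Rightarrow> nat"
  assumes "graded_bialgebra R H"
    and "graded_bialgebra R G"
    and "length \<alpha> = k"
    and "\<sigma> permutes {..<k}"
  shows "\<forall>t \<in> carrier (tensor_bialgebra R H G).
    p_map R (tensor_bialgebra R H G) \<alpha> \<sigma> t =
    finsum (tensor_bialgebra R H G)
      (\<lambda>(\<beta>, \<gamma>). tensor_map R H G (p_map R H \<beta> \<sigma>) (p_map R G \<gamma> \<sigma>) t)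
      {(\<beta>, \<gamma>). length \<beta> = k \<and> length \<gamma> = k \<and> map2 (+) \<beta> \<gamma> = \<alpha>}"
  using tensor_p_map[OF assms] assms(3) by (simp add: splittings_def case_prod_unfold)

end
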